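(* Let $T$ be a theory of fields in a language $L\supseteq L_{\mathrm{rings}}$. If $T$ is complete, then $\mathrm{ACF}_T$ is complete.
   Context: $L_{\mathrm{rings}}$ is the language of rings. A theory of fields is a theory in a language $L\supseteq L_{\mathrm{rings}}$ which contains all the field axioms. $\mathrm{ACF}$ is the theory of algebraically closed fields. The theory $\mathrm{ACF}_T$: let $L^P=L\cup\{P\}$ with $P$ a unary predicate. $\mathrm{ACF}_T$ is the $L^P$-theory consisting of $\mathrm{ACF}$ (for the $L_{\mathrm{rings}}$-reduct of the universe) together with: (1) $P$ is a subfield of the universe; (2) $P$ (with the induced $L$-structure) is a model of $T$; (3) for every $n$-ary function symbol $f\in L\setminus L_{\mathrm{rings}}$: if $x_0,\dots,x_{n-1}\in P$ then $f(x_0,\dots,x_{n-1})\in P$, and if some $x_i\notin P$ then $f(x_0,\dots,x_{n-1})=0$; (4) for every $n$-ary relation symbol $R\in L$, if some $x_i\notin P$ then $\lnot R(x_0,\dots,x_{n-1})$; (5) the degree of the field extension of the universe over $P$ is infinite. *)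

theory Defs
  imports Main
begin

section \<open>First-order logic\<close>

text \<open>
  A language is given by two partial functions that assign arities to the function and the
  relation symbols; their domains are the sets of symbols. Equality is a logical symbol.
\<close>

record ('f, 'r) lang =
  funs :: "'f \<rightharpoonup> nat"
  rels :: "'r \<rightharpoonup> nat"

definition sublang :: "('f, 'r) lang \<Rightarrow> ('f, 'r) lang \<Rightarrow> bool" where
  "sublang L L' \<longleftrightarrow> funs L \<subseteq>\<^sub>m funs L' \<and> rels L \<subseteq>\<^sub>m rels L'"

datatype 'f tm = Var nat | App 'f "'f tm list"

datatype ('f, 'r) fm =
    Falsum
  | Eq "'f tm" "'f tm"
  | Rel 'r "'f tm list"
  | Imp "('f, 'r) fm" "('f, 'r) fm"
  | Forall nat "('f, 'r) fm"

abbreviation Neg :: "('f, 'r) fm \<Rightarrow> ('f, 'r) fm" where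
  "Neg \<phi> \<equiv> Imp \<phi> Falsum"

abbreviation Conj :: "('f, 'r) fm \<Rightarrow> ('f, 'r) fm \<Rightarrow> ('f, 'r) fm" where
  "Conj \<phi> \<psi> \<equiv> Neg (Imp \<phi> (Neg \<psi>))"

abbreviation Exists :: "nat \<Rightarrow> ('f, 'r) fm \<Rightarrow> ('f, 'r) fm" where
  "Exists x \<phi> \<equiv> Neg (Forall x (Neg \<phi>))"

definition Conjs :: "('f, 'r) fm list \<Rightarrow> ('f, 'r) fm" where
  "Conjs \<phi>s = foldr Conj \<phi>s (Neg Falsum)"

definition Foralls :: "nat list \<Rightarrow> ('f, 'r) fm \<Rightarrow> ('f, 'r) fm" where
  "Foralls xs \<phi> = foldr Forall xs \<phi>"

definition Existss :: "nat list \<Rightarrow> ('f, 'r) fm \<Rightarrow> ('f, 'r) fm" where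
  "Existss xs \<phi> = foldr Exists xs \<phi>"

primrec fv_tm :: "'f tm \<Rightarrow> nat set" where
  "fv_tm (Var x) = {x}"
| "fv_tm (App f ts) = \<Union> (set (map fv_tm ts))"

primrec fv :: "('f, 'r) fm \<Rightarrow> nat set" where
  "fv Falsum = {}"
| "fv (Eq s t) = fv_tm s \<union> fv_tm t"
| "fv (Rel r ts) = \<Union> (set (map fv_tm ts))"
| "fv (Imp \<phi> \<psi>) = fv \<phi> \<union> fv \<psi>"
| "fv (Forall x \<phi>) = fv \<phi> - {x}"

primrec wf_tm :: "('f, 'r) lang \<Rightarrow> 'f tm \<Rightarrow> bool" where
  "wf_tm L (Var x) \<longleftrightarrow> True"
| "wf_tm L (App f ts) \<longleftrightarrow> funs L f = Some (length ts) \<and> list_all id (map (wf_tm L) ts)"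

primrec wf_fm :: "('f, 'r) lang \<Rightarrow> ('f, 'r) fm \<Rightarrow> bool" where
  "wf_fm L Falsum \<longleftrightarrow> True"
| "wf_fm L (Eq s t) \<longleftrightarrow> wf_tm L s \<and> wf_tm L t"
| "wf_fm L (Rel r ts) \<longleftrightarrow> rels L r = Some (length ts) \<and> list_all (wf_tm L) ts"
| "wf_fm L (Imp \<phi> \<psi>) \<longleftrightarrow> wf_fm L \<phi> \<and> wf_fm L \<psi>"
| "wf_fm L (Forall x \<phi>) \<longleftrightarrow> wf_fm L \<phi>"

definition sentences :: "('f, 'r) lang \<Rightarrow> ('f, 'r) fm set" where
  "sentences L = {\<phi>. wf_fm L \<phi> \<and> fv \<phi> = {}}"

text \<open>
  Interpretations of symbols outside the language, or at argument lists of the wrong length,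
  are arbitrary and never matter for formulas of the language.
\<close>

record ('u, 'f, 'r) struct =
  universe :: "'u set"
  fint :: "'f \<Rightarrow> 'u list \<Rightarrow> 'u"
  rint :: "'r \<Rightarrow> 'u list \<Rightarrow> bool"

definition is_structure :: "('f, 'r) lang \<Rightarrow> ('u, 'f, 'r) struct \<Rightarrow> bool" where
  "is_structure L M \<longleftrightarrow> universe M \<noteq> {} \<and>
     (\<forall>f n as. funs L f = Some n \<longrightarrow> length as = n \<longrightarrow> set as \<subseteq> universe M \<longrightarrow>
        fint M f as \<in> universe M)"

primrec eval_tm :: "('u, 'f, 'r) struct \<Rightarrow> (nat \<Rightarrow> 'u) \<Rightarrow> 'f tm \<Rightarrow> 'u" where
  "eval_tm M e (Var x) = e x"
| "eval_tm M e (App f ts) = fint M f (map (eval_tm M e) ts)"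

primrec sat :: "('u, 'f, 'r) struct \<Rightarrow> (nat \<Rightarrow> 'u) \<Rightarrow> ('f, 'r) fm \<Rightarrow> bool" where
  "sat M e Falsum \<longleftrightarrow> False"
| "sat M e (Eq s t) \<longleftrightarrow> eval_tm M e s = eval_tm M e t"
| "sat M e (Rel r ts) \<longleftrightarrow> rint M r (map (eval_tm M e) ts)"
| "sat M e (Imp \<phi> \<psi>) \<longleftrightarrow> (sat M e \<phi> \<longrightarrow> sat M e \<psi>)"
| "sat M e (Forall x \<phi>) \<longleftrightarrow> (\<forall>a\<in>universe M. sat M (e(x := a)) \<phi>)"

definition holds :: "('u, 'f, 'r) struct \<Rightarrow> ('f, 'r) fm \<Rightarrow> bool" where
  "holds M \<phi> \<longleftrightarrow> (\<forall>e. range e \<subseteq> universe M \<longrightarrow> sat M e \<phi>)"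

definition is_theory :: "('f, 'r) lang \<Rightarrow> ('f, 'r) fm set \<Rightarrow> bool" where
  "is_theory L T \<longleftrightarrow> T \<subseteq> sentences L"

definition is_model :: "('f, 'r) lang \<Rightarrow> ('u, 'f, 'r) struct \<Rightarrow> ('f, 'r) fm set \<Rightarrow> bool" where
  "is_model L M T \<longleftrightarrow> is_structure L M \<and> (\<forall>\<phi>\<in>T. holds M \<phi>)"

text \<open>
  HOL cannot quantify over all types inside a definition, so satisfiability and consequence are
  defined through structures whose universe is a set of formulas. By the downward
  Loewenheim-Skolem theorem, proved below, this is no restriction: see
  \<open>satisfiable_of_model\<close>, \<open>holds_of_entails\<close> and \<open>complete_elementarily_equivalent\<close>, where the
  universes of the structures are of arbitrary type.
\<close>

type_synonym ('f, 'r) fm_struct = "(('f, 'r) fm, 'f, 'r) struct"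

definition satisfiable :: "('f, 'r) lang \<Rightarrow> ('f, 'r) fm set \<Rightarrow> bool" where
  "satisfiable L T \<longleftrightarrow> (\<exists>M :: ('f, 'r) fm_struct. is_model L M T)"

definition entails :: "('f, 'r) lang \<Rightarrow> ('f, 'r) fm set \<Rightarrow> ('f, 'r) fm \<Rightarrow> bool" where
  "entails L T \<phi> \<longleftrightarrow> (\<forall>M :: ('f, 'r) fm_struct. is_model L M T \<longrightarrow> holds M \<phi>)"

definition complete_theory :: "('f, 'r) lang \<Rightarrow> ('f, 'r) fm set \<Rightarrow> bool" where
  "complete_theory L T \<longleftrightarrow> is_theory L T \<and> satisfiable L T \<and>
     (\<forall>\<phi>\<in>sentences L. entails L T \<phi> \<or> entails L T (Neg \<phi>))"


section \<open>Independence of the choice of universe\<close>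

lemma finite_fv_tm: "finite (fv_tm t)"
  by (induction t) auto

lemma finite_fv: "finite (fv \<phi>)"
  by (induction \<phi>) (auto simp: finite_fv_tm)

lemma eval_tm_cong: "(\<And>x. x \<in> fv_tm t \<Longrightarrow> e x = e' x) \<Longrightarrow> eval_tm M e t = eval_tm M e' t"
proof (induction t)
  case (App f ts)
  have "map (eval_tm M e) ts = map (eval_tm M e') ts"
  proof (rule map_cong[OF refl])
    fix t assume "t \<in> set ts"
    then show "eval_tm M e t = eval_tm M e' t" by (intro App.IH App.prems) auto
  qed
  then show ?case unfolding eval_tm.simps by (rule arg_cong)
qed simp

lemma sat_cong: "(\<And>x. x \<in> fv \<phi> \<Longrightarrow> e x = e' x) \<Longrightarrow> sat M e \<phi> \<longleftrightarrow> sat M e' \<phi>"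
proof (induction \<phi> arbitrary: e e')
  case (Eq s t)
  have "eval_tm M e s = eval_tm M e' s" by (rule eval_tm_cong) (simp add: Eq.prems)
  moreover have "eval_tm M e t = eval_tm M e' t" by (rule eval_tm_cong) (simp add: Eq.prems)
  ultimately show ?case by simp
next
  case (Rel r ts)
  then have "map (eval_tm M e) ts = map (eval_tm M e') ts"
    by (intro map_cong refl eval_tm_cong) auto
  then show ?case unfolding sat.simps by (rule arg_cong)
next
  case (Imp \<phi> \<psi>)
  have "sat M e \<phi> = sat M e' \<phi>" by (rule Imp.IH(1)) (simp add: Imp.prems)
  moreover have "sat M e \<psi> = sat M e' \<psi>" by (rule Imp.IH(2)) (simp add: Imp.prems)
  ultimately show ?case by simp
next
  case (Forall x \<phi>)
  have "sat M (e(x := a)) \<phi> = sat M (e'(x := a)) \<phi>" for a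
    by (rule Forall.IH) (use Forall.prems in auto)
  then show ?case unfolding sat.simps by (simp only:)
qed simp

lemma holds_iff_sat:
  assumes "fv \<phi> = {}" "range e \<subseteq> universe M"
  shows "holds M \<phi> \<longleftrightarrow> sat M e \<phi>"
proof -
  have "sat M e' \<phi> \<longleftrightarrow> sat M e \<phi>" for e'
    by (rule sat_cong) (simp add: assms(1))
  then show ?thesis using assms(2) unfolding holds_def by auto
qed

text \<open>
  Codes for the elements of a Skolem hull: \<open>Wit \<phi> ks\<close> with \<open>\<phi> = Forall x \<psi>\<close> denotes a
  counterexample to \<open>\<phi>\<close>, if there is one, under the assignment given by \<open>ks\<close>.
\<close>

datatype ('f, 'r) skolem = Wit "('f, 'r) fm" "('f, 'r) skolem list"

primrec encode :: "('f, 'r) skolem \<Rightarrow> ('f, 'r) fm" where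
  "encode (Wit \<phi> ks) = Imp \<phi> (foldr Imp (map encode ks) Falsum)"

lemma foldr_Imp_inject: "foldr Imp xs Falsum = foldr Imp ys Falsum \<Longrightarrow> xs = ys"
proof (induction xs arbitrary: ys)
  case Nil
  then show ?case by (cases ys) auto
next
  case (Cons x xs)
  then show ?case by (cases ys) auto
qed

lemma inj_encode: "inj (encode :: ('f, 'r) skolem \<Rightarrow> ('f, 'r) fm)"
proof (rule injI)
  fix k l :: "('f, 'r) skolem"
  show "encode k = encode l \<Longrightarrow> k = l"
  proof (induction k arbitrary: l)
    case (Wit \<phi> ks)
    obtain \<psi> ls where l: "l = Wit \<psi> ls" by (cases l)
    with Wit.prems have "map encode ks = map encode ls"
      by (auto dest: foldr_Imp_inject)
    then have "ks = ls"
      using Wit.IH by (rule list.inj_map_strong[rotated])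
    with Wit.prems l show ?case by simp
  qed
qed

definition assign :: "'u \<Rightarrow> 'u list \<Rightarrow> nat \<Rightarrow> 'u" where
  "assign d as i = (if i < length as then as ! i else d)"

fun counterexample :: "('u, 'f, 'r) struct \<Rightarrow> 'u \<Rightarrow> ('f, 'r) fm \<Rightarrow> 'u list \<Rightarrow> 'u" where
  "counterexample M d (Forall x \<phi>) as =
     (if \<exists>a\<in>universe M. \<not> sat M ((assign d as)(x := a)) \<phi>
      then SOME a. a \<in> universe M \<and> \<not> sat M ((assign d as)(x := a)) \<phi> else d)"
| "counterexample M d _ as = d"

primrec decode :: "('u, 'f, 'r) struct \<Rightarrow> 'u \<Rightarrow> ('f, 'r) skolem \<Rightarrow> 'u" where
  "decode M d (Wit \<phi> ks) = counterexample M d \<phi> (map (decode M d) ks)"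

lemma counterexample_in:
  assumes "d \<in> universe M"
  shows "counterexample M d \<phi> as \<in> universe M"
proof (cases \<phi>)
  case (Forall x \<psi>)
  show ?thesis
  proof (cases "\<exists>a\<in>universe M. \<not> sat M ((assign d as)(x := a)) \<psi>")
    case True
    then have "\<exists>a. a \<in> universe M \<and> \<not> sat M ((assign d as)(x := a)) \<psi>" by blast
    from someI_ex[OF this] Forall True show ?thesis by simp
  qed (use Forall assms in auto)
qed (use assms in auto)

lemma counterexample:
  assumes "\<exists>a\<in>universe M. \<not> sat M ((assign d as)(x := a)) \<phi>"
  shows "\<not> sat M ((assign d as)(x := counterexample M d (Forall x \<phi>) as)) \<phi>"
proof -
  have "\<exists>a. a \<in> universe M \<and> \<not> sat M ((assign d as)(x := a)) \<phi>" using assms by blast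
  from someI_ex[OF this] assms show ?thesis by simp
qed

theorem downward_Loewenheim_Skolem:
  fixes M :: "('u, 'f, 'r) struct"
  assumes M: "is_structure L M"
  shows "\<exists>N :: ('f, 'r) fm_struct. is_structure L N \<and>
           (\<forall>\<phi>\<in>sentences L. holds N \<phi> \<longleftrightarrow> holds M \<phi>)"
proof -
  obtain d where d: "d \<in> universe M" using M unfolding is_structure_def by blast
  define H where "H = range (decode M d)"
  have H: "H \<subseteq> universe M"
  proof
    fix a assume "a \<in> H"
    then obtain k where k: "a = decode M d k" unfolding H_def by blast
    show "a \<in> universe M" by (cases k) (simp add: k counterexample_in[OF d])
  qed
  have Wit: "\<exists>a\<in>H. \<not> sat M (e(x := a)) \<phi>"
    if e: "range e \<subseteq> H" and ce: "a \<in> universe M" "\<not> sat M (e(x := a)) \<phi>" for e x a \<phi>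
  proof -
    obtain n where n: "\<And>y. y \<in> fv \<phi> \<Longrightarrow> y < n"
      using finite_fv[of \<phi>] unfolding finite_nat_set_iff_bounded by blast
    define ks where "ks = map (\<lambda>i. inv (decode M d) (e i)) [0..<n]"
    have eq: "assign d (map (decode M d) ks) y = e y" if "y \<in> fv \<phi>" for y
      using n[OF that] e unfolding ks_def assign_def H_def
      by (simp add: f_inv_into_f range_subsetD)
    have same: "sat M ((assign d (map (decode M d) ks))(x := b)) \<phi> = sat M (e(x := b)) \<phi>" for b
      by (rule sat_cong) (simp add: eq)
    have "\<not> sat M ((assign d (map (decode M d) ks))
            (x := counterexample M d (Forall x \<phi>) (map (decode M d) ks))) \<phi>"
      using ce by (intro counterexample bexI[of _ a]) (simp_all only: same not_False_eq_True)
    then have "\<not> sat M (e(x := decode M d (Wit (Forall x \<phi>) ks))) \<phi>"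
      unfolding same by simp
    then show ?thesis unfolding H_def by blast
  qed
  have closed: "fint M f as \<in> H"
    if f: "funs L f = Some (length as)" and as: "set as \<subseteq> H" for f as
  proof -
    obtain h where h: "h \<in> H" unfolding H_def by blast
    define n where "n = length as"
    define \<phi> :: "('f, 'r) fm" where "\<phi> = Neg (Eq (Var n) (App f (map Var [0..<n])))"
    have ev: "eval_tm M ((assign h as)(n := a)) (App f (map Var [0..<n])) = fint M f as" for a
      by (auto simp: assign_def n_def comp_def intro!: arg_cong[where f = "fint M f"] nth_equalityI)
    have "range (assign h as) \<subseteq> H"
      using as h nth_mem[of _ as] by (auto simp: assign_def)
    moreover have "fint M f as \<in> universe M"
      using M f as H unfolding is_structure_def by blast
    moreover have "\<not> sat M ((assign h as)(n := fint M f as)) \<phi>"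
      using ev[of "fint M f as"] unfolding \<phi>_def by simp
    ultimately have "\<exists>a\<in>H. \<not> sat M ((assign h as)(n := a)) \<phi>" by (rule Wit)
    then obtain a where "a \<in> H" "\<not> sat M ((assign h as)(n := a)) \<phi>" ..
    then show ?thesis using ev[of a] unfolding \<phi>_def by simp
  qed
  define g where "g = encode \<circ> (inv (decode M d) :: 'u \<Rightarrow> ('f, 'r) skolem)"
  have g: "inj_on g H"
    unfolding g_def H_def
    by (intro comp_inj_on inj_on_inv_into) (auto intro: inj_on_subset[OF inj_encode])
  define g' where "g' = inv_into H g"
  have g': "g' (g a) = a" if "a \<in> H" for a
    using g that unfolding g'_def by simp
  have map_g': "map (g' \<circ> g) as = as" if "set as \<subseteq> H" for as
    using that g' by (intro map_idI) auto
  define N :: "('f, 'r) fm_struct" where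
    "N = \<lparr>universe = g ` H, fint = (\<lambda>f as. g (fint M f (map g' as))),
          rint = (\<lambda>r as. rint M r (map g' as))\<rparr>"
  have struct: "is_structure L N"
    unfolding is_structure_def
  proof (intro conjI allI impI)
    show "universe N \<noteq> {}" unfolding N_def H_def by simp
    fix f n as assume *: "funs L f = Some n" "length as = n" "set as \<subseteq> universe N"
    then have "set (map g' as) \<subseteq> H" unfolding N_def by (auto simp: g')
    then have "fint M f (map g' as) \<in> H" using * closed by simp
    then show "fint N f as \<in> universe N" unfolding N_def by simp
  qed
  have tm: "eval_tm M e t \<in> H \<and> eval_tm N (g \<circ> e) t = g (eval_tm M e t)"
    if e: "range e \<subseteq> H" and "wf_tm L t" for e t
    using that(2)
  proof (induction t)
    case (Var x)
    then show ?case using e by auto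
  next
    case (App f ts)
    have IH: "eval_tm M e t \<in> H" "eval_tm N (g \<circ> e) t = g (eval_tm M e t)" if "t \<in> set ts" for t
    proof -
      have "wf_tm L t" using App.prems that by (auto simp: list_all_iff)
      from App.IH[OF that this]
      show "eval_tm M e t \<in> H" "eval_tm N (g \<circ> e) t = g (eval_tm M e t)" by blast+
    qed
    have in_H: "set (map (eval_tm M e) ts) \<subseteq> H" using IH by auto
    have map_N: "map (eval_tm N (g \<circ> e)) ts = map g (map (eval_tm M e) ts)" using IH by simp
    have "eval_tm N (g \<circ> e) (App f ts) = g (fint M f (map g' (map g (map (eval_tm M e) ts))))"
      unfolding eval_tm.simps map_N by (simp add: N_def)
    also have "map g' (map g (map (eval_tm M e) ts)) = map (eval_tm M e) ts"
      using map_g'[OF in_H] by simp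
    finally show ?case using closed[OF _ in_H] App.prems by simp
  qed
  have fm: "sat N (g \<circ> e) \<phi> \<longleftrightarrow> sat M e \<phi>" if "range e \<subseteq> H" and "wf_fm L \<phi>" for e \<phi>
    using that
  proof (induction \<phi> arbitrary: e)
    case (Eq s t)
    then have "eval_tm M e s \<in> H" "eval_tm M e t \<in> H"
      "eval_tm N (g \<circ> e) s = g (eval_tm M e s)" "eval_tm N (g \<circ> e) t = g (eval_tm M e t)"
      using tm[of e s] tm[of e t] by (auto simp: o_def)
    then show ?case unfolding sat.simps by (simp only: inj_on_eq_iff[OF g])
  next
    case (Rel r ts)
    have IH: "eval_tm M e t \<in> H" "eval_tm N (g \<circ> e) t = g (eval_tm M e t)" if "t \<in> set ts" for t
      using tm[of e t] Rel.prems that by (auto simp: list_all_iff)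
    have in_H: "set (map (eval_tm M e) ts) \<subseteq> H" using IH by auto
    have map_N: "map (eval_tm N (g \<circ> e)) ts = map g (map (eval_tm M e) ts)" using IH by simp
    have "sat N (g \<circ> e) (Rel r ts) = rint M r (map g' (map g (map (eval_tm M e) ts)))"
      unfolding sat.simps map_N by (simp add: N_def)
    also have "map g' (map g (map (eval_tm M e) ts)) = map (eval_tm M e) ts"
      using map_g'[OF in_H] by simp
    finally show ?case by simp
  next
    case (Forall x \<phi>)
    have upd: "sat N ((g \<circ> e)(x := g a)) \<phi> = sat M (e(x := a)) \<phi>" if "a \<in> H" for a
    proof -
      have "(g \<circ> e)(x := g a) = g \<circ> e(x := a)" by auto
      moreover have "range (e(x := a)) \<subseteq> H" using Forall.prems(1) that by auto
      moreover have "wf_fm L \<phi>" using Forall.prems(2) by simp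
      ultimately show ?thesis using Forall.IH[of "e(x := a)"] by (simp only: simp_thms)
    qed
    have "sat N (g \<circ> e) (Forall x \<phi>) \<longleftrightarrow> (\<forall>a\<in>H. sat M (e(x := a)) \<phi>)"
      using upd by (simp add: N_def)
    also have "\<dots> \<longleftrightarrow> sat M e (Forall x \<phi>)"
    proof -
      have "\<exists>a\<in>H. \<not> sat M (e(x := a)) \<phi>" if "a \<in> universe M" "\<not> sat M (e(x := a)) \<phi>" for a
        using Wit[OF Forall.prems(1) that] .
      then show ?thesis using H unfolding sat.simps by (meson subsetD)
    qed
    finally show ?case .
  qed simp_all
  have "holds N \<phi> \<longleftrightarrow> holds M \<phi>" if "\<phi> \<in> sentences L" for \<phi>
  proof -
    obtain h where h: "h \<in> H" unfolding H_def by blast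
    define e :: "nat \<Rightarrow> 'u" where "e = (\<lambda>_. h)"
    have "range e \<subseteq> H" using h by (auto simp: e_def)
    moreover have "range (g \<circ> e) \<subseteq> universe N" using h by (auto simp: e_def N_def)
    ultimately show ?thesis
      using fm[of e \<phi>] holds_iff_sat[of \<phi> e M] holds_iff_sat[of \<phi> "g \<circ> e" N] that H
      unfolding sentences_def by auto
  qed
  with struct show ?thesis by blast
qed

corollary satisfiable_of_model:
  fixes M :: "('u, 'f, 'r) struct"
  assumes "is_theory L T" "is_model L M T"
  shows "satisfiable L T"
proof -
  obtain N :: "('f, 'r) fm_struct" where "is_structure L N"
    and "\<forall>\<phi>\<in>sentences L. holds N \<phi> \<longleftrightarrow> holds M \<phi>"
    using assms downward_Loewenheim_Skolem[of L M] by (auto simp: is_model_def)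
  then have "is_model L N T"
    using assms by (auto simp: is_theory_def is_model_def)
  then show ?thesis unfolding satisfiable_def by (rule exI)
qed

corollary holds_of_entails:
  fixes M :: "('u, 'f, 'r) struct"
  assumes "is_theory L T" "\<phi> \<in> sentences L" "entails L T \<phi>" "is_model L M T"
  shows "holds M \<phi>"
proof -
  obtain N :: "('f, 'r) fm_struct" where N: "is_structure L N"
    and iff: "\<forall>\<phi>\<in>sentences L. holds N \<phi> \<longleftrightarrow> holds M \<phi>"
    using assms downward_Loewenheim_Skolem[of L M] by (auto simp: is_model_def)
  then have "is_model L N T"
    using assms by (auto simp: is_theory_def is_model_def)
  then have "holds N \<phi>" using assms(3) unfolding entails_def by (elim allE impE)
  with iff assms(2) show ?thesis by simp
qed

lemma holds_Neg:
  assumes "is_structure L M" "fv \<phi> = {}"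
  shows "holds M (Neg \<phi>) \<longleftrightarrow> \<not> holds M \<phi>"
proof -
  obtain a where "a \<in> universe M" using assms(1) unfolding is_structure_def by blast
  then have "range (\<lambda>_::nat. a) \<subseteq> universe M" by auto
  from holds_iff_sat[OF _ this, of \<phi>] holds_iff_sat[OF _ this, of "Neg \<phi>"] assms(2)
  show ?thesis by simp
qed

corollary complete_elementarily_equivalent:
  fixes M :: "('u, 'f, 'r) struct" and N :: "('v, 'f, 'r) struct"
  assumes T: "complete_theory L T" and M: "is_model L M T" and N: "is_model L N T"
    and \<phi>: "\<phi> \<in> sentences L"
  shows "holds M \<phi> \<longleftrightarrow> holds N \<phi>"
proof -
  have th: "is_theory L T" and Neg: "Neg \<phi> \<in> sentences L"
    using T \<phi> by (auto simp: complete_theory_def sentences_def)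
  have M': "holds M (Neg \<phi>) \<longleftrightarrow> \<not> holds M \<phi>" and N': "holds N (Neg \<phi>) \<longleftrightarrow> \<not> holds N \<phi>"
    using M N \<phi> holds_Neg[of L M \<phi>] holds_Neg[of L N \<phi>]
    unfolding is_model_def sentences_def by auto
  from T \<phi> have "entails L T \<phi> \<or> entails L T (Neg \<phi>)" by (auto simp: complete_theory_def)
  then show ?thesis
  proof
    assume "entails L T \<phi>"
    from holds_of_entails[OF th \<phi> this M] holds_of_entails[OF th \<phi> this N] show ?thesis by simp
  next
    assume "entails L T (Neg \<phi>)"
    from holds_of_entails[OF th Neg this M] holds_of_entails[OF th Neg this N] M' N'
    show ?thesis by simp
  qed
qed


section \<open>The language of rings and fields\<close>

text \<open>
  A language containing the language of rings has function symbols of type \<open>'f fsym\<close>, where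
  \<open>Ext\<close> marks the symbols that are not ring operations.
\<close>

datatype 'f fsym = RZero | ROne | RNeg | RAdd | RMul | Ext 'f

definition L_rings :: "('f fsym, 'r) lang" where
  "L_rings = \<lparr>funs = [RZero \<mapsto> 0, ROne \<mapsto> 0, RNeg \<mapsto> 1, RAdd \<mapsto> 2, RMul \<mapsto> 2],
              rels = Map.empty\<rparr>"

abbreviation tzero :: "'f fsym tm" where "tzero \<equiv> App RZero []"
abbreviation tone :: "'f fsym tm" where "tone \<equiv> App ROne []"
abbreviation tneg :: "'f fsym tm \<Rightarrow> 'f fsym tm" where "tneg s \<equiv> App RNeg [s]"
abbreviation tadd :: "'f fsym tm \<Rightarrow> 'f fsym tm \<Rightarrow> 'f fsym tm" where "tadd s t \<equiv> App RAdd [s, t]"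
abbreviation tmul :: "'f fsym tm \<Rightarrow> 'f fsym tm \<Rightarrow> 'f fsym tm" where "tmul s t \<equiv> App RMul [s, t]"

definition tsum :: "'f fsym tm list \<Rightarrow> 'f fsym tm" where
  "tsum ts = foldr tadd ts tzero"

primrec tpow :: "'f fsym tm \<Rightarrow> nat \<Rightarrow> 'f fsym tm" where
  "tpow t 0 = tone"
| "tpow t (Suc n) = tmul t (tpow t n)"

definition field_axioms :: "('f fsym, 'r) fm set" where
  "field_axioms =
     (let x = Var 0; y = Var 1; z = Var 2 in
      {Foralls [0, 1, 2] (Eq (tadd (tadd x y) z) (tadd x (tadd y z))),
       Foralls [0, 1] (Eq (tadd x y) (tadd y x)),
       Foralls [0] (Eq (tadd x tzero) x),
       Foralls [0] (Eq (tadd x (tneg x)) tzero),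
       Foralls [0, 1, 2] (Eq (tmul (tmul x y) z) (tmul x (tmul y z))),
       Foralls [0, 1] (Eq (tmul x y) (tmul y x)),
       Foralls [0] (Eq (tmul x tone) x),
       Foralls [0, 1, 2] (Eq (tmul x (tadd y z)) (tadd (tmul x y) (tmul x z))),
       Neg (Eq tzero tone),
       Foralls [0] (Imp (Neg (Eq x tzero)) (Exists 1 (Eq (tmul x y) tone)))})"

definition theory_of_fields :: "('f fsym, 'r) lang \<Rightarrow> ('f fsym, 'r) fm set \<Rightarrow> bool" where
  "theory_of_fields L T \<longleftrightarrow> sublang L_rings L \<and> is_theory L T \<and> field_axioms \<subseteq> T"

text \<open>Every polynomial \<open>x\<^sup>n + y\<^sub>n\<^sub>-\<^sub>1 x\<^sup>n\<^sup>-\<^sup>1 + \<dots> + y\<^sub>0\<close> has a root; \<open>x\<close> is variable \<open>n\<close>, \<open>y\<^sub>i\<close> is variable \<open>i\<close>.\<close>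

definition monic_root :: "nat \<Rightarrow> ('f fsym, 'r) fm" where
  "monic_root n = Foralls [0..<n] (Exists n
     (Eq (tadd (tpow (Var n) n) (tsum (map (\<lambda>i. tmul (Var i) (tpow (Var n) i)) [0..<n]))) tzero))"

definition ACF :: "('f fsym, 'r) fm set" where
  "ACF = field_axioms \<union> {monic_root n | n. 1 \<le> n}"


section \<open>The theory ACF with a predicate for a model of T\<close>

datatype 'r psym = P | Base 'r

definition lang_P :: "('f, 'r) lang \<Rightarrow> ('f, 'r psym) lang" where
  "lang_P L = \<lparr>funs = funs L, rels = (\<lambda>s. case s of P \<Rightarrow> Some 1 | Base r \<Rightarrow> rels L r)\<rparr>"

abbreviation inP :: "'f tm \<Rightarrow> ('f, 'r psym) fm" where
  "inP t \<equiv> Rel P [t]"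

definition subfield_axioms :: "('f fsym, 'r psym) fm set" where
  "subfield_axioms =
     (let x = Var 0; y = Var 1 in
      {inP tzero, inP tone,
       Foralls [0, 1] (Imp (inP x) (Imp (inP y) (inP (tadd x y)))),
       Foralls [0] (Imp (inP x) (inP (tneg x))),
       Foralls [0, 1] (Imp (inP x) (Imp (inP y) (inP (tmul x y)))),
       Foralls [0] (Imp (inP x) (Imp (Neg (Eq x tzero))
         (Exists 1 (Conj (inP y) (Eq (tmul x y) tone)))))})"

primrec relativize :: "('f, 'r) fm \<Rightarrow> ('f, 'r psym) fm" where
  "relativize Falsum = Falsum"
| "relativize (Eq s t) = Eq s t"
| "relativize (Rel r ts) = Rel (Base r) ts"
| "relativize (Imp \<phi> \<psi>) = Imp (relativize \<phi>) (relativize \<psi>)"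
| "relativize (Forall x \<phi>) = Forall x (Imp (inP (Var x)) (relativize \<phi>))"

definition function_axioms :: "('f fsym, 'r) lang \<Rightarrow> ('f fsym, 'r psym) fm set" where
  "function_axioms L =
     (\<Union>(f, n) \<in> {(f, n). funs L f = Some n \<and> f \<notin> dom (funs (L_rings :: ('f fsym, 'r) lang))}.
        let xs = map Var [0..<n]; all_inP = Conjs (map inP xs) in
        {Foralls [0..<n] (Imp all_inP (inP (App f xs))),
         Foralls [0..<n] (Imp (Neg all_inP) (Eq (App f xs) tzero))})"

definition relation_axioms :: "('f fsym, 'r) lang \<Rightarrow> ('f fsym, 'r psym) fm set" where
  "relation_axioms L =
     {let xs = map Var [0..<n] in
        Foralls [0..<n] (Imp (Neg (Conjs (map inP xs))) (Neg (Rel (Base r) xs)))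
      | r n. rels L r = Some n}"

text \<open>There are \<open>n\<close> elements that are linearly independent over \<open>P\<close>.\<close>

definition degree_ge :: "nat \<Rightarrow> ('f fsym, 'r psym) fm" where
  "degree_ge n =
     (let xs = map Var [0..<n]; ys = map Var [n..<2 * n] in
      Existss [0..<n] (Foralls [n..<2 * n]
        (Imp (Conjs (map inP ys))
          (Imp (Eq (tsum (map2 tmul ys xs)) tzero)
            (Conjs (map (\<lambda>y. Eq y tzero) ys))))))"

definition ACF_T ::
  "('f fsym, 'r) lang \<Rightarrow> ('f fsym, 'r) fm set \<Rightarrow> ('f fsym, 'r psym) fm set" where
  "ACF_T L T = ACF \<union> subfield_axioms \<union> relativize ` T \<union> function_axioms L \<union>
     relation_axioms L \<union> range degree_ge"

text \<open>Relativization expresses truth in the induced structure on \<open>P\<close>.\<close>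

definition induced :: "('u, 'f, 'r psym) struct \<Rightarrow> ('u, 'f, 'r) struct" where
  "induced M = \<lparr>universe = {a \<in> universe M. rint M P [a]}, fint = fint M,
                rint = (\<lambda>r. rint M (Base r))\<rparr>"

lemma eval_tm_induced: "eval_tm (induced M) e t = eval_tm M e t"
  by (induction t) (auto simp: induced_def cong: map_cong)

lemma sat_relativize: "sat M e (relativize \<phi>) \<longleftrightarrow> sat (induced M) e \<phi>"
proof (induction \<phi> arbitrary: e)
  case (Rel r ts)
  then show ?case by (simp add: eval_tm_induced cong: map_cong) (simp add: induced_def)
next
  case (Forall x \<phi>)
  have "a \<in> universe (induced M) \<longleftrightarrow> a \<in> universe M \<and> rint M P [a]" for a
    by (simp add: induced_def)
  then show ?case by (auto simp: Forall.IH fun_upd_same simp del: fun_upd_apply)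
qed (simp_all add: eval_tm_induced)

end

theory Submission
  imports Defs "HOL-Algebra.Algebraic_Closure" "HOL-Algebra.UnivPoly" "HOL-Library.Countable_Set"
begin

text \<open>
  Two models of \<open>ACF_T\<close> are elementarily equivalent: a sentence involves only finitely many symbols,
  so the language may be taken finite. After passing to ultrapowers the models are
  \<open>\<aleph>\<^sub>1\<close>-saturated, and as the degree over the predicate is infinite, there are elements that are
  transcendental over any given finitely generated extension of the predicate. Since \<open>T\<close> is complete, the
  predicates are elementarily equivalent, so alternating between the two sides yields countable
  elementary submodels that still have these transcendental elements and whose predicates are
  isomorphic. Isomorphisms of finitely generated subrings over the predicates that extend this
  isomorphism have the back-and-forth property: an algebraic element is matched by a root of the
  transported polynomial, and a transcendental one by another transcendental one.

  For satisfiability, let \<open>K\<close> be a model of \<open>T\<close>. In an ultrapower of the algebraic closure of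
  \<open>K\<close> take the diagonal copy of \<open>K\<close> as the predicate; the class of an injective sequence is
  transcendental over it.
\<close>

section \<open>Elements of large degree\<close>

text \<open>Infinite degree only yields long linearly independent tuples, whereas a transcendental
  element of an ultrapower needs single elements of unbounded degree over each finitely generated
  extension. For arbitrary extensions this step fails: a purely inseparable extension of infinite
  degree may have elements of bounded degree only. Algebraic closedness of the universe must
  therefore enter, and it does so through roots of high order, in all characteristics at once.
  Saturation alone does not make elementarily equivalent predicates isomorphic; countable submodels
  are used because their elements can be enumerated and matched one by one. Being transcendental is
  not expressed by a single formula, so elementarity does not transfer it: it is carried along as an
  additional closure condition of the chain. The partial maps live on subrings instead of fields.
  This avoids fractions, at the price of dividing polynomials only up to powers of leading
  coefficients.\<close>

lemma (in algebraically_closed) exists_root: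
  assumes "p \<in> carrier (poly_ring L)" "1 \<le> degree p"
  shows "\<exists>x\<in>carrier L. eval p x = \<zero>"
proof -
  have "size (roots p) = degree p" using roots_over_carrier[OF assms(1)] unfolding splitted_def .
  then have "roots p \<noteq> {#}" using assms(2) by auto
  then obtain x where "x \<in># roots p" by blast
  then show ?thesis using roots_mem_iff_is_root[OF assms(1)] unfolding is_root_def by blast
qed

lemma (in algebraically_closed) exists_nth_root:
  assumes "a \<in> carrier L" "1 \<le> (n::nat)"
  shows "\<exists>x\<in>carrier L. x [^] n = a"
proof -
  define p where "p = \<one> # replicate (n - 1) \<zero> @ [\<ominus> a]"
  have p: "set p \<subseteq> carrier L" using assms by (auto simp: p_def)
  have "p \<in> carrier (poly_ring L)"
    using p unfolding univ_poly_def polynomial_def by (auto simp: p_def)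
  moreover have "1 \<le> degree p" using assms by (simp add: p_def)
  ultimately obtain x where x: "x \<in> carrier L" "eval p x = \<zero>" using exists_root by blast
  have "eval p x = x [^] n \<oplus> eval (replicate (n - 1) \<zero> @ [\<ominus> a]) x"
    using assms x by (simp add: p_def)
  also have "eval (replicate (n - 1) \<zero> @ [\<ominus> a]) x = \<ominus> a"
    using eval_replicate[of "[\<ominus> a]" x "n - 1"] assms x by simp
  finally have "x [^] n \<oplus> \<ominus> a = \<zero>" using x by simp
  then show ?thesis using x assms by (metis nat_pow_closed minus_equality minus_minus a_inv_closed)
qed

text \<open>Polynomials are lists of coefficients, so length at most \<open>n\<close> means degree less than \<open>n\<close>.\<close>

definition (in ring) alg_le :: "'a set \<Rightarrow> nat \<Rightarrow> 'a \<Rightarrow> bool" where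
  "alg_le K n x \<longleftrightarrow> (\<exists>p. set p \<subseteq> K \<and> \<not> set p \<subseteq> {\<zero>} \<and> length p \<le> n \<and> eval p x = \<zero>)"

lemma (in ring) normalize_Nil_iff: "normalize p = [] \<longleftrightarrow> set p \<subseteq> {\<zero>}"
  by (induction p) auto

text \<open>\<open>alg_le\<close> admits leading zeros, which suits the coordinatewise argument in
  the ultrapower. Stripping them yields a genuine polynomial without increasing the length.\<close>

lemma (in domain) alg_leE:
  assumes "subring K R" "x \<in> carrier R" "alg_le K n x"
  obtains p where "p \<in> carrier (K[X])" "p \<noteq> []" "length p \<le> n" "eval p x = \<zero>"
proof -
  obtain p where p: "set p \<subseteq> K" "\<not> set p \<subseteq> {\<zero>}" "length p \<le> n" "eval p x = \<zero>"
    using assms(3) unfolding alg_le_def by blast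
  have "set p \<subseteq> carrier R" using p subringE(1)[OF assms(1)] by blast
  then have "eval (normalize p) x = \<zero>" using eval_normalize assms(2) p by simp
  moreover have "normalize p \<in> carrier (K[X])"
    using normalize_gives_polynomial[OF p(1)] univ_poly_carrier by blast
  moreover have "length (normalize p) \<le> n" using normalize_length_le[of p] p by simp
  ultimately show ?thesis using that p normalize_Nil_iff by blast
qed

lemma (in domain) alg_le_imp_algebraic:
  assumes "subring K R" "x \<in> carrier R" "alg_le K n x"
  shows "(algebraic over K) x"
  using alg_leE[OF assms] algebraicI by (metis over_def)

lemma (in domain) degree_Irr_less:
  assumes "subfield K R" "x \<in> carrier R" "alg_le K n x"
  shows "degree (Irr K x) < n"
proof -
  note K = subfieldE(1)[OF assms(1)]
  obtain p where p: "p \<in> carrier (K[X])" "p \<noteq> []" "length p \<le> n" "eval p x = \<zero>"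
    using alg_leE[OF K assms(2,3)] .
  note alg = alg_le_imp_algebraic[OF K assms(2,3)]
  have "(Irr K x) pdivides p" using Irr_minimal[OF assms(1,2) alg p(1,4)] .
  then have "degree (Irr K x) \<le> degree p"
    using pdivides_imp_degree_le[OF K IrrE(1)[OF assms(1,2) alg] p(1,2)] by blast
  then show ?thesis using p by (cases p) auto
qed

section \<open>Unbounded degrees survive finitely generated extensions\<close>

text \<open>The powers of \<open>b\<close> with exponents 0 to m are m + 1 vectors in a space of
  dimension m. As \<open>exp_base\<close> lists them from the highest down, a dependence relation is
  literally a coefficient list for \<open>eval\<close>.\<close>

lemma (in domain) dimension_imp_alg_le:
  assumes "subfield K R" "dimension m K E" "\<And>i. b [^] (i::nat) \<in> E" "b \<in> carrier R"
  shows "alg_le K (Suc m) b"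
proof -
  have "set (exp_base b (Suc m)) \<subseteq> E" using assms(3) by (auto simp: exp_base_def)
  moreover have "length (exp_base b (Suc m)) = Suc m" by (simp add: exp_base_def)
  ultimately have "dependent K (exp_base b (Suc m))"
    using independent_length_le_dimension[OF assms(1,2)] by fastforce
  then obtain Ks where Ks: "length Ks = length (exp_base b (Suc m))"
    "combine Ks (exp_base b (Suc m)) = \<zero>" "set Ks \<subseteq> K" "set Ks \<noteq> {\<zero>}"
    using dependent_imp_non_trivial_combine[OF assms(1) exp_base_closed[OF assms(4)]] by metis
  have len: "length Ks = Suc m" using Ks(1) by (simp add: exp_base_def)
  have "eval Ks b = \<zero>" using Ks(2) combine_eq_eval[of Ks b] len by simp
  moreover have "\<not> set Ks \<subseteq> {\<zero>}" using Ks(4) len by (cases Ks) auto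
  ultimately show ?thesis unfolding alg_le_def using Ks(3) len by (metis order_refl)
qed

text \<open>By contraposition: if all degrees over K(x) are below n, then K(x)(b) has dimension at
  most e n over K, where e is the degree of x, and so the degrees over K are bounded too.\<close>

lemma (in domain) unbounded_simple_extension:
  assumes K: "subfield K R" and x: "x \<in> carrier R" "(algebraic over K) x"
    and unb: "\<And>n. \<exists>b\<in>carrier R. \<not> alg_le K n b"
  shows "\<exists>b\<in>carrier R. \<not> alg_le (simple_extension K x) n b"
proof (rule ccontr)
  let ?K' = "simple_extension K x"
  assume "\<not> ?thesis"
  then have le: "\<And>b. b \<in> carrier R \<Longrightarrow> alg_le ?K' n b" by blast
  have K': "subfield ?K' R" using simple_extension_is_subfield[OF K x(1)] x(2) by blast
  define e where "e = degree (Irr K x)"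
  have e: "dimension e K ?K'" unfolding e_def by (rule dimension_simple_extension[OF K x])
  have "alg_le K (Suc (e * n)) b" if b: "b \<in> carrier R" for b
  proof -
    have alg: "(algebraic over ?K') b"
      using alg_le_imp_algebraic[OF subfieldE(1)[OF K'] b le[OF b]] .
    have d: "degree (Irr ?K' b) < n" using degree_Irr_less[OF K' b le[OF b]] .
    have dim: "dimension (e * degree (Irr ?K' b)) K (simple_extension ?K' b)"
      using telescopic_base[OF K K' e dimension_simple_extension[OF K' b alg]] .
    have sub: "subring (simple_extension ?K' b) R"
      using simple_extension_is_subring[OF subfieldE(1)[OF K'] b] .
    have mem: "b \<in> simple_extension ?K' b"
      using simple_extension_mem[OF subfieldE(1)[OF K'] b] .
    have "b [^] (i::nat) \<in> simple_extension ?K' b" for i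
      by (induction i) (use subringE[OF sub] mem in auto)
    from dimension_imp_alg_le[OF K dim this b]
    have "alg_le K (Suc (e * degree (Irr ?K' b))) b" .
    moreover have "Suc (e * degree (Irr ?K' b)) \<le> Suc (e * n)" using d by simp
    ultimately show ?thesis unfolding alg_le_def by (meson order_trans)
  qed
  then show False using unb by blast
qed

text \<open>An element of K[y^m] is a polynomial in y^m, and rewriting it in terms of y multiplies
  degrees by m. The divisibility is what prevents cancellation in the next lemma.\<close>

lemma (in domain) simple_extension_power_poly:
  assumes K: "subfield K R" and y: "y \<in> carrier R" and m: "1 \<le> (m::nat)"
    and u: "u \<in> simple_extension K (y [^] m)"
  shows "\<exists>q\<in>carrier (K[X]). eval q y = u \<and> (q = [] \<or> m dvd degree q)"
  using u
proof (induction u rule: simple_extension.induct)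
  case zero
  then show ?case using univ_poly_zero_closed by (intro bexI[of _ "[]"]) auto
next
  case (lin k1 k2)
  note KR = subringE(1)[OF subfieldE(1)[OF K]]
  have k2: "k2 \<in> carrier R" using lin KR by blast
  obtain q where q: "q \<in> carrier (K[X])" "eval q y = k1" "q = [] \<or> m dvd degree q"
    using lin.IH by blast
  show ?case
  proof (cases "q = []")
    case True
    show ?thesis
    proof (cases "k2 = \<zero>")
      case True
      then show ?thesis using \<open>q = []\<close> q y by (intro bexI[of _ "[]"]) auto
    next
      case False
      then have "[k2] \<in> carrier (K[X])" using lin by (auto simp: univ_poly_def polynomial_def)
      then show ?thesis using \<open>q = []\<close> q y k2 by (intro bexI[of _ "[k2]"]) auto
    qed
  next
    case False
    \<comment> \<open>Multiplying by y^m and adding \<open>k2\<close> appends m coefficients: m - 1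
      zeros and \<open>k2\<close>.\<close>
    let ?r = "q @ (replicate (m - 1) \<zero> @ [k2])"
    have z: "\<zero> \<in> K" using subringE(2)[OF subfieldE(1)[OF K]] .
    have qK: "set q \<subseteq> K" "hd q \<noteq> \<zero>"
      using q(1) False by (auto simp: univ_poly_def polynomial_def)
    have "?r \<in> carrier (K[X])"
      using qK False lin z by (auto simp: univ_poly_def polynomial_def)
    moreover have "eval ?r y = k1 \<otimes> (y [^] m) \<oplus> k2"
    proof -
      have "eval ?r y = eval q y \<otimes> (y [^] length (replicate (m - 1) \<zero> @ [k2]))
          \<oplus> eval (replicate (m - 1) \<zero> @ [k2]) y"
        using qK KR k2 y by (intro eval_append) auto
      moreover have "eval (replicate (m - 1) \<zero> @ [k2]) y = k2"
        using eval_replicate[of "[k2]" y "m - 1"] k2 y by simp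
      ultimately show ?thesis using q m by simp
    qed
    moreover have "degree ?r = degree q + m" using False m by (cases q) auto
    ultimately show ?thesis using q(3) False by (intro bexI[of _ ?r]) auto
  qed
qed

text \<open>Nonzero summands \<open>c\<^sub>i y\<^sup>i\<close> have degrees in \<open>y\<close> that differ modulo \<open>m\<close>, so they cannot cancel.\<close>

lemma (in domain) simple_extension_power_independent:
  assumes K: "subfield K R" and y: "y \<in> carrier R" and m: "1 \<le> (m::nat)"
    and cs: "set cs \<subseteq> simple_extension K (y [^] m)" "length cs \<le> m"
  shows "\<exists>q\<in>carrier (K[X]). eval q y = eval cs y \<and>
    (if q = [] then set cs \<subseteq> {\<zero>} else degree q mod m < length cs)"
  using cs
proof (induction cs)
  case Nil
  then show ?case using univ_poly_zero_closed by (intro bexI[of _ "[]"]) auto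
next
  case (Cons c cs)
  note KR = subringE(1)[OF subfieldE(1)[OF K]]
  note Kp = subfieldE(1)[OF K]
  obtain q where q: "q \<in> carrier (K[X])" "eval q y = eval cs y"
    "if q = [] then set cs \<subseteq> {\<zero>} else degree q mod m < length cs"
    using Cons by auto
  obtain r where r: "r \<in> carrier (K[X])" "eval r y = c" "r = [] \<or> m dvd degree r"
    using simple_extension_power_poly[OF K y m] Cons.prems by (metis list.set_intros(1) subsetD)
  have rK: "set r \<subseteq> carrier R" "set q \<subseteq> carrier R"
    using r(1) q(1) KR by (auto simp: univ_poly_def polynomial_def)
  show ?case
  proof (cases "r = []")
    case True
    then have "c = \<zero>" using r by simp
    moreover have "eval cs y \<in> carrier R" using q rK y eval_in_carrier by metis
    ultimately show ?thesis using q y by (intro bexI[of _ q]) auto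
  next
    case False
    \<comment> \<open>The head \<open>c\<close> is the coefficient of the power with exponent
      \<open>length cs\<close>. The degree of \<open>?s\<close> is thus \<open>length cs\<close>
      modulo m, whereas a nonzero \<open>q\<close> has a smaller residue, so the lengths
      differ.\<close>
    let ?s = "r @ replicate (length cs) \<zero>"
    have s: "?s \<in> carrier (K[X])"
      using r(1) False subringE(2)[OF Kp] by (auto simp: univ_poly_def polynomial_def)
    have ev: "eval ?s y = c \<otimes> (y [^] length cs)"
    proof -
      have "eval ?s y = eval r y \<otimes> (y [^] length (replicate (length cs) \<zero>)) \<oplus> eval (replicate (length cs) \<zero>) y"
        using rK y by (intro eval_append) auto
      moreover have "eval (replicate (length cs) \<zero>) y = \<zero>"
        using eval_replicate[of "[]" y "length cs"] y by simp
      moreover have "c \<in> carrier R" using r(2) rK y eval_in_carrier by metis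
      ultimately show ?thesis using r y by simp
    qed
    have deg: "degree ?s = degree r + length cs" using False by (cases r) auto
    have lt: "length cs < m" using Cons.prems by simp
    have mod_s: "degree ?s mod m = length cs"
      using r(3) False lt unfolding deg by auto
    let ?t = "poly_add ?s q"
    have t: "?t \<in> carrier (K[X])"
      using poly_add_closed[OF Kp] s q(1) unfolding univ_poly_carrier[symmetric] by blast
    have evt: "eval ?t y = c \<otimes> (y [^] length cs) \<oplus> eval cs y"
      proof -
      have "set ?s \<subseteq> carrier R" using rK by auto
      from eval_poly_add[OF this rK(2) y] show ?thesis unfolding ev q(2) .
    qed
    have len: "length ?t = max (length ?s) (length q)"
    proof (rule poly_add_length_eq[OF Kp])
      show "polynomial K ?s" "polynomial K q" using s q(1) unfolding univ_poly_carrier by auto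
      show "length ?s \<noteq> length q"
      proof
        assume eq: "length ?s = length q"
        then have "q \<noteq> []" using False by auto
        then have "degree q mod m < length cs" using q(3) by simp
        then show False using mod_s eq by simp
      qed
    qed
    have ne: "?t \<noteq> []"
    proof
      assume "?t = []"
      then have "max (length ?s) (length q) = 0" using len by (metis list.size(3))
      then show False using False by auto
    qed
    have "degree ?t mod m < length (c # cs)"
    proof (cases "length q \<le> length ?s")
      case True
      then show ?thesis using len mod_s by simp
    next
      case F: False
      then have "q \<noteq> []" by auto
      then show ?thesis using F q(3) len by (simp add: max_def split: if_splits)
    qed
    then show ?thesis using t evt ne by (intro bexI[of _ ?t]) auto
  qed
qed

text \<open>The fraction field of \<open>S\<close> inside \<open>R\<close>. It is described by
  denominators because the coefficients of a polynomial will have to be multiplied back into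
  \<open>S\<close>.\<close>

lemma (in field) subfield_fractions:
  assumes S: "subring S R"
  shows "subfield {u \<in> carrier R. \<exists>d\<in>S. d \<noteq> \<zero> \<and> d \<otimes> u \<in> S} R" (is "subfield ?F R")
proof (rule subfieldI')
  note S' = subringE[OF S]
  show "subring ?F R"
  proof (rule subringI)
    show "\<one> \<in> ?F" using S' by (auto intro!: bexI[of _ \<one>])
    fix h assume "h \<in> ?F"
    then obtain d where d: "d \<in> S" "d \<noteq> \<zero>" "d \<otimes> h \<in> S" "h \<in> carrier R" by auto
    then have "d \<otimes> \<ominus> h = \<ominus> (d \<otimes> h)" using S'(1) by (auto intro: r_minus)
    then have "d \<otimes> \<ominus> h \<in> S" using S'(5)[OF d(3)] by simp
    then show "\<ominus> h \<in> ?F" using d by auto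
  next
    fix h k assume "h \<in> ?F" "k \<in> ?F"
    then obtain d e where d: "d \<in> S" "d \<noteq> \<zero>" "d \<otimes> h \<in> S" "h \<in> carrier R"
      and e: "e \<in> S" "e \<noteq> \<zero>" "e \<otimes> k \<in> S" "k \<in> carrier R" by auto
    have c: "d \<in> carrier R" "e \<in> carrier R" using d e S'(1) by auto
    have de: "d \<otimes> e \<in> S" "d \<otimes> e \<noteq> \<zero>" using d e S' integral[OF _ c] by blast+
    have "(d \<otimes> e) \<otimes> (h \<otimes> k) = (d \<otimes> h) \<otimes> (e \<otimes> k)" using c d e by (simp add: m_ac)
    then have "(d \<otimes> e) \<otimes> (h \<otimes> k) \<in> S" using d e S' by simp
    then show "h \<otimes> k \<in> ?F" using de d e by blast
    have "(d \<otimes> e) \<otimes> (h \<oplus> k) = e \<otimes> (d \<otimes> h) \<oplus> d \<otimes> (e \<otimes> k)" using c d e by (simp add: m_ac r_distr)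
    then have "(d \<otimes> e) \<otimes> (h \<oplus> k) \<in> S" using d e S' by simp
    then show "h \<oplus> k \<in> ?F" using de d e by blast
  qed auto
  fix k assume k: "k \<in> ?F - {\<zero>}"
  then obtain d where d: "d \<in> S" "d \<noteq> \<zero>" "d \<otimes> k \<in> S" "k \<in> carrier R" "k \<noteq> \<zero>" by auto
  then have c: "d \<in> carrier R" "inv k \<in> carrier R" using S'(1) by (auto simp: field_Units)
  have "(d \<otimes> k) \<otimes> inv k = d" using c d by (simp add: m_assoc field_Units)
  moreover have "d \<otimes> k \<noteq> \<zero>" using c d integral by blast
  ultimately show "inv k \<in> ?F" using d c by auto
qed

lemma (in domain) clear_denominators:
  assumes S: "subring S R"
    and p: "\<forall>u\<in>set p. u \<in> carrier R \<and> (\<exists>d\<in>S. d \<noteq> \<zero> \<and> d \<otimes> u \<in> S)"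
  shows "\<exists>d\<in>S. d \<noteq> \<zero> \<and> (\<forall>u\<in>set p. d \<otimes> u \<in> S)"
  using p
proof (induction p)
  case Nil
  then show ?case using subringE[OF S] by (auto intro!: bexI[of _ \<one>])
next
  case (Cons a p)
  note S' = subringE[OF S]
  obtain d where d: "d \<in> S" "d \<noteq> \<zero>" "\<forall>u\<in>set p. d \<otimes> u \<in> S" using Cons by auto
  obtain e where e: "e \<in> S" "e \<noteq> \<zero>" "e \<otimes> a \<in> S" using Cons by auto
  have c: "d \<in> carrier R" "e \<in> carrier R" using d e S'(1) by auto
  have "(d \<otimes> e) \<otimes> u \<in> S" if u: "u \<in> set (a # p)" for u
  proof (cases "u = a")
    case True
    then show ?thesis using d e c Cons.prems S' by (simp add: m_assoc)
  next
    case False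
    then have "(d \<otimes> e) \<otimes> u = e \<otimes> (d \<otimes> u)" using c u Cons.prems by (auto simp: m_ac)
    then show ?thesis using False u d e S' by auto
  qed
  moreover have "d \<otimes> e \<in> S" "d \<otimes> e \<noteq> \<zero>" using d e S' integral[OF _ c] by blast+
  ultimately show ?case by blast
qed

lemma (in ring) eval_smult:
  assumes "set p \<subseteq> carrier R" "x \<in> carrier R" "d \<in> carrier R"
  shows "eval (map ((\<otimes>) d) p) x = d \<otimes> eval p x"
  using assms
proof (induction p)
  case (Cons a p)
  then show ?case using eval_in_carrier[of p x] by (simp add: m_assoc r_distr)
qed auto

text \<open>An (n+1)-th root y of x is the witness. After clearing denominators, a relation of
  length at most n has coefficients in K[y^(n+1)]; these summands cannot cancel, so a nontrivial
  relation would make y, and hence x, algebraic over K. The exponent n + 1 also covers n =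
  0.\<close>

lemma (in algebraically_closed) unbounded_transcendental_extension:
  assumes K: "subfield K L" and x: "x \<in> carrier L" "(transcendental over K) x"
    and F: "F = {u \<in> carrier L. \<exists>d\<in>simple_extension K x. d \<noteq> \<zero> \<and> d \<otimes> u \<in> simple_extension K x}"
  shows "\<exists>b\<in>carrier L. \<not> alg_le F n b"
proof -
  note Kp = subfieldE(1)[OF K]
  note S = simple_extension_is_subring[OF Kp x(1)]
  obtain y where y: "y \<in> carrier L" "y [^] Suc n = x" using exists_nth_root[OF x(1), of "Suc n"] by auto
  have ty: "(transcendental over K) y"
  proof (rule ccontr)
    assume a: "\<not> (transcendental over K) y"
    then have alg: "(algebraic over K) y" by (simp add: over_def)
    have sub: "subring (simple_extension K y) L" using simple_extension_is_subring[OF Kp y(1)] .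
    have "y [^] (i::nat) \<in> simple_extension K y" for i
      by (induction i) (use subringE[OF sub] simple_extension_mem[OF Kp y(1)] in auto)
    then have "x \<in> simple_extension K y" using y(2) by metis
    then have "(algebraic over K) x" using simple_extesion_mem_imp_algebraic[OF K y(1) alg] by blast
    then show False using x(2) by (simp add: over_def)
  qed
  have "\<not> alg_le F n y"
  proof
    assume "alg_le F n y"
    then obtain p where p: "set p \<subseteq> F" "\<not> set p \<subseteq> {\<zero>}" "length p \<le> n" "eval p y = \<zero>"
      unfolding alg_le_def by blast
    then have pL: "set p \<subseteq> carrier L" unfolding F by auto
    obtain d where d: "d \<in> simple_extension K x" "d \<noteq> \<zero>" "\<forall>u\<in>set p. d \<otimes> u \<in> simple_extension K x"
      using clear_denominators[OF S, of p] p(1) unfolding F by auto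
    have dL: "d \<in> carrier L" using d(1) subringE(1)[OF S] by blast
    let ?p = "map ((\<otimes>) d) p"
    have "eval ?p y = \<zero>" using eval_smult[OF pL y(1) dL] p(4) dL by simp
    moreover obtain q where q: "q \<in> carrier (K[X])" "eval q y = eval ?p y"
      "if q = [] then set ?p \<subseteq> {\<zero>} else degree q mod Suc n < length ?p"
      using simple_extension_power_independent[OF K y(1), of "Suc n" ?p] d(3) p(3) y(2) by auto
    ultimately have "q = []" using eval_transcendental[OF ty q(1)] by simp
    then have "set ?p \<subseteq> {\<zero>}" using q(3) by simp
    then have "set p \<subseteq> {\<zero>}" using d(2) dL pL by (auto dest: integral)
    then show False using p(2) by blast
  qed
  then show ?thesis using y by blast
qed

lemma (in algebraically_closed) unbounded_finite_extension:
  assumes "subfield K L" "\<And>n. \<exists>b\<in>carrier L. \<not> alg_le K n b" "set xs \<subseteq> carrier L"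
  shows "\<exists>b\<in>carrier L. \<not> alg_le (finite_extension K xs) n b"
proof -
  \<comment> \<open>With a transcendental generator, \<open>finite_extension K xs\<close> is only a
    ring. The induction therefore carries a field that contains it: K'[x] in the algebraic case, its
    fraction field in the other. More coefficients only make the claim stronger.\<close>
  have "\<exists>K'. subfield K' L \<and> finite_extension K xs \<subseteq> K' \<and> (\<forall>n. \<exists>b\<in>carrier L. \<not> alg_le K' n b)"
    using assms(3)
  proof (induction xs)
    case Nil
    then show ?case using assms(1,2) by auto
  next
    case (Cons x xs)
    then obtain K' where K': "subfield K' L" "finite_extension K xs \<subseteq> K'"
      "\<And>n. \<exists>b\<in>carrier L. \<not> alg_le K' n b" by auto
    have x: "x \<in> carrier L" using Cons.prems by simp
    note Kp = subfieldE(1)[OF K'(1)]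
    have sub: "finite_extension K (x # xs) \<subseteq> simple_extension K' x"
      using mono_simple_extension[OF K'(2)] by simp
    show ?case
    proof (cases "(algebraic over K') x")
      case True
      then show ?thesis
        using unbounded_simple_extension[OF K'(1) x True K'(3)] sub
          simple_extension_is_subfield[OF K'(1) x] by blast
    next
      case False
      then have t: "(transcendental over K') x" by (simp add: over_def)
      note S = simple_extension_is_subring[OF Kp x]
      define F where F: "F = {u \<in> carrier L. \<exists>d\<in>simple_extension K' x. d \<noteq> \<zero> \<and> d \<otimes> u \<in> simple_extension K' x}"
      have "simple_extension K' x \<subseteq> F"
        using subringE[OF S] unfolding F by (auto intro!: bexI[of _ \<one>])
      then show ?thesis
        using unbounded_transcendental_extension[OF K'(1) x t F] sub subfield_fractions[OF S]
        unfolding F[symmetric] by blast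
    qed
  qed
  then obtain K' where "finite_extension K xs \<subseteq> K'" "\<exists>b\<in>carrier L. \<not> alg_le K' n b" by blast
  then show ?thesis unfolding alg_le_def by (meson subset_trans)
qed

section \<open>Bounded degrees force finite degree\<close>

text \<open>Substitution of u + v X into \<open>p\<close>, as an actual element of k[X], so that
  divisibility by a minimal polynomial over \<open>k\<close> can be applied to it.\<close>

lemma (in ring) poly_eval_affine:
  assumes k: "subring k R" and d: "domain R" and u: "u \<in> k" "v \<in> k" and p: "set p \<subseteq> k"
  shows "\<exists>h\<in>carrier (k[X]). \<forall>b\<in>carrier R. eval h b = eval p (u \<oplus> v \<otimes> b)"
  using p
proof (induction p)
  case Nil
  then show ?case using univ_poly_zero_closed by (intro bexI[of _ "[]"]) auto
next
  case (Cons a p)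
  interpret domain R by (rule d)
  note kR = subringE(1)[OF k]
  have [simp]: "u \<in> carrier R" "v \<in> carrier R" using u kR by auto
  interpret UP: cring "k[X]" using univ_poly_is_cring[OF k] .
  \<comment> \<open>\<open>normalize\<close> covers the case that \<open>v\<close> vanishes, and
    below the case of a zero coefficient \<open>a\<close>.\<close>
  define l where "l = normalize [v, u]"
  have l: "l \<in> carrier (k[X])"
    using normalize_gives_polynomial[of "[v, u]" k] u unfolding l_def univ_poly_carrier by simp
  have evl: "eval l b = u \<oplus> v \<otimes> b" if "b \<in> carrier R" for b
    using eval_normalize[of "[v,u]" b] that unfolding l_def by (simp add: a_comm)
  define c where "c = normalize [a]"
  have c: "c \<in> carrier (k[X])"
    using normalize_gives_polynomial[of "[a]" k] Cons.prems unfolding c_def univ_poly_carrier by simp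
  have evc: "eval c b = a" if "b \<in> carrier R" for b
    using eval_normalize[of "[a]" b] that Cons.prems kR unfolding c_def by auto
  obtain h where h: "h \<in> carrier (k[X])" "\<forall>b\<in>carrier R. eval h b = eval p (u \<oplus> v \<otimes> b)"
    using Cons by auto
  let ?h = "c \<otimes>\<^bsub>k[X]\<^esub> l [^]\<^bsub>k[X]\<^esub> length p \<oplus>\<^bsub>k[X]\<^esub> h"
  have "eval ?h b = eval (a # p) (u \<oplus> v \<otimes> b)" if b: "b \<in> carrier R" for b
  proof -
    interpret E: ring_hom_cring "k[X]" R "\<lambda>p. eval p b" using eval_cring_hom[OF k b] .
    show ?thesis using c l h b evc[OF b] evl[OF b] by simp
  qed
  moreover have "?h \<in> carrier (k[X])" using c l h by simp
  ultimately show ?case by blast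
qed

text \<open>Such a polynomial is a constant times a power of X - a: the induction splits off one
  factor, and the roots of the quotient are again roots of \<open>p\<close>.\<close>

lemma (in algebraically_closed) eval_single_root:
  assumes "p \<in> carrier (poly_ring L)" "p \<noteq> []" "a \<in> carrier L"
    "\<And>b. b \<in> carrier L \<Longrightarrow> eval p b = \<zero> \<Longrightarrow> b = a" "z \<in> carrier L"
  shows "eval p z = lead_coeff p \<otimes> (z \<ominus> a) [^] degree p"
  using assms
proof (induction "degree p" arbitrary: p)
  case 0
  then obtain c where "p = [c]" by (cases p) auto
  moreover have "c \<in> carrier L" using 0 \<open>p = [c]\<close> by (auto simp: univ_poly_def polynomial_def)
  ultimately show ?case using 0 by simp
next
  case (Suc n)
  interpret UP: domain "poly_ring L" using univ_poly_is_domain[OF carrier_is_subring] .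
  obtain b where b: "b \<in> carrier L" "eval p b = \<zero>" using exists_root[OF Suc.prems(1)] Suc(2) by auto
  then have "is_root p a" using Suc.prems unfolding is_root_def by metis
  then have "[\<one>, \<ominus> a] pdivides p" using is_root_imp_pdivides[OF Suc.prems(1)] by blast
  then obtain q where q: "q \<in> carrier (poly_ring L)" "p = [\<one>, \<ominus> a] \<otimes>\<^bsub>poly_ring L\<^esub> q"
    unfolding pdivides_def factor_def by blast
  have x: "[\<one>, \<ominus> a] \<in> carrier (poly_ring L)" using Suc.prems by (auto simp: univ_poly_def polynomial_def)
  have qn: "q \<noteq> []" using q Suc.prems(2) x UP.r_null unfolding univ_poly_zero by metis
  have pm: "p = poly_mult [\<one>, \<ominus> a] q" using q(2) by (simp add: univ_poly_mult)
  have pol: "polynomial (carrier L) [\<one>, \<ominus> a]" "polynomial (carrier L) q"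
    using x q(1) univ_poly_carrier by blast+
  have deg: "degree p = 1 + degree q"
    using poly_mult_degree_eq[OF carrier_is_subring pol] qn unfolding pm by (simp del: poly_mult.simps)
  have lc: "lead_coeff p = lead_coeff q"
  proof -
    have "lead_coeff q \<in> carrier L" using qn pol(2) by (cases q) (auto simp: polynomial_def)
    then show ?thesis
      using poly_mult_lead_coeff[OF carrier_is_subring pol _ qn] unfolding pm
      by (simp del: poly_mult.simps)
  qed
  have set: "set [\<one>, \<ominus> a] \<subseteq> carrier L" "set q \<subseteq> carrier L"
    using pol by (auto simp: polynomial_def)
  have ev: "eval p b = (b \<ominus> a) \<otimes> eval q b" if "b \<in> carrier L" for b
    using eval_poly_mult[OF set that] that Suc.prems(3) unfolding pm by (simp add: a_minus_def del: poly_mult.simps)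
  have evq: "eval q z = lead_coeff q \<otimes> (z \<ominus> a) [^] degree q"
  proof -
    have n: "n = degree q" using deg Suc.hyps(2) by linarith
    have r: "b = a" if "b \<in> carrier L" "eval q b = \<zero>" for b
    proof -
      have "eval p b = \<zero>" using ev[OF that(1)] that Suc.prems(3) by simp
      then show ?thesis by (rule Suc.prems(4)[OF that(1)])
    qed
    show ?thesis by (rule Suc.hyps(1)[OF n q(1) qn Suc.prems(3) r Suc.prems(5)])
  qed
  have "lead_coeff q \<in> carrier L" using qn set(2) by (cases q) auto
  then show ?case using ev[OF Suc.prems(5)] evq Suc.prems(3,5) unfolding lc deg by (simp add: m_ac)
qed

text \<open>An element that is the only common zero of two polynomials generates a purely inseparable
  extension; the witnessing exponent is read off the constant term of its minimal polynomial.\<close>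

lemma (in algebraically_closed) power_mem_subfield:
  assumes k: "subfield k L" and uv: "u \<in> k" "v \<in> k"
    and f: "f \<in> carrier (k[X])" "f \<noteq> []" "eval f a = \<zero>" and a: "a \<in> carrier L"
    and g: "set g \<subseteq> k" "eval g (u \<oplus> v \<otimes> a) = \<zero>"
    and unique: "\<And>b. b \<in> carrier L \<Longrightarrow> eval f b = \<zero> \<Longrightarrow> eval g (u \<oplus> v \<otimes> b) = \<zero> \<Longrightarrow> b = a"
  shows "\<exists>r. 1 \<le> r \<and> r \<le> degree f \<and> a [^] r \<in> k"
proof -
  note kr = subfieldE(1)[OF k]
  have alg: "(algebraic over k) a" using algebraicI[OF f] unfolding over_def .
  define m where "m = Irr k a"
  note m = IrrE[OF k a alg, folded m_def]
  obtain h where h: "h \<in> carrier (k[X])" "\<And>b. b \<in> carrier L \<Longrightarrow> eval h b = eval g (u \<oplus> v \<otimes> b)"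
    using poly_eval_affine[OF kr domain_axioms uv g(1)] by blast
  have mL: "m \<in> carrier (poly_ring L)" using carrier_polynomial_shell[OF kr m(1)] .
  have mf: "m pdivides f" "m pdivides h"
    unfolding m_def using Irr_minimal[OF k a alg] f h g a by auto
  have deg: "1 \<le> degree m" using pirreducible_degree[OF k m(1,2)] .
  then have ne: "m \<noteq> []" by auto
  \<comment> \<open>\<open>m\<close> divides both \<open>f\<close> and \<open>h\<close>, so its
    roots are common zeros. Hence \<open>m\<close> has the single root \<open>a\<close> and behaves
    like a power of X - a.\<close>
  have root: "b = a" if b: "b \<in> carrier L" "eval m b = \<zero>" for b
    using unique[OF b(1)] h(2)[OF b(1)]
      pdivides_imp_root_sharing[OF mL mf(1) b] pdivides_imp_root_sharing[OF mL mf(2) b] by simp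
  have "eval m \<zero> = lead_coeff m \<otimes> (\<zero> \<ominus> a) [^] degree m"
    by (rule eval_single_root[OF mL ne a]) (use root in blast)+
  then have e: "eval m \<zero> = (\<ominus> a) [^] degree m" using m(3) a by (simp add: a_minus_def)
  \<comment> \<open>Values at zero of polynomials over \<open>k\<close> form
    \<open>simple_extension k \<zero>\<close>, which stays inside \<open>k\<close>.\<close>
  have "eval m \<zero> \<in> k"
  proof -
    have "eval m \<zero> \<in> simple_extension k \<zero>"
      using simple_extension_as_eval_img[OF subringE(1)[OF kr], of \<zero>] m(1) by auto
    then show ?thesis
      using simple_extension_subring_incl[OF kr order_refl, of \<zero>] subringE(2)[OF kr] by blast
  qed
  \<comment> \<open>The constant term is a power of -a; a power of -1 removes the sign.\<close>
  moreover have "(\<ominus> \<one>) [^] degree m \<in> k"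
  proof -
    have "(\<ominus> \<one>) [^] (i::nat) \<in> k" for i
      by (induction i) (use subringE[OF kr] in auto)
    then show ?thesis .
  qed
  ultimately have "(\<ominus> \<one>) [^] degree m \<otimes> (\<ominus> a) [^] degree m \<in> k"
    using e subringE(6)[OF kr] by simp
  then have "a [^] degree m \<in> k"
    using a by (simp add: nat_pow_distrib[symmetric] l_minus r_minus)
  moreover have "degree m \<le> degree f"
    using pdivides_imp_degree_le[OF kr m(1) f(1,2) mf(1)] .
  ultimately show ?thesis using deg by blast
qed

text \<open>For infinite \<open>K\<close>, let \<open>\<theta>\<close> have maximal degree over \<open>K\<close> and let \<open>s\<close>, \<open>a\<close> be \<open>N\<close>-th roots of \<open>\<theta>\<close> and
  \<open>\<alpha>\<close>, where \<open>N = n!\<close>. For a suitable \<open>c\<close> the element \<open>\<gamma> = s + c a\<close> generates \<open>s\<close> and \<open>a\<close> up to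
  purely inseparable exponents, which divide \<open>N\<close>. Hence \<open>\<theta>\<close> and \<open>\<alpha>\<close> lie in \<open>K(\<gamma>)\<close>, which equals
  \<open>K(\<theta>)\<close> by maximality.\<close>

lemma (in algebraically_closed) bounded_imp_finite_dimension:
  assumes K: "subfield K L" and le: "\<And>b. b \<in> carrier L \<Longrightarrow> alg_le K n b"
  shows "finite_dimension K (carrier L)"
proof -
  note Kr = subfieldE(1)[OF K]
  note KL = subringE(1)[OF Kr]
  have alg: "(algebraic over K) b" if "b \<in> carrier L" for b
    using alg_le_imp_algebraic[OF Kr that le[OF that]] .
  have deg_le: "degree (Irr K b) < n" if "b \<in> carrier L" for b
    using degree_Irr_less[OF K that le[OF that]] .
  show ?thesis
  proof (cases "finite K")
    case True
    \<comment> \<open>Over a finite field there are only finitely many polynomials of bounded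
      length, hence finitely many roots. So \<open>L\<close> is finite and is generated by all of
      its elements.\<close>
    let ?S = "{p \<in> carrier (K[X]). length p \<le> n}"
    have "?S \<subseteq> {p. set p \<subseteq> K \<and> length p \<le> n}" by (auto simp: univ_poly_def polynomial_def)
    then have fin: "finite ?S" using finite_lists_length_le[OF True] finite_subset by blast
    have "carrier L \<subseteq> (\<Union>p\<in>?S. {x. is_root p x})"
    proof
      fix x assume x: "x \<in> carrier L"
      obtain p where "p \<in> carrier (K[X])" "p \<noteq> []" "length p \<le> n" "eval p x = \<zero>"
        using alg_leE[OF Kr x le[OF x]] .
      then show "x \<in> (\<Union>p\<in>?S. {x. is_root p x})" using x unfolding is_root_def by blast
    qed
    moreover have "finite (\<Union>p\<in>?S. {x. is_root p x})"
      using fin finite_number_of_roots carrier_polynomial_shell[OF Kr] by blast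
    ultimately have "finite (carrier L)" using finite_subset by blast
    then obtain xs where xs: "set xs = carrier L" using finite_list by blast
    have "finite_extension K xs = carrier L"
      using finite_extension_mem[OF Kr, of xs] finite_extension_in_carrier[OF KL, of xs] xs by blast
    then show ?thesis using finite_extension_finite_dimension(1)[OF K, of xs] xs alg by simp
  next
    case inf: False
    obtain \<theta> where \<theta>: "\<theta> \<in> carrier L"
      and max: "\<And>b. b \<in> carrier L \<Longrightarrow> degree (Irr K b) \<le> degree (Irr K \<theta>)"
      using ex_has_greatest_nat[of "\<lambda>b. b \<in> carrier L" \<zero> "\<lambda>b. degree (Irr K b)" n] deg_le
      by (metis less_imp_le zero_closed)
    have "\<alpha> \<in> simple_extension K \<theta>" if \<alpha>: "\<alpha> \<in> carrier L" for \<alpha>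
    proof -
      define N :: nat where "N = fact n"
      have N: "1 \<le> N" unfolding N_def by (simp add: fact_ge_1)
      obtain s where s: "s \<in> carrier L" "s [^] N = \<theta>" using exists_nth_root[OF \<theta> N] by blast
      obtain a where a: "a \<in> carrier L" "a [^] N = \<alpha>" using exists_nth_root[OF \<alpha> N] by blast
      define f g where "f = Irr K a" and "g = Irr K s"
      note f = IrrE[OF K a(1) alg[OF a(1)], folded f_def]
      note g = IrrE[OF K s(1) alg[OF s(1)], folded g_def]
      have ne: "f \<noteq> []" "g \<noteq> []"
        using pirreducibleE(1)[OF Kr f(1,2)] pirreducibleE(1)[OF Kr g(1,2)] by auto
      \<comment> \<open>If x is another root of \<open>f\<close> and y = \<gamma> - c x is a root of
        \<open>g\<close>, then s - y = c (x - a). So \<open>c\<close> is one of these finitely many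
        quotients, and any other \<open>c\<close> leaves \<open>a\<close> as the only common
        zero.\<close>
      define bad where "bad = (\<lambda>(y, x). (s \<ominus> y) \<otimes> inv (x \<ominus> a)) ` ({y. is_root g y} \<times> {x. is_root f x})"
      have "finite bad"
        unfolding bad_def using finite_number_of_roots carrier_polynomial_shell[OF Kr] f(1) g(1) by blast
      then obtain c where c: "c \<in> K" "c \<noteq> \<zero>" "c \<notin> bad"
        using inf by (metis (no_types, opaque_lifting) finite.emptyI finite.insertI finite_UnI finite_subset insert_iff subsetI Un_iff)
      have cL: "c \<in> carrier L" using c KL by blast
      have ci: "inv c \<in> K" "inv c \<in> carrier L" "c \<otimes> inv c = \<one>"
        using subfield_m_inv[OF K, of c] c KL by auto
      define \<gamma> where "\<gamma> = s \<oplus> c \<otimes> a"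
      have \<gamma>: "\<gamma> \<in> carrier L" unfolding \<gamma>_def using s a cL by simp
      define k where "k = simple_extension K \<gamma>"
      have k: "subfield k L" unfolding k_def using simple_extension_is_subfield[OF K \<gamma>] alg[OF \<gamma>] by blast
      note kr = subfieldE(1)[OF k]
      have Kk: "K \<subseteq> k" unfolding k_def using simple_extension_incl[OF KL \<gamma>] .
      have \<gamma>k: "\<gamma> \<in> k" unfolding k_def using simple_extension_mem[OF Kr \<gamma>] .
      have s_eq: "s = \<gamma> \<oplus> (\<ominus> c) \<otimes> a"
        unfolding \<gamma>_def using s a cL by (simp add: l_minus a_assoc r_neg)
      have unique: "x = a" if x: "x \<in> carrier L" "eval f x = \<zero>" "eval g (\<gamma> \<oplus> (\<ominus> c) \<otimes> x) = \<zero>" for x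
      proof (rule ccontr)
        assume xa: "x \<noteq> a"
        define y where "y = \<gamma> \<oplus> (\<ominus> c) \<otimes> x"
        have y: "y \<in> carrier L" unfolding y_def using \<gamma> cL x by simp
        have "s \<ominus> y = c \<otimes> (x \<ominus> a)"
          unfolding y_def \<gamma>_def using s a cL x
          by (simp add: a_minus_def l_minus r_minus minus_add r_distr a_ac r_neg1 r_neg2 r_neg)
        moreover have "x \<ominus> a \<noteq> \<zero>" using xa x a by simp
        ultimately have "c = (s \<ominus> y) \<otimes> inv (x \<ominus> a)"
          using cL x a by (simp add: m_assoc field_Units)
        moreover have "is_root g y" "is_root f x"
          using x y ne unfolding is_root_def y_def by auto
        ultimately have "c \<in> bad" unfolding bad_def by force
        then show False using c by blast
      qed
      have fk: "f \<in> carrier (k[X])" and gk: "g \<in> carrier (k[X])"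
        using f(1) g(1) Kk by (auto simp: univ_poly_def polynomial_def)
      have set: "set f \<subseteq> k" "set g \<subseteq> k" using fk gk by (auto simp: univ_poly_def polynomial_def)
      \<comment> \<open>Solving \<gamma> = s + c a for \<open>a\<close> instead of \<open>s\<close>
        gives the affine substitution in which the roles of \<open>f\<close> and \<open>g\<close>
        are exchanged; \<open>c\<close> was chosen nonzero for this.\<close>
      have uv: "\<ominus> c \<in> k" "inv c \<otimes> \<gamma> \<in> k" "\<ominus> (inv c) \<in> k"
        using c ci Kk \<gamma>k subringE[OF kr] by (auto simp: subset_eq)
      have r1: "\<exists>r. 1 \<le> r \<and> r \<le> degree f \<and> a [^] r \<in> k"
        by (rule power_mem_subfield[OF k \<gamma>k uv(1) fk ne(1) f(4) a(1) set(2)])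
          (use unique s_eq g(4) in auto)
      have inv_eq: "inv c \<otimes> \<gamma> \<oplus> (\<ominus> (inv c)) \<otimes> (\<gamma> \<oplus> (\<ominus> c) \<otimes> x) = x" if "x \<in> carrier L" for x
      proof -
        have "inv c \<otimes> \<gamma> \<oplus> (\<ominus> (inv c)) \<otimes> (\<gamma> \<oplus> (\<ominus> c) \<otimes> x) = (c \<otimes> inv c) \<otimes> x"
          using ci(2) cL \<gamma> that by (simp add: l_minus r_minus r_distr m_ac a_ac minus_add r_neg1 r_neg2 r_neg)
        then show ?thesis using ci that by simp
      qed
      have inv_eq': "\<gamma> \<oplus> (\<ominus> c) \<otimes> (inv c \<otimes> \<gamma> \<oplus> (\<ominus> (inv c)) \<otimes> x) = x" if "x \<in> carrier L" for x
      proof -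
        have "(\<ominus> c) \<otimes> (inv c \<otimes> \<gamma> \<oplus> (\<ominus> (inv c)) \<otimes> x) = (c \<otimes> inv c) \<otimes> (\<ominus> \<gamma> \<oplus> x)"
          using ci(2) cL \<gamma> that by (simp add: l_minus r_minus r_distr m_ac minus_add)
        then show ?thesis using ci that \<gamma> by (simp add: r_neg2)
      qed
      have r2: "\<exists>r. 1 \<le> r \<and> r \<le> degree g \<and> s [^] r \<in> k"
      proof (rule power_mem_subfield[OF k uv(2,3) gk ne(2) g(4) s(1) set(1)])
        show "eval f (inv c \<otimes> \<gamma> \<oplus> \<ominus> (inv c) \<otimes> s) = \<zero>"
          using inv_eq[OF a(1)] s_eq f(4) by simp
        fix b assume b: "b \<in> carrier L" "eval g b = \<zero>"
          "eval f (inv c \<otimes> \<gamma> \<oplus> \<ominus> (inv c) \<otimes> b) = \<zero>"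
        let ?t = "inv c \<otimes> \<gamma> \<oplus> \<ominus> (inv c) \<otimes> b"
        have "?t = a"
          by (rule unique) (use ci \<gamma> b inv_eq'[OF b(1)] in auto)
        then show "b = s" using inv_eq'[OF b(1)] s_eq by simp
      qed
      have pow: "x [^] N \<in> k" if r: "1 \<le> r" "r < n" "x [^] r \<in> k" "x \<in> carrier L" for x and r :: nat
      proof -
        have "r dvd N" unfolding N_def using r by (intro dvd_fact) auto
        then obtain j where j: "N = r * j" by blast
        have "(x [^] r) [^] i \<in> k" for i :: nat
          by (induction i) (use subringE[OF kr] r in auto)
        then show ?thesis unfolding j using r(4) by (simp add: nat_pow_pow[symmetric])
      qed
      have \<alpha>k: "\<alpha> \<in> k" using r1 pow[of _ a] a deg_le[OF a(1)] unfolding f_def by fastforce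
      have \<theta>k: "\<theta> \<in> k" using r2 pow[of _ s] s deg_le[OF s(1)] unfolding g_def by fastforce
      \<comment> \<open>K(\<theta>) is contained in \<open>k\<close>, which is K(\<gamma>). By
        maximality its dimension over \<open>K\<close> is no smaller, so a basis of K(\<theta>)
        already spans \<open>k\<close>.\<close>
      have sub: "simple_extension K \<theta> \<subseteq> k" using simple_extension_subring_incl[OF kr Kk \<theta>k] .
      have d\<theta>: "dimension (degree (Irr K \<theta>)) K (simple_extension K \<theta>)"
        using dimension_simple_extension[OF K \<theta> alg[OF \<theta>]] .
      have d\<gamma>: "dimension (degree (Irr K \<gamma>)) K k"
        unfolding k_def using dimension_simple_extension[OF K \<gamma> alg[OF \<gamma>]] .
      obtain Vs where Vs: "independent K Vs" "length Vs = degree (Irr K \<theta>)" "Span K Vs = simple_extension K \<theta>"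
        using exists_base[OF K d\<theta>] by blast
      have Vk: "set Vs \<subseteq> k"
        using Span_base_incl[OF K independent_in_carrier[OF Vs(1)]] Vs(3) sub by blast
      have "length Vs \<le> degree (Irr K \<gamma>)" using independent_length_le_dimension[OF K d\<gamma> Vs(1) Vk] .
      then have "length Vs = degree (Irr K \<gamma>)" using max[OF \<gamma>] Vs(2) by simp
      then have "Span K Vs = k" using independent_length_eq_dimension[OF K d\<gamma> Vs(1) Vk] by blast
      then show ?thesis using \<alpha>k Vs(3) by simp
    qed
    then have "carrier L = simple_extension K \<theta>"
      using simple_extension_in_carrier[OF KL \<theta>] by blast
    then show ?thesis using finite_dimension_simple_extension[OF K \<theta>] alg[OF \<theta>] by simp
  qed
qed

text \<open>Infinite degree excludes a common bound for the degrees over \<open>K\<close>, and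
  unboundedness passes to K[xs]. In the ultrapower the i-th coordinate of a transcendental element
  is taken from here with n = i.\<close>

theorem (in algebraically_closed) exists_large_degree:
  assumes "subfield K L" "infinite_dimension K (carrier L)" "set xs \<subseteq> carrier L"
  shows "\<exists>b\<in>carrier L. \<not> alg_le (finite_extension K xs) n b"
  using unbounded_finite_extension[OF assms(1) _ assms(3)] bounded_imp_finite_dimension[OF assms(1)]
    assms(2) by blast

section \<open>Extending isomorphisms of subrings\<close>

text \<open>The relation itself becomes a coefficient ring: a pair is one coefficient seen in both
  rings, so a single polynomial can be evaluated on either side through \<open>fst\<close> and
  \<open>snd\<close>.\<close>

definition pair_ring :: "'a ring \<Rightarrow> 'b ring \<Rightarrow> ('a \<times> 'b) set \<Rightarrow> ('a \<times> 'b) ring" where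
  "pair_ring F G \<rho> =
     \<lparr>carrier = \<rho>, monoid.mult = (\<lambda>x y. (fst x \<otimes>\<^bsub>F\<^esub> fst y, snd x \<otimes>\<^bsub>G\<^esub> snd y)), one = (\<one>\<^bsub>F\<^esub>, \<one>\<^bsub>G\<^esub>),
      zero = (\<zero>\<^bsub>F\<^esub>, \<zero>\<^bsub>G\<^esub>), add = (\<lambda>x y. (fst x \<oplus>\<^bsub>F\<^esub> fst y, snd x \<oplus>\<^bsub>G\<^esub> snd y))\<rparr>"

text \<open>The condition on zeros makes the relation single-valued in both directions, so that it is the
  graph of an isomorphism between subrings.\<close>

definition partial_iso :: "'a ring \<Rightarrow> 'b ring \<Rightarrow> ('a \<times> 'b) set \<Rightarrow> bool" where
  "partial_iso F G \<rho> \<longleftrightarrow> \<rho> \<subseteq> carrier F \<times> carrier G \<and> (\<one>\<^bsub>F\<^esub>, \<one>\<^bsub>G\<^esub>) \<in> \<rho> \<and>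
     (\<forall>a b. (a, b) \<in> \<rho> \<longrightarrow> (\<ominus>\<^bsub>F\<^esub> a, \<ominus>\<^bsub>G\<^esub> b) \<in> \<rho> \<and> (a = \<zero>\<^bsub>F\<^esub> \<longleftrightarrow> b = \<zero>\<^bsub>G\<^esub>)) \<and>
     (\<forall>a b c d. (a, b) \<in> \<rho> \<longrightarrow> (c, d) \<in> \<rho> \<longrightarrow>
        (a \<oplus>\<^bsub>F\<^esub> c, b \<oplus>\<^bsub>G\<^esub> d) \<in> \<rho> \<and> (a \<otimes>\<^bsub>F\<^esub> c, b \<otimes>\<^bsub>G\<^esub> d) \<in> \<rho>)"

lemma partial_isoD:
  assumes "partial_iso F G \<rho>"
  shows "(a, b) \<in> \<rho> \<Longrightarrow> a \<in> carrier F" "(a, b) \<in> \<rho> \<Longrightarrow> b \<in> carrier G"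
    "(\<one>\<^bsub>F\<^esub>, \<one>\<^bsub>G\<^esub>) \<in> \<rho>" "(a, b) \<in> \<rho> \<Longrightarrow> (\<ominus>\<^bsub>F\<^esub> a, \<ominus>\<^bsub>G\<^esub> b) \<in> \<rho>"
    "(a, b) \<in> \<rho> \<Longrightarrow> a = \<zero>\<^bsub>F\<^esub> \<longleftrightarrow> b = \<zero>\<^bsub>G\<^esub>"
    "(a, b) \<in> \<rho> \<Longrightarrow> (c, d) \<in> \<rho> \<Longrightarrow> (a \<oplus>\<^bsub>F\<^esub> c, b \<oplus>\<^bsub>G\<^esub> d) \<in> \<rho>"
    "(a, b) \<in> \<rho> \<Longrightarrow> (c, d) \<in> \<rho> \<Longrightarrow> (a \<otimes>\<^bsub>F\<^esub> c, b \<otimes>\<^bsub>G\<^esub> d) \<in> \<rho>"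
  using assms unfolding partial_iso_def by blast+

lemma partial_iso_zero:
  assumes "domain F" "domain G" "partial_iso F G \<rho>"
  shows "(\<zero>\<^bsub>F\<^esub>, \<zero>\<^bsub>G\<^esub>) \<in> \<rho>"
proof -
  interpret F: domain F by fact
  interpret G: domain G by fact
  note D = partial_isoD[OF assms(3)]
  show ?thesis using D(6)[OF D(3) D(4)[OF D(3)]] by (simp add: F.r_neg G.r_neg)
qed

lemma partial_iso_converse: "partial_iso F G \<rho> \<Longrightarrow> partial_iso G F (\<rho>\<inverse>)"
  unfolding partial_iso_def by blast

lemma partial_iso_unique:
  assumes "domain F" "domain G" "partial_iso F G \<rho>" "(a, b) \<in> \<rho>" "(c, d) \<in> \<rho>"
  shows "a = c \<longleftrightarrow> b = d"
proof -
  interpret F: domain F by fact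
  interpret G: domain G by fact
  note D = partial_isoD[OF assms(3)]
  have "(a \<ominus>\<^bsub>F\<^esub> c, b \<ominus>\<^bsub>G\<^esub> d) \<in> \<rho>" unfolding a_minus_def using D assms by blast
  then have "a \<ominus>\<^bsub>F\<^esub> c = \<zero>\<^bsub>F\<^esub> \<longleftrightarrow> b \<ominus>\<^bsub>G\<^esub> d = \<zero>\<^bsub>G\<^esub>" by (rule D(5))
  then show ?thesis using D(1,2)[OF assms(4)] D(1,2)[OF assms(5)] by simp
qed

text \<open>There are no zero divisors because a pair vanishes as soon as one of its components
  does.\<close>

lemma pair_ring_domain:
  assumes "domain F" "domain G" "partial_iso F G \<rho>"
  shows "domain (pair_ring F G \<rho>)"
    and "fst \<in> ring_hom (pair_ring F G \<rho>) F" "snd \<in> ring_hom (pair_ring F G \<rho>) G"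
proof -
  interpret F: domain F by fact
  interpret G: domain G by fact
  note D = partial_isoD[OF assms(3)]
  have c [simp]: "fst x \<in> carrier F" "snd x \<in> carrier G" if "x \<in> \<rho>" for x
    using that D(1,2) by (metis prod.collapse)+
  have "cring (pair_ring F G \<rho>)"
  proof (rule cringI)
    show "abelian_group (pair_ring F G \<rho>)"
    proof (rule abelian_groupI)
      fix x assume x: "x \<in> carrier (pair_ring F G \<rho>)"
      then have "(\<ominus>\<^bsub>F\<^esub> fst x, \<ominus>\<^bsub>G\<^esub> snd x) \<in> \<rho>" using D(4) by (simp add: pair_ring_def)
      then show "\<exists>y\<in>carrier (pair_ring F G \<rho>). y \<oplus>\<^bsub>pair_ring F G \<rho>\<^esub> x = \<zero>\<^bsub>pair_ring F G \<rho>\<^esub>"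
        using x by (intro bexI) (auto simp: pair_ring_def F.l_neg G.l_neg)
    qed (auto simp: pair_ring_def D partial_iso_zero[OF assms] F.a_ac G.a_ac intro: D(6))
    show "comm_monoid (pair_ring F G \<rho>)"
      by (rule comm_monoidI) (auto simp: pair_ring_def D F.m_ac G.m_ac intro: D(7))
  qed (auto simp: pair_ring_def F.l_distr G.l_distr)
  moreover have "a = \<zero>\<^bsub>pair_ring F G \<rho>\<^esub> \<or> b = \<zero>\<^bsub>pair_ring F G \<rho>\<^esub>"
    if "a \<otimes>\<^bsub>pair_ring F G \<rho>\<^esub> b = \<zero>\<^bsub>pair_ring F G \<rho>\<^esub>" "a \<in> carrier (pair_ring F G \<rho>)"
      "b \<in> carrier (pair_ring F G \<rho>)" for a b
  proof -
    have ab: "a \<in> \<rho>" "b \<in> \<rho>" "fst a \<otimes>\<^bsub>F\<^esub> fst b = \<zero>\<^bsub>F\<^esub>" using that by (auto simp: pair_ring_def)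
    then have "fst a = \<zero>\<^bsub>F\<^esub> \<or> fst b = \<zero>\<^bsub>F\<^esub>" using F.integral by simp
    then show ?thesis using D(5)[of "fst a" "snd a"] D(5)[of "fst b" "snd b"] ab
      by (auto simp: pair_ring_def prod_eq_iff)
  qed
  ultimately show "domain (pair_ring F G \<rho>)"
    by (intro domain.intro domain_axioms.intro) (auto simp: pair_ring_def)
  show "fst \<in> ring_hom (pair_ring F G \<rho>) F" "snd \<in> ring_hom (pair_ring F G \<rho>) G"
    by (auto intro!: ring_hom_memI intro: D(1,2) simp: pair_ring_def)
qed

text \<open>Links the two representations of polynomials in use: \<open>UP\<close> evaluates by
  finite sums, the list polynomials by \<open>eval\<close>, which reads the highest power first;
  hence \<open>rev\<close>.\<close>

lemma (in ring) finsum_eq_eval: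
  assumes "f \<in> UNIV \<rightarrow> carrier R" "x \<in> carrier R"
  shows "(\<Oplus>i\<in>{..n::nat}. f i \<otimes> x [^] i) = eval (map f (rev [0..<Suc n])) x"
proof (induction n)
  case 0
  have "f 0 \<in> carrier R" using assms by auto
  then show ?case using assms by simp
next
  case (Suc n)
  have "(\<Oplus>i\<in>{..Suc n}. f i \<otimes> x [^] i) = f (Suc n) \<otimes> x [^] Suc n \<oplus> (\<Oplus>i\<in>{..n}. f i \<otimes> x [^] i)"
    using assms by (intro finsum_Suc) auto
  then show ?case using Suc by simp
qed

lemma (in ring) subring_finsum_closed:
  assumes "subring H R" "finite I" "\<And>i. i \<in> I \<Longrightarrow> f i \<in> H"
  shows "finsum R f I \<in> H"
  using assms(2,3)
proof (induction I rule: finite_induct)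
  case (insert i I)
  have "finsum R f (insert i I) = f i \<oplus> finsum R f I"
    using insert subringE(1)[OF assms(1)] by (intro finsum_insert) auto
  then show ?case using insert subringE(7)[OF assms(1)] by simp
qed (use subringE(2)[OF assms(1)] in simp)

text \<open>\<open>b\<close> is the element to be added on the left. Polynomials are taken in
  \<open>UP A\<close> because division up to powers of the leading coefficient works there, although
  \<open>A\<close> need not be a field.\<close>

locale partial_iso_extension =
  F: domain F + G: domain G for F :: "'a ring" and G :: "'b ring" +
  fixes \<rho> :: "('a \<times> 'b) set" and b :: 'a
  assumes \<rho>: "partial_iso F G \<rho>" and b: "b \<in> carrier F"
begin

abbreviation "A \<equiv> pair_ring F G \<rho>"
abbreviation "U \<equiv> UP A"
abbreviation "ev1 \<equiv> UnivPoly.eval A F fst"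
abbreviation "ev2 \<equiv> UnivPoly.eval A G snd"

lemmas dom = F.domain_axioms G.domain_axioms
lemmas D = partial_isoD[OF \<rho>]

sublocale A: domain A by (rule pair_ring_domain[OF dom \<rho>])
sublocale UP_domain A U by unfold_locales
sublocale H1: ring_hom_cring A F fst
  by (rule ring_hom_cringI) (unfold_locales, rule pair_ring_domain[OF dom \<rho>])
sublocale H2: ring_hom_cring A G snd
  by (rule ring_hom_cringI) (unfold_locales, rule pair_ring_domain[OF dom \<rho>])
sublocale U1: UP_pre_univ_prop A F fst U by unfold_locales
sublocale U2: UP_pre_univ_prop A G snd U by unfold_locales
sublocale E1: UP_univ_prop A F fst U b "ev1 b" by unfold_locales (use b in auto)

lemma E2: "b' \<in> carrier G \<Longrightarrow> UP_univ_prop A G snd b'"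
  by unfold_locales auto

lemma zero_iff: "a \<in> carrier A \<Longrightarrow> a = \<zero>\<^bsub>A\<^esub> \<longleftrightarrow> fst a = \<zero>\<^bsub>F\<^esub>" "a \<in> carrier A \<Longrightarrow> a = \<zero>\<^bsub>A\<^esub> \<longleftrightarrow> snd a = \<zero>\<^bsub>G\<^esub>"
  using D(5)[of "fst a" "snd a"] by (auto simp: pair_ring_def prod_eq_iff)


text \<open>The pairs (p(b), p(b')) form the ring generated by \<rho> and (b, b'), and equality of
  the two kernels is the condition on zeros. The last two clauses bound both sides of the new
  relation, which keeps it finitely generated over the predicates.\<close>

lemma extend:
  assumes b': "b' \<in> carrier G"
    and ker: "\<And>p. p \<in> carrier U \<Longrightarrow> ev1 b p = \<zero>\<^bsub>F\<^esub> \<longleftrightarrow> ev2 b' p = \<zero>\<^bsub>G\<^esub>"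
  shows "\<exists>\<rho>'. partial_iso F G \<rho>' \<and> \<rho> \<subseteq> \<rho>' \<and> (b, b') \<in> \<rho>' \<and>
    (\<forall>H. subring H F \<longrightarrow> Domain \<rho> \<subseteq> H \<longrightarrow> b \<in> H \<longrightarrow> Domain \<rho>' \<subseteq> H) \<and>
    (\<forall>H. subring H G \<longrightarrow> Range \<rho> \<subseteq> H \<longrightarrow> b' \<in> H \<longrightarrow> Range \<rho>' \<subseteq> H)"
proof -
  interpret E2: UP_univ_prop A G snd U b' "ev2 b'" by (rule E2[OF b'])
  define \<rho>' where "\<rho>' = (\<lambda>p. (ev1 b p, ev2 b' p)) ` carrier U"
  have mem: "(ev1 b p, ev2 b' p) \<in> \<rho>'" if "p \<in> carrier U" for p
    using that unfolding \<rho>'_def by blast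
  have "partial_iso F G \<rho>'"
    unfolding partial_iso_def
  proof (intro conjI allI impI)
    show "\<rho>' \<subseteq> carrier F \<times> carrier G" unfolding \<rho>'_def by auto
    show "(\<one>\<^bsub>F\<^esub>, \<one>\<^bsub>G\<^esub>) \<in> \<rho>'" using mem[of "\<one>\<^bsub>U\<^esub>"] by simp
  next
    fix x y assume "(x, y) \<in> \<rho>'"
    then obtain p where p: "p \<in> carrier U" "x = ev1 b p" "y = ev2 b' p" unfolding \<rho>'_def by auto
    show "(\<ominus>\<^bsub>F\<^esub> x, \<ominus>\<^bsub>G\<^esub> y) \<in> \<rho>'" using mem[of "\<ominus>\<^bsub>U\<^esub> p"] p by simp
    show "x = \<zero>\<^bsub>F\<^esub> \<longleftrightarrow> y = \<zero>\<^bsub>G\<^esub>" using ker p by simp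
    fix z w assume "(z, w) \<in> \<rho>'"
    then obtain q where q: "q \<in> carrier U" "z = ev1 b q" "w = ev2 b' q" unfolding \<rho>'_def by auto
    show "(x \<oplus>\<^bsub>F\<^esub> z, y \<oplus>\<^bsub>G\<^esub> w) \<in> \<rho>'" using mem[of "p \<oplus>\<^bsub>U\<^esub> q"] p q by simp
    show "(x \<otimes>\<^bsub>F\<^esub> z, y \<otimes>\<^bsub>G\<^esub> w) \<in> \<rho>'" using mem[of "p \<otimes>\<^bsub>U\<^esub> q"] p q by simp
  qed
  moreover have "\<rho> \<subseteq> \<rho>'"
  proof
    fix x assume x: "x \<in> \<rho>"
    then have c: "x \<in> carrier A" by (simp add: pair_ring_def)
    have "ev1 b (up_ring.monom U x 0) = fst x" using U1.eval_const[OF b c] .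
    moreover have "ev2 b' (up_ring.monom U x 0) = snd x" using U2.eval_const[OF b' c] .
    ultimately show "x \<in> \<rho>'" using mem[of "up_ring.monom U x 0"] c by simp
  qed
  moreover have "(b, b') \<in> \<rho>'"
    using mem[of "up_ring.monom U \<one>\<^bsub>A\<^esub> 1"] U1.eval_monom1[OF b] U2.eval_monom1[OF b'] by simp
  moreover have "Domain \<rho>' \<subseteq> H" if H: "subring H F" "Domain \<rho> \<subseteq> H" "b \<in> H" for H
  proof
    fix x assume "x \<in> Domain \<rho>'"
    then obtain p where p: "p \<in> carrier U" "x = ev1 b p" unfolding \<rho>'_def by auto
    have c: "fst (up_ring.coeff U p i) \<in> H" for i
    proof -
      have "up_ring.coeff U p i \<in> \<rho>" using coeff_closed[OF p(1), of i] by (simp add: pair_ring_def)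
      then show ?thesis using H(2) by (metis Domain.DomainI prod.collapse subsetD)
    qed
    have pow: "b [^]\<^bsub>F\<^esub> (i::nat) \<in> H" for i
      by (induction i) (use subringE[OF H(1)] H(3) in auto)
    have "x = (\<Oplus>\<^bsub>F\<^esub>i\<in>{..deg A p}. fst (up_ring.coeff U p i) \<otimes>\<^bsub>F\<^esub> b [^]\<^bsub>F\<^esub> i)"
      using eval_on_carrier[OF p(1), where S = F and phi = fst and s = b] p(2) by simp
    also have "\<dots> \<in> H"
      by (rule F.subring_finsum_closed[OF H(1)]) (auto intro: c pow subringE(6)[OF H(1)])
    finally show "x \<in> H" .
  qed
  moreover have "Range \<rho>' \<subseteq> H" if H: "subring H G" "Range \<rho> \<subseteq> H" "b' \<in> H" for H
  proof
    fix x assume "x \<in> Range \<rho>'"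
    then obtain p where p: "p \<in> carrier U" "x = ev2 b' p" unfolding \<rho>'_def by auto
    have c: "snd (up_ring.coeff U p i) \<in> H" for i
    proof -
      have "up_ring.coeff U p i \<in> \<rho>" using coeff_closed[OF p(1), of i] by (simp add: pair_ring_def)
      then show ?thesis using H(2) by (metis Range.intros prod.collapse subsetD)
    qed
    have pow: "b' [^]\<^bsub>G\<^esub> (i::nat) \<in> H" for i
      by (induction i) (use subringE[OF H(1)] H(3) in auto)
    have "x = (\<Oplus>\<^bsub>G\<^esub>i\<in>{..deg A p}. snd (up_ring.coeff U p i) \<otimes>\<^bsub>G\<^esub> b' [^]\<^bsub>G\<^esub> i)"
      using eval_on_carrier[OF p(1), where S = G and phi = snd and s = b'] p(2) by simp
    also have "\<dots> \<in> H"
      by (rule G.subring_finsum_closed[OF H(1)]) (auto intro: c pow subringE(6)[OF H(1)])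
    finally show "x \<in> H" .
  qed
  ultimately show ?thesis by blast
qed

text \<open>A polynomial \<open>t\<close> of least degree killing \<open>b\<close> replaces the
  minimal polynomial over the fraction field. Division by \<open>t\<close> leaves a remainder of
  smaller degree that kills \<open>b\<close>, hence zero; this gives one inclusion of kernels. No
  irreducibility of the transported polynomial is at hand, so the other inclusion compares
  \<open>t\<close> with a polynomial of least degree killing \<open>b'\<close>.\<close>

lemma kernel_eq:
  assumes b': "b' \<in> carrier G"
    and t: "t \<in> carrier U" "t \<noteq> \<zero>\<^bsub>U\<^esub>" "ev1 b t = \<zero>\<^bsub>F\<^esub>" "ev2 b' t = \<zero>\<^bsub>G\<^esub>"
    and min: "\<And>s. s \<in> carrier U \<Longrightarrow> ev1 b s = \<zero>\<^bsub>F\<^esub> \<Longrightarrow> s \<noteq> \<zero>\<^bsub>U\<^esub> \<Longrightarrow> deg A t \<le> deg A s"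
    and p: "p \<in> carrier U"
  shows "ev1 b p = \<zero>\<^bsub>F\<^esub> \<longleftrightarrow> ev2 b' p = \<zero>\<^bsub>G\<^esub>"
proof -
  interpret E2: UP_univ_prop A G snd U b' "ev2 b'" by (rule E2[OF b'])
  have lc: "lcoeff s [^]\<^bsub>A\<^esub> (k::nat) \<in> carrier A" "lcoeff s [^]\<^bsub>A\<^esub> (k::nat) \<noteq> \<zero>\<^bsub>A\<^esub>"
    if "s \<in> carrier U" "s \<noteq> \<zero>\<^bsub>U\<^esub>" for s k
  proof -
    have 1: "lcoeff s \<in> carrier A" using that by simp
    have 2: "lcoeff s \<noteq> \<zero>\<^bsub>A\<^esub>" using lcoeff_nonzero2[OF that] .
    show "lcoeff s [^]\<^bsub>A\<^esub> k \<in> carrier A" using 1 by simp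
    show "lcoeff s [^]\<^bsub>A\<^esub> k \<noteq> \<zero>\<^bsub>A\<^esub>"
      by (induction k) (use 1 2 A.integral_iff in simp_all)
  qed
  have sm1: "ev1 b (c \<odot>\<^bsub>U\<^esub> s) = \<zero>\<^bsub>F\<^esub> \<longleftrightarrow> ev1 b s = \<zero>\<^bsub>F\<^esub>"
    if "c \<in> carrier A" "c \<noteq> \<zero>\<^bsub>A\<^esub>" "s \<in> carrier U" for c s
    using that zero_iff(1)[of c] E1.Eval_smult[of c s] F.integral_iff by simp
  have sm2: "ev2 b' (c \<odot>\<^bsub>U\<^esub> s) = \<zero>\<^bsub>G\<^esub> \<longleftrightarrow> ev2 b' s = \<zero>\<^bsub>G\<^esub>"
    if "c \<in> carrier A" "c \<noteq> \<zero>\<^bsub>A\<^esub>" "s \<in> carrier U" for c s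
    using that zero_iff(2)[of c] E2.Eval_smult[of c s] G.integral_iff by simp
  have dir1: "ev2 b' p = \<zero>\<^bsub>G\<^esub>" if "ev1 b p = \<zero>\<^bsub>F\<^esub>"
  proof -
    obtain q r k where d: "q \<in> carrier U" "r \<in> carrier U"
      "lcoeff t [^]\<^bsub>A\<^esub> (k::nat) \<odot>\<^bsub>U\<^esub> p = t \<otimes>\<^bsub>U\<^esub> q \<oplus>\<^bsub>U\<^esub> r" "r = \<zero>\<^bsub>U\<^esub> \<or> deg A r < deg A t"
      using long_div_theorem[OF t(1) p t(2)] by blast
    have "ev1 b (t \<otimes>\<^bsub>U\<^esub> q \<oplus>\<^bsub>U\<^esub> r) = \<zero>\<^bsub>F\<^esub>"
      using sm1[OF lc[OF t(1,2)] p, of k] that d(3) by simp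
    then have "ev1 b r = \<zero>\<^bsub>F\<^esub>" using d t by simp
    then have "r = \<zero>\<^bsub>U\<^esub>" using min[OF d(2)] d(4) by fastforce
    then have "ev2 b' (t \<otimes>\<^bsub>U\<^esub> q \<oplus>\<^bsub>U\<^esub> r) = \<zero>\<^bsub>G\<^esub>" using d t by simp
    then show ?thesis using sm2[OF lc[OF t(1,2)] p, of k] d(3) by simp
  qed
  moreover have "ev1 b p = \<zero>\<^bsub>F\<^esub>" if p0: "ev2 b' p = \<zero>\<^bsub>G\<^esub>"
  proof -
    \<comment> \<open>\<open>t'\<close> divides every polynomial killing \<open>b'\<close> up to a
      power of its leading coefficient, in particular \<open>t\<close>. It remains to see that
      \<open>t'\<close> kills \<open>b\<close>.\<close>
    obtain t' where t': "t' \<in> carrier U" "t' \<noteq> \<zero>\<^bsub>U\<^esub>" "ev2 b' t' = \<zero>\<^bsub>G\<^esub>"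
      and min': "\<And>s. s \<in> carrier U \<Longrightarrow> ev2 b' s = \<zero>\<^bsub>G\<^esub> \<Longrightarrow> s \<noteq> \<zero>\<^bsub>U\<^esub> \<Longrightarrow> deg A t' \<le> deg A s"
      using ex_has_least_nat[of "\<lambda>s. s \<in> carrier U \<and> s \<noteq> \<zero>\<^bsub>U\<^esub> \<and> ev2 b' s = \<zero>\<^bsub>G\<^esub>" t "deg A"] t by blast
    have div: "\<exists>q k. q \<in> carrier U \<and> lcoeff t' [^]\<^bsub>A\<^esub> (k::nat) \<odot>\<^bsub>U\<^esub> s = t' \<otimes>\<^bsub>U\<^esub> q"
      if s: "s \<in> carrier U" "ev2 b' s = \<zero>\<^bsub>G\<^esub>" for s
    proof -
      obtain q r k where d: "q \<in> carrier U" "r \<in> carrier U"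
        "lcoeff t' [^]\<^bsub>A\<^esub> (k::nat) \<odot>\<^bsub>U\<^esub> s = t' \<otimes>\<^bsub>U\<^esub> q \<oplus>\<^bsub>U\<^esub> r" "r = \<zero>\<^bsub>U\<^esub> \<or> deg A r < deg A t'"
        using long_div_theorem[OF t'(1) s(1) t'(2)] by blast
      have "ev2 b' (t' \<otimes>\<^bsub>U\<^esub> q \<oplus>\<^bsub>U\<^esub> r) = \<zero>\<^bsub>G\<^esub>"
        using sm2[OF lc[OF t'(1,2)] s(1), of k] s d(3) by simp
      then have "ev2 b' r = \<zero>\<^bsub>G\<^esub>" using d t' by simp
      then have "r = \<zero>\<^bsub>U\<^esub>" using min'[OF d(2)] d(4) by fastforce
      then show ?thesis using d t' by auto
    qed
    obtain q k where q: "q \<in> carrier U" "lcoeff t' [^]\<^bsub>A\<^esub> (k::nat) \<odot>\<^bsub>U\<^esub> t = t' \<otimes>\<^bsub>U\<^esub> q"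
      using div[OF t(1,4)] by blast
    note lct = lc[OF t'(1,2), of k]
    have "ev1 b (t' \<otimes>\<^bsub>U\<^esub> q) = \<zero>\<^bsub>F\<^esub>" using sm1[OF lct t(1)] t(3) q(2) by simp
    then have "ev1 b t' = \<zero>\<^bsub>F\<^esub> \<or> ev1 b q = \<zero>\<^bsub>F\<^esub>" using q t' F.integral by simp
    then have "ev1 b t' = \<zero>\<^bsub>F\<^esub>"
    proof
      \<comment> \<open>If the cofactor \<open>q\<close> kills \<open>b\<close>, its degree is at
        least that of \<open>t\<close>, which leaves degree 0 for \<open>t'\<close>. A constant
        killing \<open>b'\<close> is zero, contrary to the choice of \<open>t'\<close>.\<close>
      assume q0: "ev1 b q = \<zero>\<^bsub>F\<^esub>"
      have degt: "deg A (t' \<otimes>\<^bsub>U\<^esub> q) = deg A t" using deg_smult[OF lct(1) t(1)] lct(2) q(2) by simp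
      have tq: "t' \<otimes>\<^bsub>U\<^esub> q \<noteq> \<zero>\<^bsub>U\<^esub>"
      proof
        assume z: "t' \<otimes>\<^bsub>U\<^esub> q = \<zero>\<^bsub>U\<^esub>"
        have "up_ring.monom U (lcoeff t' [^]\<^bsub>A\<^esub> k) 0 \<otimes>\<^bsub>U\<^esub> t = \<zero>\<^bsub>U\<^esub>"
          using monom_mult_is_smult[OF lct(1) t(1)] q(2) z by simp
        then have "up_ring.monom U (lcoeff t' [^]\<^bsub>A\<^esub> k) 0 = \<zero>\<^bsub>U\<^esub>"
          using domain.integral[OF UP_domain _ monom_closed[OF lct(1)] t(1)] t(2) by metis
        then have "up_ring.monom U (lcoeff t' [^]\<^bsub>A\<^esub> k) 0 = up_ring.monom U \<zero>\<^bsub>A\<^esub> 0" by simp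
        then show False using lct inj_onD[OF monom_inj[of 0] _ lct(1) A.zero_closed] by metis
      qed
      then have qn: "q \<noteq> \<zero>\<^bsub>U\<^esub>" using t' by auto
      have "deg A t' + deg A q = deg A t" using deg_mult[OF t'(2) qn t'(1) q(1)] degt by simp
      then have "deg A t' = 0" using min[OF q(1) q0 qn] by simp
      then have t0: "t' = up_ring.monom U (up_ring.coeff U t' 0) 0" using deg_zero_impl_monom[OF t'(1)] by simp
      define c where "c = up_ring.coeff U t' 0"
      have c: "c \<in> carrier A" "t' = up_ring.monom U c 0"
        using coeff_closed[OF t'(1)] t0 unfolding c_def by blast+
      have "snd c = \<zero>\<^bsub>G\<^esub>" using t'(3) c U2.eval_const[OF b' c(1)] by simp
      then have "c = \<zero>\<^bsub>A\<^esub>" using zero_iff(2)[OF c(1)] by simp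
      then show ?thesis using c t' by simp
    qed
    moreover obtain q' k' where q': "q' \<in> carrier U" "lcoeff t' [^]\<^bsub>A\<^esub> (k'::nat) \<odot>\<^bsub>U\<^esub> p = t' \<otimes>\<^bsub>U\<^esub> q'"
      using div[OF p p0] by blast
    ultimately have "ev1 b (t' \<otimes>\<^bsub>U\<^esub> q') = \<zero>\<^bsub>F\<^esub>" using t' q' by simp
    then show ?thesis using sm1[OF lc[OF t'(1,2)] p, of k'] q'(2) by simp
  qed
  ultimately show ?thesis by blast
qed

lemma eval_transcendental_imp_zero:
  assumes b': "b' \<in> carrier G"
    and tr: "\<And>cs. set cs \<subseteq> Range \<rho> \<Longrightarrow> G.eval cs b' = \<zero>\<^bsub>G\<^esub> \<Longrightarrow> set cs \<subseteq> {\<zero>\<^bsub>G\<^esub>}"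
    and p: "p \<in> carrier U" "ev2 b' p = \<zero>\<^bsub>G\<^esub>"
  shows "p = \<zero>\<^bsub>U\<^esub>"
proof -
  let ?c = "\<lambda>i. snd (up_ring.coeff U p i)"
  let ?cs = "map ?c (rev [0..<Suc (deg A p)])"
  have c: "up_ring.coeff U p i \<in> \<rho>" for i using coeff_closed[OF p(1), of i] by (simp add: pair_ring_def)
  have c'': "?c i \<in> Range \<rho>" for i using imageI[OF c[of i], of snd] unfolding snd_eq_Range .
  have c': "?c i \<in> carrier G" for i using c''[of i] D(2) by blast
  have "G.eval ?cs b' = (\<Oplus>\<^bsub>G\<^esub>i\<in>{..deg A p}. ?c i \<otimes>\<^bsub>G\<^esub> b' [^]\<^bsub>G\<^esub> i)"
    using G.finsum_eq_eval[of ?c b' "deg A p"] c' b' by simp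
  also have "\<dots> = \<zero>\<^bsub>G\<^esub>" using eval_on_carrier[OF p(1), where S = G and phi = snd and s = b'] p(2) by simp
  finally have "set ?cs \<subseteq> {\<zero>\<^bsub>G\<^esub>}"
    by (intro tr) (use c'' in auto)
  then have "?c (deg A p) = \<zero>\<^bsub>G\<^esub>" by simp
  then have "lcoeff p = \<zero>\<^bsub>A\<^esub>" using zero_iff(2)[of "lcoeff p"] p(1) by simp
  then show ?thesis using lcoeff_nonzero2[OF p(1)] by blast
qed

theorem exists_extension:
  assumes G: "algebraically_closed G"
    and tr: "\<exists>b'\<in>carrier G. \<forall>cs. set cs \<subseteq> Range \<rho> \<longrightarrow> G.eval cs b' = \<zero>\<^bsub>G\<^esub> \<longrightarrow> set cs \<subseteq> {\<zero>\<^bsub>G\<^esub>}"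
  shows "\<exists>b'\<in>carrier G. \<exists>\<rho>'. partial_iso F G \<rho>' \<and> \<rho> \<subseteq> \<rho>' \<and> (b, b') \<in> \<rho>' \<and>
    (\<forall>H. subring H F \<longrightarrow> Domain \<rho> \<subseteq> H \<longrightarrow> b \<in> H \<longrightarrow> Domain \<rho>' \<subseteq> H) \<and>
    (\<forall>H. subring H G \<longrightarrow> Range \<rho> \<subseteq> H \<longrightarrow> b' \<in> H \<longrightarrow> Range \<rho>' \<subseteq> H)"
proof -
  interpret G': algebraically_closed G by fact
  have "\<exists>b'\<in>carrier G. \<forall>p\<in>carrier U. ev1 b p = \<zero>\<^bsub>F\<^esub> \<longleftrightarrow> ev2 b' p = \<zero>\<^bsub>G\<^esub>"
  proof (cases "\<exists>p\<in>carrier U. ev1 b p = \<zero>\<^bsub>F\<^esub> \<and> p \<noteq> \<zero>\<^bsub>U\<^esub>")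
    case False
    obtain b' where b': "b' \<in> carrier G"
      and tr: "\<And>cs. set cs \<subseteq> Range \<rho> \<Longrightarrow> G.eval cs b' = \<zero>\<^bsub>G\<^esub> \<Longrightarrow> set cs \<subseteq> {\<zero>\<^bsub>G\<^esub>}"
      using tr by blast
    interpret E2: UP_univ_prop A G snd U b' "ev2 b'" by (rule E2[OF b'])
    have "ev1 b p = \<zero>\<^bsub>F\<^esub> \<longleftrightarrow> ev2 b' p = \<zero>\<^bsub>G\<^esub>" if "p \<in> carrier U" for p
      using False that eval_transcendental_imp_zero[OF b' tr that] by auto
    then show ?thesis using b' by blast
  next
    case True
    then obtain t0 where t0: "t0 \<in> carrier U \<and> t0 \<noteq> \<zero>\<^bsub>U\<^esub> \<and> ev1 b t0 = \<zero>\<^bsub>F\<^esub>" by blast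
    obtain t where t: "t \<in> carrier U" "t \<noteq> \<zero>\<^bsub>U\<^esub>" "ev1 b t = \<zero>\<^bsub>F\<^esub>"
      and min: "\<And>s. s \<in> carrier U \<Longrightarrow> ev1 b s = \<zero>\<^bsub>F\<^esub> \<Longrightarrow> s \<noteq> \<zero>\<^bsub>U\<^esub> \<Longrightarrow> deg A t \<le> deg A s"
      using ex_has_least_nat[of "\<lambda>s. s \<in> carrier U \<and> s \<noteq> \<zero>\<^bsub>U\<^esub> \<and> ev1 b s = \<zero>\<^bsub>F\<^esub>", OF t0, of "deg A"] by auto
    let ?c = "\<lambda>i. snd (up_ring.coeff U t i)"
    let ?cs = "map ?c (rev [0..<Suc (deg A t)])"
    have c: "up_ring.coeff U t i \<in> \<rho>" for i using coeff_closed[OF t(1), of i] by (simp add: pair_ring_def)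
    have "?c i \<in> Range \<rho>" for i using imageI[OF c[of i], of snd] unfolding snd_eq_Range .
    then have c': "?c i \<in> carrier G" for i using D(2) by blast
    have "?c (deg A t) \<noteq> \<zero>\<^bsub>G\<^esub>" using zero_iff(2)[of "lcoeff t"] lcoeff_nonzero2[OF t(1,2)] t(1) by simp
    then have poly: "?cs \<in> carrier (poly_ring G)"
      using c' by (auto simp: univ_poly_def polynomial_def)
    \<comment> \<open>A constant polynomial that kills \<open>b\<close> has a zero coefficient and
      so is zero; hence the transported polynomial has positive degree and therefore a root.\<close>
    have "deg A t \<noteq> 0"
    proof
      assume "deg A t = 0"
      then have e: "t = up_ring.monom U (up_ring.coeff U t 0) 0" using deg_zero_impl_monom[OF t(1)] by simp
      have c0: "up_ring.coeff U t 0 \<in> carrier A" using coeff_closed[OF t(1)] .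
      have "ev1 b t = fst (up_ring.coeff U t 0)" using U1.eval_const[OF b c0] e by metis
      then have "up_ring.coeff U t 0 = \<zero>\<^bsub>A\<^esub>" using t(3) zero_iff(1)[OF c0] by simp
      then show False using e t(2) by simp
    qed
    then obtain b' where b': "b' \<in> carrier G" "G.eval ?cs b' = \<zero>\<^bsub>G\<^esub>"
      using G'.exists_root[OF poly] by auto
    have "ev2 b' t = (\<Oplus>\<^bsub>G\<^esub>i\<in>{..deg A t}. ?c i \<otimes>\<^bsub>G\<^esub> b' [^]\<^bsub>G\<^esub> i)"
      using eval_on_carrier[OF t(1), where S = G and phi = snd and s = b'] by simp
    also have "\<dots> = \<zero>\<^bsub>G\<^esub>" using G.finsum_eq_eval[of ?c b' "deg A t"] c' b' by simp
    finally show ?thesis using kernel_eq[OF b'(1) t _ min] b'(1) by blast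
  qed
  then show ?thesis using extend by blast
qed

end

section \<open>Ultrapowers\<close>

text \<open>Zorn's lemma for the reversed order, since finer filters are smaller in the order on
  filters. Being below \<open>sequentially\<close> makes the filter contain all cofinite
  sets.\<close>

lemma exists_nonprincipal_ultrafilter:
  "\<exists>U :: nat filter. U \<noteq> bot \<and> U \<le> sequentially \<and> (\<forall>P. eventually P U \<or> eventually (\<lambda>i. \<not> P i) U)"
proof -
  let ?A = "{F :: nat filter. F \<noteq> bot \<and> F \<le> sequentially}"
  let ?R = "\<lambda>F G :: nat filter. G \<le> F"
  have "\<exists>m\<in>?A. \<forall>a\<in>?A. a \<le> m \<longrightarrow> a = m"
  proof (rule predicate_Zorn)
    show "partial_order_on ?A (relation_of ?R ?A)"
      by (rule partial_order_on_relation_ofI) auto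
    fix C assume C: "C \<in> Chains (relation_of ?R ?A)"
    then have CA: "C \<subseteq> ?A" and lin: "\<And>a b. a \<in> C \<Longrightarrow> b \<in> C \<Longrightarrow> a \<le> b \<or> b \<le> a"
      unfolding Chains_def relation_of_def by auto
    show "\<exists>u\<in>?A. \<forall>a\<in>C. u \<le> a"
    proof (cases "C = {}")
      case True
      then show ?thesis by (intro bexI[of _ sequentially]) auto
    next
      case False
      \<comment> \<open>Finite parts of a chain have a least member, so their infima are proper, and
        this suffices for the infimum of the whole chain.\<close>
      have min: "finite Y \<Longrightarrow> Y \<noteq> {} \<Longrightarrow> Y \<subseteq> C \<Longrightarrow> \<exists>m\<in>Y. \<forall>a\<in>Y. m \<le> a" for Y
      proof (induction Y rule: finite_ne_induct)
        case (insert a Y)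
        then obtain m where "m \<in> Y" "\<forall>b\<in>Y. m \<le> b" by auto
        then show ?case using lin[of a m] insert.prems by (auto intro: order_trans)
      qed auto
      have "Inf C \<noteq> bot"
      proof (rule Inf_filter_not_bot)
        fix Y assume Y: "Y \<subseteq> C" "finite Y"
        show "Inf Y \<noteq> bot"
        proof (cases "Y = {}")
          case False
          then obtain m where m: "m \<in> Y" "\<forall>a\<in>Y. m \<le> a" using min Y by blast
          then have "m \<le> Inf Y" by (intro Inf_greatest) blast
          then show ?thesis using m CA Y by (auto simp: bot_unique)
        qed (simp add: trivial_limit_def)
      qed
      moreover obtain c where "c \<in> C" using False by blast
      then have "Inf C \<le> sequentially" using CA Inf_lower[of c C] by (auto intro: order_trans)
      ultimately have "Inf C \<in> ?A" by simp
      then show ?thesis by (rule bexI[rotated]) (simp add: Inf_lower)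
    qed
  qed
  then obtain U where UA: "U \<in> ?A" and max: "\<forall>F\<in>?A. F \<le> U \<longrightarrow> F = U" by (rule bexE)
  from UA have U: "U \<noteq> bot" "U \<le> sequentially" by simp_all
  have "eventually P U \<or> eventually (\<lambda>i. \<not> P i) U" for P
  proof (rule disjCI)
    \<comment> \<open>Cutting \<open>U\<close> down to the set where \<open>P\<close> holds keeps it
      proper, so by minimality the cut changes nothing.\<close>
    assume "\<not> eventually (\<lambda>i. \<not> P i) U"
    then have "inf U (principal {i. P i}) \<noteq> bot"
      by (simp add: trivial_limit_def eventually_inf_principal)
    moreover have "inf U (principal {i. P i}) \<le> sequentially" using U(2) inf.coboundedI1 by blast
    ultimately have "inf U (principal {i. P i}) = U" using max by simp
    then have "U \<le> principal {i. P i}" by (metis inf.cobounded2)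
    then show "eventually P U" by (simp add: le_principal)
  qed
  then show ?thesis using U by blast
qed

locale ultrafilter =
  fixes U :: "nat filter"
  assumes proper: "U \<noteq> bot" and nonprincipal: "U \<le> sequentially"
    and ultra: "eventually Q U \<or> eventually (\<lambda>i. \<not> Q i) U"
begin

lemma eventually_not_iff: "eventually (\<lambda>i. \<not> Q i) U \<longleftrightarrow> \<not> eventually Q U"
proof
  assume *: "eventually (\<lambda>i. \<not> Q i) U"
  show "\<not> eventually Q U"
  proof
    assume "eventually Q U"
    with * have "eventually (\<lambda>i. False) U" by eventually_elim simp
    then show False using proper by (simp add: trivial_limit_def)
  qed
qed (use ultra in blast)

lemma eventually_imp_iff: "eventually (\<lambda>i. Q i \<longrightarrow> R i) U \<longleftrightarrow> (eventually Q U \<longrightarrow> eventually R U)"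
  using ultra[of Q] eventually_mp[of Q R U] eventually_not_iff[of Q]
  by (auto elim: eventually_mono)

lemma eventually_ge: "eventually (\<lambda>i. n \<le> i) U"
  using nonprincipal eventually_ge_at_top[of n] unfolding le_filter_def by blast

text \<open>Elements of the ultrapower are representatives of classes, which keeps the type of the universe
  simple.\<close>

definition germ :: "(nat \<Rightarrow> 'u) \<Rightarrow> (nat \<Rightarrow> 'u)" where
  "germ f = (SOME g. eventually (\<lambda>i. f i = g i) U)"

lemma germ: "eventually (\<lambda>i. germ f i = f i) U"
proof -
  have "\<exists>g. eventually (\<lambda>i. f i = g i) U" by (rule exI[of _ f]) simp
  from someI_ex[OF this] have "eventually (\<lambda>i. f i = germ f i) U" unfolding germ_def .
  then show ?thesis by eventually_elim simp
qed

lemma germ_eq_iff: "germ f = germ g \<longleftrightarrow> eventually (\<lambda>i. f i = g i) U"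
proof
  assume eq: "germ f = germ g"
  from germ[of f] germ[of g] show "eventually (\<lambda>i. f i = g i) U"
    by eventually_elim (simp add: eq)
next
  assume *: "eventually (\<lambda>i. f i = g i) U"
  have "eventually (\<lambda>i. f i = h i) U \<longleftrightarrow> eventually (\<lambda>i. g i = h i) U" for h
  proof
    assume "eventually (\<lambda>i. f i = h i) U"
    with * show "eventually (\<lambda>i. g i = h i) U" by eventually_elim simp
  next
    assume "eventually (\<lambda>i. g i = h i) U"
    with * show "eventually (\<lambda>i. f i = h i) U" by eventually_elim simp
  qed
  then show "germ f = germ g" unfolding germ_def by simp
qed

definition ultrapower :: "('u, 'f, 'r) struct \<Rightarrow> (nat \<Rightarrow> 'u, 'f, 'r) struct" where
  "ultrapower M = \<lparr>universe = germ ` {f. range f \<subseteq> universe M},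
     fint = (\<lambda>s as. germ (\<lambda>i. fint M s (map (\<lambda>a. a i) as))),
     rint = (\<lambda>r as. eventually (\<lambda>i. rint M r (map (\<lambda>a. a i) as)) U)\<rparr>"

text \<open>On the negligible set of indices where \<open>f\<close> leaves the universe it is
  replaced by a default element, without changing the class.\<close>

lemma germ_in_ultrapower:
  assumes "eventually (\<lambda>i. f i \<in> universe M) U"
  shows "germ f \<in> universe (ultrapower M)"
proof -
  have "\<exists>d. d \<in> universe M"
  proof (rule ccontr)
    assume "\<not> ?thesis"
    then have "eventually (\<lambda>i. False) U" using assms by simp
    then show False using proper by (simp add: trivial_limit_def)
  qed
  then obtain d where d: "d \<in> universe M" by blast
  let ?g = "\<lambda>i. if f i \<in> universe M then f i else d"
  have "germ f = germ ?g" unfolding germ_eq_iff using assms by eventually_elim simp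
  moreover have "range ?g \<subseteq> universe M" using d by auto
  ultimately show ?thesis unfolding ultrapower_def by auto
qed

lemma in_ultrapowerE:
  assumes "a \<in> universe (ultrapower M)"
  obtains f where "range f \<subseteq> universe M" "a = germ f"
  using assms unfolding ultrapower_def by auto

lemma eventually_map_eq:
  assumes "\<And>t. t \<in> set ts \<Longrightarrow> eventually (\<lambda>i. f t i = g t i) U"
  shows "eventually (\<lambda>i. map (\<lambda>t. f t i) ts = map (\<lambda>t. g t i) ts) U"
proof -
  have "eventually (\<lambda>i. \<forall>t\<in>set ts. f t i = g t i) U" using assms by (simp add: eventually_ball_finite)
  then show ?thesis by eventually_elim simp
qed

lemma eval_tm_ultrapower:
  "eval_tm (ultrapower M) (\<lambda>x. germ (e x)) t = germ (\<lambda>i. eval_tm M (\<lambda>x. e x i) t)"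
proof (induction t)
  case (App f ts)
  have "eventually (\<lambda>i. map (\<lambda>t. eval_tm (ultrapower M) (\<lambda>x. germ (e x)) t i) ts
      = map (\<lambda>t. eval_tm M (\<lambda>x. e x i) t) ts) U"
    by (rule eventually_map_eq) (simp add: App.IH germ)
  then have "eventually (\<lambda>i. fint M f (map (\<lambda>t. eval_tm (ultrapower M) (\<lambda>x. germ (e x)) t i) ts)
      = fint M f (map (\<lambda>t. eval_tm M (\<lambda>x. e x i) t) ts)) U"
    by eventually_elim (rule arg_cong)
  then show ?case by (simp add: ultrapower_def germ_eq_iff comp_def)
qed simp

theorem Los:
  assumes "\<And>x i. e x i \<in> universe M"
  shows "sat (ultrapower M) (\<lambda>x. germ (e x)) \<phi> \<longleftrightarrow> eventually (\<lambda>i. sat M (\<lambda>x. e x i) \<phi>) U"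
  using assms
proof (induction \<phi> arbitrary: e)
  case Falsum
  then show ?case using proper by (simp add: trivial_limit_def)
next
  case (Eq s t)
  show ?case by (simp add: eval_tm_ultrapower germ_eq_iff)
next
  case (Rel r ts)
  have *: "eventually (\<lambda>i. map (\<lambda>t. eval_tm (ultrapower M) (\<lambda>x. germ (e x)) t i) ts
      = map (\<lambda>t. eval_tm M (\<lambda>x. e x i) t) ts) U"
    by (rule eventually_map_eq) (simp add: eval_tm_ultrapower germ)
  have "sat (ultrapower M) (\<lambda>x. germ (e x)) (Rel r ts) \<longleftrightarrow>
      eventually (\<lambda>i. rint M r (map (\<lambda>t. eval_tm (ultrapower M) (\<lambda>x. germ (e x)) t i) ts)) U"
    by (simp add: ultrapower_def comp_def)
  also have "\<dots> \<longleftrightarrow> eventually (\<lambda>i. rint M r (map (\<lambda>t. eval_tm M (\<lambda>x. e x i) t) ts)) U"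
  proof (rule eventually_subst)
    from * show "eventually (\<lambda>i. rint M r (map (\<lambda>t. eval_tm (ultrapower M) (\<lambda>x. germ (e x)) t i) ts)
        = rint M r (map (\<lambda>t. eval_tm M (\<lambda>x. e x i) t) ts)) U"
      by eventually_elim (rule arg_cong)
  qed
  finally show ?case by simp
next
  case (Imp \<phi> \<psi>)
  then show ?case by (simp add: eventually_imp_iff)
next
  case (Forall x \<phi>)
  have upd: "sat (ultrapower M) ((\<lambda>y. germ (e y))(x := germ f)) \<phi>
      \<longleftrightarrow> eventually (\<lambda>i. sat M ((\<lambda>y. e y i)(x := f i)) \<phi>) U"
    if f: "\<And>i. f i \<in> universe M" for f
  proof -
    have 1: "(\<lambda>y. germ (e y))(x := germ f) = (\<lambda>y. germ ((e(x := f)) y))" by auto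
    have 2: "(\<lambda>y. (e(x := f)) y i) = (\<lambda>y. e y i)(x := f i)" for i by auto
    show ?thesis unfolding 1 using Forall.IH[of "e(x := f)"] Forall.prems f
      by (simp only: 2[symmetric]) (simp add: fun_upd_apply)
  qed
  show ?case
  proof
    assume L: "sat (ultrapower M) (\<lambda>x. germ (e x)) (Forall x \<phi>)"
    show "eventually (\<lambda>i. sat M (\<lambda>x. e x i) (Forall x \<phi>)) U"
    proof (rule ccontr)
      assume "\<not> ?thesis"
      then have ne: "eventually (\<lambda>i. \<exists>a\<in>universe M. \<not> sat M ((\<lambda>y. e y i)(x := a)) \<phi>) U"
        using eventually_not_iff[of "\<lambda>i. sat M (\<lambda>x. e x i) (Forall x \<phi>)"] by simp
      \<comment> \<open>\<open>f\<close> picks a counterexample at every index that has one. Its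
        class then refutes the universal formula in the ultrapower.\<close>
      have "\<exists>f. \<forall>i. f i \<in> universe M \<and>
          ((\<exists>a\<in>universe M. \<not> sat M ((\<lambda>y. e y i)(x := a)) \<phi>) \<longrightarrow> \<not> sat M ((\<lambda>y. e y i)(x := f i)) \<phi>)"
        using Forall.prems by (intro choice) blast
      then obtain f where f: "\<And>i. f i \<in> universe M"
        "\<And>i. (\<exists>a\<in>universe M. \<not> sat M ((\<lambda>y. e y i)(x := a)) \<phi>) \<Longrightarrow> \<not> sat M ((\<lambda>y. e y i)(x := f i)) \<phi>" by blast
      have "germ f \<in> universe (ultrapower M)" using f by (intro germ_in_ultrapower) simp
      then have "eventually (\<lambda>i. sat M ((\<lambda>y. e y i)(x := f i)) \<phi>) U" using upd[of f, OF f(1)] L by simp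
      with ne have "eventually (\<lambda>i. False) U" by eventually_elim (use f(2) in blast)
      then show False using proper by (simp add: trivial_limit_def)
    qed
  next
    assume R: "eventually (\<lambda>i. sat M (\<lambda>x. e x i) (Forall x \<phi>)) U"
    show "sat (ultrapower M) (\<lambda>x. germ (e x)) (Forall x \<phi>)"
      unfolding sat.simps
    proof
      fix a assume "a \<in> universe (ultrapower M)"
      then obtain f where fM: "range f \<subseteq> universe M" and f2: "a = germ f" by (rule in_ultrapowerE)
      have f: "f i \<in> universe M" for i using fM by blast
      from R have "eventually (\<lambda>i. sat M ((\<lambda>y. e y i)(x := f i)) \<phi>) U"
        by eventually_elim (simp add: f)
      then show "sat (ultrapower M) ((\<lambda>x. germ (e x))(x := a)) \<phi>" using upd[of f, OF f] f2 by simp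
    qed
  qed
qed

lemma is_structure_ultrapower:
  assumes "is_structure L M"
  shows "is_structure L (ultrapower M)"
  unfolding is_structure_def
proof (intro conjI allI impI)
  obtain d where "d \<in> universe M" using assms unfolding is_structure_def by blast
  then have "germ (\<lambda>i. d) \<in> universe (ultrapower M)" by (intro germ_in_ultrapower) simp
  then show "universe (ultrapower M) \<noteq> {}" by blast
  fix f n as assume f: "funs L f = Some n" "length as = n" "set as \<subseteq> universe (ultrapower M)"
  have "eventually (\<lambda>i. \<forall>a\<in>set as. a i \<in> universe M) U"
  proof (rule eventually_ball_finite, simp, rule ballI)
    fix a assume "a \<in> set as"
    then obtain g where g: "range g \<subseteq> universe M" "a = germ g" using f(3) in_ultrapowerE by (metis subsetD)
    show "eventually (\<lambda>i. a i \<in> universe M) U" unfolding g(2) using germ[of g] by eventually_elim (use g(1) in auto)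
  qed
  then have "eventually (\<lambda>i. fint M f (map (\<lambda>a. a i) as) \<in> universe M) U"
  proof eventually_elim
    case (elim i)
    then have "set (map (\<lambda>a. a i) as) \<subseteq> universe M" by auto
    then show ?case using assms f(1,2) unfolding is_structure_def by (metis length_map)
  qed
  then show "fint (ultrapower M) f as \<in> universe (ultrapower M)"
    using germ_in_ultrapower by (simp add: ultrapower_def)
qed

lemma assignment_germ:
  assumes "range E \<subseteq> universe (ultrapower M)"
  obtains e where "\<And>x i. e x i \<in> universe M" "E = (\<lambda>x. germ (e x))"
proof -
  have "\<exists>e. \<forall>x. (\<forall>i. e x i \<in> universe M) \<and> E x = germ (e x)"
    using assms by (intro choice) (metis (no_types, lifting) in_ultrapowerE rangeI subsetD)
  then show ?thesis using that by blast
qed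

lemma holds_ultrapower:
  assumes "is_structure L M" "fv \<phi> = {}"
  shows "holds (ultrapower M) \<phi> \<longleftrightarrow> holds M \<phi>"
proof -
  obtain d where d: "d \<in> universe M" using assms unfolding is_structure_def by blast
  then have "germ (\<lambda>i. d) \<in> universe (ultrapower M)" by (intro germ_in_ultrapower) simp
  then have "holds (ultrapower M) \<phi> \<longleftrightarrow> sat (ultrapower M) (\<lambda>x. germ (\<lambda>i. d)) \<phi>"
    using assms(2) by (intro holds_iff_sat) auto
  also have "\<dots> \<longleftrightarrow> eventually (\<lambda>i. sat M (\<lambda>x. d) \<phi>) U" using Los[of "\<lambda>x i. d"] d by simp
  also have "\<dots> \<longleftrightarrow> sat M (\<lambda>x. d) \<phi>" using proper by (cases "sat M (\<lambda>x. d) \<phi>") (auto simp: trivial_limit_def)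
  also have "\<dots> \<longleftrightarrow> holds M \<phi>" using assms(2) d by (intro holds_iff_sat[symmetric]) auto
  finally show ?thesis .
qed

section \<open>Saturation for countable sets of formulas\<close>

text \<open>The variables in \<open>W\<close> are to be realized, those outside are parameters.
  \<open>W\<close> may be infinite, which later allows a whole countable set to be matched in one
  step.\<close>

theorem saturation:
  assumes E: "range E \<subseteq> universe (ultrapower M)"
    and fin: "\<And>n :: nat. \<exists>E'. range E' \<subseteq> universe (ultrapower M) \<and> (\<forall>x. x \<notin> W \<longrightarrow> E' x = E x) \<and>
      (\<forall>k\<le>n. sat (ultrapower M) E' (\<psi> k))"
  shows "\<exists>E'. range E' \<subseteq> universe (ultrapower M) \<and> (\<forall>x. x \<notin> W \<longrightarrow> E' x = E x) \<and>
      (\<forall>k. sat (ultrapower M) E' (\<psi> k))"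
proof -
  obtain e where e: "\<And>x i. e x i \<in> universe M" "E = (\<lambda>x. germ (e x))" using assignment_germ[OF E] by blast
  define good where "good i n d \<longleftrightarrow> range d \<subseteq> universe M \<and> (\<forall>x. x \<notin> W \<longrightarrow> d x = e x i) \<and>
    (\<forall>k<n. sat M d (\<psi> k))" for i n d
  have ev: "eventually (\<lambda>i. \<exists>d. good i n d) U" for n
  proof -
    obtain E' where E': "range E' \<subseteq> universe (ultrapower M)" "\<forall>x. x \<notin> W \<longrightarrow> E' x = E x"
      "\<forall>k\<le>n. sat (ultrapower M) E' (\<psi> k)" using fin[of n] by blast
    obtain f where f: "\<And>x i. f x i \<in> universe M" "E' = (\<lambda>x. germ (f x))" using assignment_germ[OF E'(1)] by blast
    \<comment> \<open>\<open>good\<close> demands equality with the representatives \<open>e\<close>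
      on the parameters at the index itself, so these are kept literally rather than up to a
      negligible set.\<close>
    define g where "g x = (if x \<in> W then f x else e x)" for x
    have "E' = (\<lambda>x. germ (g x))" using E'(2) f(2) e(2) by (auto simp: g_def)
    moreover have g: "g x i \<in> universe M" for x i using f(1) e(1) by (simp add: g_def)
    ultimately have "\<forall>k<n. eventually (\<lambda>i. sat M (\<lambda>x. g x i) (\<psi> k)) U"
      using E'(3) Los[of g M] by auto
    then have "eventually (\<lambda>i. \<forall>k\<in>{..<n}. sat M (\<lambda>x. g x i) (\<psi> k)) U"
      by (intro eventually_ball_finite) auto
    then show ?thesis
    proof eventually_elim
      case (elim i)
      then have "good i n (\<lambda>x. g x i)" unfolding good_def using g by (auto simp: g_def)
      then show ?case by blast
    qed
  qed
  text \<open>At index \<open>i\<close> satisfy as many of the first \<open>i\<close> formulas as possible.\<close>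
  have zero: "good i 0 (\<lambda>x. e x i)" for i unfolding good_def using e(1) by auto
  \<comment> \<open>The bound by \<open>i\<close> makes the maximum exist; it does no harm, because
    almost all indices exceed any given number.\<close>
  define m where "m i = (GREATEST n. n \<le> i \<and> (\<exists>d. good i n d))" for i
  have m: "m i \<le> i \<and> (\<exists>d. good i (m i) d)" for i
    unfolding m_def by (rule GreatestI_nat[of _ 0 i]) (use zero in auto)
  have m_ge: "n \<le> m i" if "n \<le> i" "\<exists>d. good i n d" for n i
    unfolding m_def by (rule Greatest_le_nat[of _ _ i]) (use that in auto)
  obtain d where d: "\<And>i. good i (m i) (d i)" using m by metis
  let ?E = "\<lambda>x. germ (\<lambda>i. d i x)"
  have dM: "d i x \<in> universe M" for i x using d[of i] unfolding good_def by auto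
  have "range ?E \<subseteq> universe (ultrapower M)" using dM by (auto intro!: germ_in_ultrapower)
  moreover have "?E x = E x" if "x \<notin> W" for x
    unfolding e(2) using d that unfolding good_def by simp
  moreover have "sat (ultrapower M) ?E (\<psi> k)" for k
  proof -
    have "eventually (\<lambda>i. sat M (d i) (\<psi> k)) U"
      using ev[of "Suc k"] eventually_ge[of "Suc k"]
    proof eventually_elim
      case (elim i)
      then have "Suc k \<le> m i" using m_ge by blast
      then show ?case using d[of i] unfolding good_def by simp
    qed
    then show ?thesis using Los[of "\<lambda>x i. d i x" M] dM by simp
  qed
  ultimately show ?thesis by blast
qed

end

section \<open>Countable elementary submodels with isomorphic predicates\<close>

instance tm :: (countable) countable by countable_datatype
instance fm :: (countable, countable) countable by countable_datatype

lemma set_tm_wf: "wf_tm L t \<Longrightarrow> set_tm t \<subseteq> dom (funs L)"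
  by (induction t) (auto simp: list_all_iff)

lemma set_fm_wf: "wf_fm L \<phi> \<Longrightarrow> set1_fm \<phi> \<subseteq> dom (funs L) \<and> set2_fm \<phi> \<subseteq> dom (rels L)"
  by (induction \<phi>) (auto simp: list_all_iff dest: set_tm_wf)

lemma finite_set_tm: "finite (set_tm t)"
  by (induction t) auto

lemma finite_set_fm: "finite (set1_fm \<phi>)" "finite (set2_fm \<phi>)"
  by (induction \<phi>) (auto simp: finite_set_tm)

text \<open>The types of symbols may be uncountable. Renaming the symbols of \<open>L\<close> by
  natural numbers embeds its formulas into the countable type \<open>(nat, nat) fm\<close>.\<close>

lemma countable_wf_fm:
  assumes "countable (dom (funs L))" "countable (dom (rels L))"
  shows "countable {\<phi>. wf_fm L \<phi>}"
proof -
  let ?A = "dom (funs L)" and ?B = "dom (rels L)"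
  let ?f = "map_fm (to_nat_on ?A) (to_nat_on ?B)" and ?g = "map_fm (from_nat_into ?A) (from_nat_into ?B)"
  have gf: "?g (?f \<phi>) = \<phi>" if "wf_fm L \<phi>" for \<phi>
  proof -
    have sub: "set1_fm \<phi> \<subseteq> ?A" "set2_fm \<phi> \<subseteq> ?B" using set_fm_wf[OF that] by blast+
    have "?g (?f \<phi>) = map_fm id id \<phi>"
      unfolding fm.map_comp
    proof (rule fm.map_cong0)
      show "(from_nat_into ?A \<circ> to_nat_on ?A) z = id z" if "z \<in> set1_fm \<phi>" for z
        using that sub assms by (simp add: subset_eq)
      show "(from_nat_into ?B \<circ> to_nat_on ?B) z = id z" if "z \<in> set2_fm \<phi>" for z
        using that sub assms by (simp add: subset_eq)
    qed
    then show ?thesis by (simp add: fm.map_id)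
  qed
  have "{\<phi>. wf_fm L \<phi>} \<subseteq> range ?g"
  proof
    fix \<phi> assume "\<phi> \<in> {\<phi>. wf_fm L \<phi>}"
    then have "?g (?f \<phi>) = \<phi>" by (intro gf) simp
    from this[symmetric] show "\<phi> \<in> range ?g" by (rule range_eqI)
  qed
  then show ?thesis by (rule countable_subset) (intro countable_image countableI_type)
qed

lemma wf_tm_transfer: "wf_tm L t \<Longrightarrow> (\<And>f. f \<in> set_tm t \<Longrightarrow> funs L' f = funs L f) \<Longrightarrow> wf_tm L' t"
  by (induction t) (auto simp: list_all_iff)

lemma wf_fm_transfer:
  "wf_fm L \<phi> \<Longrightarrow> (\<And>f. f \<in> set1_fm \<phi> \<Longrightarrow> funs L' f = funs L f) \<Longrightarrow>
    (\<And>r. r \<in> set2_fm \<phi> \<Longrightarrow> rels L' r = rels L r) \<Longrightarrow> wf_fm L' \<phi>"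
  by (induction \<phi>) (auto simp: list_all_iff intro: wf_tm_transfer)

lemma wf_fm_sublang:
  assumes "sublang L L'" "wf_fm L \<phi>"
  shows "wf_fm L' \<phi>"
proof (rule wf_fm_transfer[OF assms(2)])
  show "funs L' f = funs L f" if "f \<in> set1_fm \<phi>" for f
    using set_fm_wf[OF assms(2)] assms(1) that unfolding sublang_def map_le_def by (metis subsetD)
  show "rels L' r = rels L r" if "r \<in> set2_fm \<phi>" for r
    using set_fm_wf[OF assms(2)] assms(1) that unfolding sublang_def map_le_def by (metis subsetD)
qed

lemma sentences_sublang: "sublang L L' \<Longrightarrow> sentences L \<subseteq> sentences L'"
  unfolding sentences_def using wf_fm_sublang by blast

lemma is_structure_sublang: "sublang L L' \<Longrightarrow> is_structure L' M \<Longrightarrow> is_structure L M"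
  unfolding is_structure_def sublang_def map_le_def by (metis domI)

lemma finite_dom_L_rings: "finite (dom (funs L_rings))"
  by (simp add: L_rings_def)

text \<open>The ring operations are kept even if \<phi> does not mention them, so that the field
  axioms remain expressible. Taking the preimage under \<open>Base\<close> drops \<open>P\<close>,
  which \<open>lang_P\<close> supplies again.\<close>

lemma finite_sublanguage:
  assumes "sublang L_rings L" "\<phi> \<in> sentences (lang_P L)"
  obtains L0 where "sublang L_rings L0" "sublang L0 L" "finite (dom (funs L0))" "finite (dom (rels L0))"
    "\<phi> \<in> sentences (lang_P L0)"
proof -
  let ?F = "dom (funs (L_rings :: ('a fsym, 'b) lang)) \<union> set1_fm \<phi>"
  let ?R = "Base -` set2_fm \<phi>"
  define L0 where "L0 = \<lparr>funs = funs L |` ?F, rels = rels L |` ?R\<rparr>"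
  have "sublang L_rings L0"
    using assms(1) unfolding sublang_def L0_def map_le_def
    by (auto simp: restrict_map_def L_rings_def)
  moreover have "sublang L0 L" unfolding sublang_def L0_def map_le_def by auto
  moreover have "finite (dom (funs L0))"
  proof -
    have "finite ?F" using finite_set_fm(1)[of \<phi>] finite_dom_L_rings by blast
    then show ?thesis unfolding L0_def by (simp add: finite_Int)
  qed
  moreover have "finite (dom (rels L0))"
    unfolding L0_def using finite_set_fm(2)[of \<phi>] by (auto intro!: finite_vimageI injI)
  moreover have "wf_fm (lang_P L0) \<phi>"
    by (rule wf_fm_transfer[of "lang_P L"])
      (use assms(2) in \<open>auto simp: sentences_def lang_P_def L0_def split: psym.split\<close>)
  ultimately show ?thesis using that assms(2) by (simp add: sentences_def)
qed

lemma countable_wf_fm_lang_P: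
  assumes "finite (dom (funs L))" "finite (dom (rels L))"
  shows "countable {\<phi>. wf_fm (lang_P L) \<phi>}"
proof (rule countable_wf_fm)
  show "countable (dom (funs (lang_P L)))" using assms by (simp add: lang_P_def countable_finite)
  have "dom (rels (lang_P L)) \<subseteq> insert P (Base ` dom (rels L))"
  proof
    fix s assume "s \<in> dom (rels (lang_P L))"
    then show "s \<in> insert P (Base ` dom (rels L))" by (cases s) (auto simp: lang_P_def dom_def)
  qed
  then show "countable (dom (rels (lang_P L)))"
    using assms(2) by (meson countable_finite finite_imageI finite_insert finite_subset)
qed

section \<open>Elementary subsets\<close>

text \<open>The Tarski-Vaught criterion, phrased with counterexamples to universal formulas because
  \<open>Forall\<close> is the primitive quantifier.\<close>

definition elementary_subset :: "('f, 'r) lang \<Rightarrow> ('u, 'f, 'r) struct \<Rightarrow> 'u set \<Rightarrow> bool" where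
  "elementary_subset L M A \<longleftrightarrow> A \<noteq> {} \<and> A \<subseteq> universe M \<and>
     (\<forall>\<phi> x e. wf_fm L \<phi> \<longrightarrow> range e \<subseteq> A \<longrightarrow> (\<exists>a\<in>universe M. \<not> sat M (e(x := a)) \<phi>) \<longrightarrow>
        (\<exists>a\<in>A. \<not> sat M (e(x := a)) \<phi>))"

text \<open>The value of \<open>f\<close> is the only counterexample to "the variable n differs from
  f applied to the variables below n", so the criterion puts it into \<open>A\<close>.\<close>

lemma elementary_subset_closed:
  assumes M: "is_structure L M" and A: "elementary_subset L M A"
    and f: "funs L f = Some (length as)" and as: "set as \<subseteq> A"
  shows "fint M f as \<in> A"
proof -
  obtain h where h: "h \<in> A" using A unfolding elementary_subset_def by blast
  define n where "n = length as"
  define \<phi> :: "('a, 'b) fm" where "\<phi> = Neg (Eq (Var n) (App f (map Var [0..<n])))"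
  have ev: "eval_tm M ((assign h as)(n := a)) (App f (map Var [0..<n])) = fint M f as" for a
    by (auto simp: assign_def n_def comp_def intro!: arg_cong[where f = "fint M f"] nth_equalityI)
  have "wf_fm L \<phi>" using f unfolding \<phi>_def n_def by (simp add: list_all_iff)
  moreover have "range (assign h as) \<subseteq> A" using as h nth_mem[of _ as] by (auto simp: assign_def)
  moreover have "fint M f as \<in> universe M"
    using M f as A unfolding is_structure_def elementary_subset_def by blast
  moreover have "\<not> sat M ((assign h as)(n := fint M f as)) \<phi>"
    using ev[of "fint M f as"] unfolding \<phi>_def by simp
  ultimately obtain a where "a \<in> A" "\<not> sat M ((assign h as)(n := a)) \<phi>"
    using A unfolding elementary_subset_def by blast
  then show ?thesis using ev[of a] unfolding \<phi>_def by simp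
qed

lemma eval_tm_universe_update: "eval_tm (M\<lparr>universe := A\<rparr>) e t = eval_tm M e t"
  by (induction t) (auto cong: map_cong)

lemma sat_elementary_subset:
  assumes A: "elementary_subset L M A" and "wf_fm L \<phi>" "range e \<subseteq> A"
  shows "sat (M\<lparr>universe := A\<rparr>) e \<phi> \<longleftrightarrow> sat M e \<phi>"
  using assms(2,3)
proof (induction \<phi> arbitrary: e)
  case (Forall x \<phi>)
  have "sat (M\<lparr>universe := A\<rparr>) (e(x := a)) \<phi> \<longleftrightarrow> sat M (e(x := a)) \<phi>" if "a \<in> A" for a
    using Forall that by (intro Forall.IH) auto
  then have "sat (M\<lparr>universe := A\<rparr>) e (Forall x \<phi>) \<longleftrightarrow> (\<forall>a\<in>A. sat M (e(x := a)) \<phi>)" by simp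
  moreover have "A \<subseteq> universe M" "wf_fm L \<phi>" using A Forall.prems by (auto simp: elementary_subset_def)
  moreover from this have "(\<exists>a\<in>universe M. \<not> sat M (e(x := a)) \<phi>) \<longrightarrow> (\<exists>a\<in>A. \<not> sat M (e(x := a)) \<phi>)"
    using A Forall.prems(2) unfolding elementary_subset_def by blast
  ultimately show ?case by auto
qed (simp_all add: eval_tm_universe_update cong: map_cong)

lemma is_structure_elementary_subset:
  assumes "is_structure L M" "elementary_subset L M A"
  shows "is_structure L (M\<lparr>universe := A\<rparr>)"
  using assms elementary_subset_closed[OF assms] unfolding is_structure_def[of L "M\<lparr>universe := A\<rparr>"]
  by (auto simp: elementary_subset_def)

lemma holds_elementary_subset:
  assumes A: "elementary_subset L M A" and \<phi>: "\<phi> \<in> sentences L"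
  shows "holds (M\<lparr>universe := A\<rparr>) \<phi> \<longleftrightarrow> holds M \<phi>"
proof -
  obtain d where d: "d \<in> A" "A \<subseteq> universe M" using A unfolding elementary_subset_def by blast
  define e where "e = (\<lambda>_::nat. d)"
  have e: "range e \<subseteq> A" using d by (auto simp: e_def)
  have "holds (M\<lparr>universe := A\<rparr>) \<phi> \<longleftrightarrow> sat (M\<lparr>universe := A\<rparr>) e \<phi>"
    using \<phi> e by (intro holds_iff_sat) (auto simp: sentences_def)
  also have "\<dots> \<longleftrightarrow> sat M e \<phi>" using \<phi> e by (intro sat_elementary_subset[OF A]) (auto simp: sentences_def)
  also have "\<dots> \<longleftrightarrow> holds M \<phi>" using \<phi> e d by (intro holds_iff_sat[symmetric]) (auto simp: sentences_def)
  finally show ?thesis .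
qed

section \<open>Partial elementary maps between the predicates\<close>

definition saturated :: "('u, 'f, 'r) struct \<Rightarrow> bool" where
  "saturated M \<longleftrightarrow> (\<forall>E W (\<psi> :: nat \<Rightarrow> ('f, 'r) fm). range E \<subseteq> universe M \<longrightarrow>
     (\<forall>n. \<exists>E'. range E' \<subseteq> universe M \<and> (\<forall>x. x \<notin> W \<longrightarrow> E' x = E x) \<and> (\<forall>k\<le>n. sat M E' (\<psi> k))) \<longrightarrow>
     (\<exists>E'. range E' \<subseteq> universe M \<and> (\<forall>x. x \<notin> W \<longrightarrow> E' x = E x) \<and> (\<forall>k. sat M E' (\<psi> k))))"

lemma (in ultrafilter) saturated_ultrapower: "saturated (ultrapower M)"
  unfolding saturated_def using saturation[of _ M] by blast

lemma sat_Existss: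
  "sat M e (Existss xs \<phi>) \<longleftrightarrow>
    (\<exists>e'. (\<forall>x. x \<notin> set xs \<longrightarrow> e' x = e x) \<and> (\<forall>x\<in>set xs. e' x \<in> universe M) \<and> sat M e' \<phi>)"
proof (induction xs arbitrary: e)
  case Nil
  have "(\<forall>x. e' x = e x) \<longleftrightarrow> e' = e" for e' by auto
  then show ?case by (simp add: Existss_def)
next
  case (Cons y ys)
  have "sat M e (Existss (y # ys) \<phi>) \<longleftrightarrow> (\<exists>a\<in>universe M. sat M (e(y := a)) (Existss ys \<phi>))"
    by (simp add: Existss_def)
  also have "\<dots> \<longleftrightarrow> (\<exists>e'. (\<forall>x. x \<notin> set (y # ys) \<longrightarrow> e' x = e x) \<and>
      (\<forall>x\<in>set (y # ys). e' x \<in> universe M) \<and> sat M e' \<phi>)" (is "?l \<longleftrightarrow> ?r")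
  proof
    assume ?l
    then obtain a e' where "a \<in> universe M" "\<forall>x. x \<notin> set ys \<longrightarrow> e' x = (e(y := a)) x"
      "\<forall>x\<in>set ys. e' x \<in> universe M" "sat M e' \<phi>" unfolding Cons.IH by blast
    then show ?r by (intro exI[of _ e']) auto
  next
    assume ?r
    then obtain e' where e': "\<forall>x. x \<notin> set (y # ys) \<longrightarrow> e' x = e x"
      "\<forall>x\<in>set (y # ys). e' x \<in> universe M" "sat M e' \<phi>" by blast
    then have "sat M (e(y := e' y)) (Existss ys \<phi>)" unfolding Cons.IH by (intro exI[of _ e']) auto
    then show ?l using e' by auto
  qed
  finally show ?case .
qed

lemma sat_Conjs: "sat M e (Conjs \<phi>s) \<longleftrightarrow> (\<forall>\<phi>\<in>set \<phi>s. sat M e \<phi>)"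
  unfolding Conjs_def by (induction \<phi>s) auto

lemma wf_Conjs: "(\<And>\<phi>. \<phi> \<in> set \<phi>s \<Longrightarrow> wf_fm L \<phi>) \<Longrightarrow> wf_fm L (Conjs \<phi>s)"
  unfolding Conjs_def by (induction \<phi>s) auto

lemma fv_Conjs: "fv (Conjs \<phi>s) = (\<Union>\<phi>\<in>set \<phi>s. fv \<phi>)"
  unfolding Conjs_def by (induction \<phi>s) auto

lemma wf_Existss: "wf_fm L \<phi> \<Longrightarrow> wf_fm L (Existss xs \<phi>)"
  unfolding Existss_def by (induction xs) auto

lemma fv_Existss: "fv (Existss xs \<phi>) = fv \<phi> - set xs"
  unfolding Existss_def by (induction xs) auto

text \<open>With the variables in \<open>V\<close> read as constants, this says that sending
  \<open>e x\<close> to \<open>e' x\<close> is a partial elementary map.\<close>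

definition equivalent_on ::
  "('f, 'r) lang \<Rightarrow> ('u, 'f, 'r) struct \<Rightarrow> ('v, 'f, 'r) struct \<Rightarrow> nat set \<Rightarrow> (nat \<Rightarrow> 'u) \<Rightarrow> (nat \<Rightarrow> 'v) \<Rightarrow> bool"
  where "equivalent_on L K K' V e e' \<longleftrightarrow>
    (\<forall>\<theta>. wf_fm L \<theta> \<longrightarrow> fv \<theta> \<subseteq> V \<longrightarrow> sat K e \<theta> \<longleftrightarrow> sat K' e' \<theta>)"

lemma equivalent_on_sym: "equivalent_on L K K' V e e' \<Longrightarrow> equivalent_on L K' K V e' e"
  unfolding equivalent_on_def by blast

text \<open>The new names in \<open>W\<close> have a type over the old ones in the predicate of
  \<open>M\<close>; it is finitely satisfiable in the predicate of \<open>N\<close> by equivalence,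
  and saturation of \<open>N\<close> realizes it.\<close>

lemma equivalent_on_extend:
  fixes M :: "('u, 'f, 'r psym) struct" and N :: "('v, 'f, 'r psym) struct"
  assumes N: "saturated N" and L: "countable {\<theta>. wf_fm L \<theta>}"
    and e: "range e \<subseteq> universe (induced M)" and e': "range e' \<subseteq> universe (induced N)"
    and eq: "equivalent_on L (induced M) (induced N) V e e'"
    and e1: "range e1 \<subseteq> universe (induced M)" "\<And>x. x \<notin> W \<Longrightarrow> e1 x = e x" and VW: "V \<inter> W = {}"
  shows "\<exists>e1'. range e1' \<subseteq> universe (induced N) \<and> (\<forall>x. x \<notin> W \<longrightarrow> e1' x = e' x) \<and>
    equivalent_on L (induced M) (induced N) (V \<union> W) e1 e1'"
proof -
  \<comment> \<open>Saturation is available for \<open>N\<close> and not directly for its predicate.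
    The type is therefore relativized, and every variable is required to lie in
    \<open>P\<close>.\<close>
  let ?T = "{\<theta>. wf_fm L \<theta> \<and> fv \<theta> \<subseteq> V \<union> W \<and> sat (induced M) e1 \<theta>}"
  let ?\<Psi> = "range (\<lambda>x. inP (Var x)) \<union> relativize ` ?T"
  have "countable ?T" using L by (rule countable_subset[rotated]) blast
  then have "countable ?\<Psi>" by simp
  then obtain \<psi> :: "nat \<Rightarrow> ('f, 'r psym) fm" where \<psi>: "range \<psi> = ?\<Psi>"
    using range_from_nat_into[of ?\<Psi>] by blast
  have "\<exists>E'. range E' \<subseteq> universe N \<and> (\<forall>x. x \<notin> W \<longrightarrow> E' x = e' x) \<and> (\<forall>k\<le>n. sat N E' (\<psi> k))" for n
  proof -
    \<comment> \<open>Finitely many members of the type involve only finitely many \<theta>s. Their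
      conjunction, with the new variables quantified away, is a formula over \<open>V\<close>, and
      such formulas have the same truth value on both sides.\<close>
    have "\<exists>\<theta>s. set \<theta>s \<subseteq> ?T \<and> \<psi> ` {..n} \<subseteq> range (\<lambda>x. inP (Var x)) \<union> relativize ` set \<theta>s"
    proof -
      have "finite (\<psi> ` {..n} \<inter> relativize ` ?T)" by simp
      then obtain T' where T': "T' \<subseteq> ?T" "finite T'" "\<psi> ` {..n} \<inter> relativize ` ?T = relativize ` T'"
        by (metis (no_types, lifting) Int_lower2 finite_subset_image)
      obtain \<theta>s where "set \<theta>s = T'" using T'(2) finite_list by blast
      then have "set \<theta>s \<subseteq> ?T" using T' by simp
      moreover have "\<psi> k \<in> range (\<lambda>x. inP (Var x)) \<union> relativize ` set \<theta>s" if k: "k \<le> n" for k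
      proof (cases "\<psi> k \<in> relativize ` ?T")
        case True
        then have "\<psi> k \<in> \<psi> ` {..n} \<inter> relativize ` ?T" using k by blast
        then show ?thesis unfolding T'(3) \<open>set \<theta>s = T'\<close> by blast
      next
        case False
        moreover have "\<psi> k \<in> ?\<Psi>" unfolding \<psi>[symmetric] by (rule rangeI)
        ultimately show ?thesis by simp
      qed
      ultimately show ?thesis by (intro exI[of _ \<theta>s]) auto
    qed
    then obtain \<theta>s where \<theta>s: "set \<theta>s \<subseteq> ?T" "\<psi> ` {..n} \<subseteq> range (\<lambda>x. inP (Var x)) \<union> relativize ` set \<theta>s"
      by blast
    let ?C = "Conjs \<theta>s"
    obtain ws where ws: "set ws = fv ?C \<inter> W" using finite_fv[of ?C] finite_list by (metis finite_Int)
    have fvC: "fv ?C \<subseteq> V \<union> W" using \<theta>s(1) unfolding fv_Conjs by auto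
    have "sat (induced M) (\<lambda>x. if x \<in> set ws then e1 x else e x) ?C \<longleftrightarrow> sat (induced M) e1 ?C"
      by (rule sat_cong) (use fvC ws e1(2) VW in auto)
    then have "sat (induced M) (\<lambda>x. if x \<in> set ws then e1 x else e x) ?C"
      using \<theta>s(1) unfolding sat_Conjs by auto
    then have "sat (induced M) e (Existss ws ?C)"
      unfolding sat_Existss using e1(1) by (intro exI[of _ "\<lambda>x. if x \<in> set ws then e1 x else e x"]) auto
    moreover have "wf_fm L (Existss ws ?C)" using \<theta>s(1) by (intro wf_Existss wf_Conjs) auto
    moreover have "fv (Existss ws ?C) \<subseteq> V" using fvC ws unfolding fv_Existss by auto
    ultimately have "sat (induced N) e' (Existss ws ?C)" using eq unfolding equivalent_on_def by blast
    then obtain E' where E': "\<And>x. x \<notin> set ws \<Longrightarrow> E' x = e' x"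
      "\<And>x. x \<in> set ws \<Longrightarrow> E' x \<in> universe (induced N)" "sat (induced N) E' ?C"
      unfolding sat_Existss by blast
    have r: "E' x \<in> universe (induced N)" for x using E'(1,2)[of x] e' by (cases "x \<in> set ws") auto
    have "sat N E' (\<psi> k)" if "k \<le> n" for k
    proof -
      have "\<psi> k \<in> range (\<lambda>x. inP (Var x)) \<union> relativize ` set \<theta>s" using \<theta>s(2) that by auto
      then show ?thesis
      proof
        assume "\<psi> k \<in> range (\<lambda>x. inP (Var x))"
        then show ?thesis using r by (auto simp: induced_def)
      next
        assume "\<psi> k \<in> relativize ` set \<theta>s"
        then show ?thesis using E'(3) by (auto simp: sat_Conjs sat_relativize)
      qed
    qed
    moreover have "range E' \<subseteq> universe N" using r by (auto simp: induced_def)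
    ultimately show ?thesis using E'(1) ws by (intro exI[of _ E']) auto
  qed
  then have fin: "\<forall>n. \<exists>E'. range E' \<subseteq> universe N \<and> (\<forall>x. x \<notin> W \<longrightarrow> E' x = e' x) \<and> (\<forall>k\<le>n. sat N E' (\<psi> k))"
    by (rule allI)
  have "range e' \<subseteq> universe N" using e' by (auto simp: induced_def)
  note N[unfolded saturated_def, THEN spec[of _ e'], THEN spec[of _ W], THEN spec[of _ \<psi>], THEN mp, OF this, THEN mp, OF fin]
  then obtain E' where E': "range E' \<subseteq> universe N" "\<forall>x. x \<notin> W \<longrightarrow> E' x = e' x" "\<And>k. sat N E' (\<psi> k)"
    by blast
  have E'\<Psi>: "sat N E' \<chi>" if "\<chi> \<in> ?\<Psi>" for \<chi>
  proof -
    have "\<chi> \<in> range \<psi>" unfolding \<psi> by (fact that)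
    then show ?thesis using E'(3) by blast
  qed
  have "range E' \<subseteq> universe (induced N)"
    using E'(1) E'\<Psi>[of "inP (Var _)"] by (auto simp: induced_def)
  moreover have "equivalent_on L (induced M) (induced N) (V \<union> W) e1 E'"
    unfolding equivalent_on_def
  proof (intro allI impI)
    fix \<theta> assume \<theta>: "wf_fm L \<theta>" "fv \<theta> \<subseteq> V \<union> W"
    \<comment> \<open>One implication is enough: applied to negations it gives the converse.\<close>
    have *: "sat (induced N) E' \<theta>" if "sat (induced M) e1 \<theta>" "wf_fm L \<theta>" "fv \<theta> \<subseteq> V \<union> W" for \<theta>
      using E'\<Psi>[of "relativize \<theta>"] that by (simp add: sat_relativize)
    show "sat (induced M) e1 \<theta> \<longleftrightarrow> sat (induced N) E' \<theta>"
      using *[of \<theta>] *[of "Neg \<theta>"] \<theta> by (cases "sat (induced M) e1 \<theta>") simp_all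
  qed
  ultimately show ?thesis by (intro exI[of _ E'] conjI E'(2))
qed

section \<open>The chain of countable sets and its limit\<close>

text \<open>One step towards an elementary subset, with witnesses for parameters in \<open>A\<close>
  only. Just the free variables need values in \<open>A\<close>, as finitely many parameters always
  lie in one stage of a chain. \<open>Tr\<close> is the additional closure condition, later
  instantiated by transcendence.\<close>

definition contains_witnesses ::
  "('f, 'r) lang \<Rightarrow> ('u, 'f, 'r) struct \<Rightarrow> ('u list \<Rightarrow> 'u \<Rightarrow> bool) \<Rightarrow> 'u set \<Rightarrow> 'u set \<Rightarrow> bool" where
  "contains_witnesses L M Tr A B \<longleftrightarrow> A \<subseteq> B \<and> (\<forall>l. set l \<subseteq> A \<longrightarrow> (\<exists>b\<in>B. Tr l b)) \<and>
    (\<forall>\<phi> x e. wf_fm L \<phi> \<longrightarrow> e ` fv \<phi> \<subseteq> A \<longrightarrow> (\<exists>a\<in>universe M. \<not> sat M (e(x := a)) \<phi>) \<longrightarrow>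
        (\<exists>a\<in>B. \<not> sat M (e(x := a)) \<phi>))"

text \<open>Parameters are recorded by finite lists of values of the free variables, padded with
  \<open>d\<close>, so countably many witnesses suffice.\<close>

lemma countable_closure:
  fixes M :: "('u, 'f, 'r) struct" and Tr :: "'u list \<Rightarrow> 'u \<Rightarrow> bool"
  assumes L: "countable {\<phi>. wf_fm L \<phi>}" and A: "countable A" "A \<subseteq> universe M" and d: "d \<in> A"
    and Tr: "\<And>l. set l \<subseteq> universe M \<Longrightarrow> \<exists>b\<in>universe M. Tr l b"
  shows "\<exists>B. countable B \<and> B \<subseteq> universe M \<and> contains_witnesses L M Tr A B"
proof -
  let ?I = "{\<phi>. wf_fm L \<phi>} \<times> (UNIV :: nat set) \<times> lists A"
  define w where "w = (\<lambda>(\<phi>, x, l). SOME a. a \<in> universe M \<and> \<not> sat M ((assign d l)(x := a)) \<phi>)"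
  define t where "t l = (SOME b. b \<in> universe M \<and> Tr l b)" for l
  define B where "B = A \<union> ((w ` ?I \<union> t ` lists A) \<inter> universe M)"
  have "countable ?I" "countable (lists A)" using L A(1) by simp_all
  then have "countable B" unfolding B_def using A(1) by (simp add: countable_Int1)
  moreover have "\<exists>b\<in>B. Tr l b" if "set l \<subseteq> A" for l
  proof -
    have "\<exists>b. b \<in> universe M \<and> Tr l b" using Tr[of l] that A(2) by blast
    from someI_ex[OF this] have "t l \<in> universe M" "Tr l (t l)" unfolding t_def by auto
    moreover have "l \<in> lists A" using that by auto
    ultimately show ?thesis unfolding B_def by blast
  qed
  moreover have "\<exists>a\<in>B. \<not> sat M (e(x := a)) \<phi>"
    if "wf_fm L \<phi>" "e ` fv \<phi> \<subseteq> A" "a \<in> universe M" "\<not> sat M (e(x := a)) \<phi>" for \<phi> x e a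
  proof -
    obtain n where n: "\<And>y. y \<in> fv \<phi> \<Longrightarrow> y < n"
      using finite_fv[of \<phi>] unfolding finite_nat_set_iff_bounded by blast
    define l where "l = map (\<lambda>y. if y \<in> fv \<phi> then e y else d) [0..<n]"
    have l: "l \<in> lists A" using that(2) d unfolding l_def by (auto simp: image_subset_iff)
    have same: "sat M (e(x := c)) \<phi> \<longleftrightarrow> sat M ((assign d l)(x := c)) \<phi>" for c
      by (rule sat_cong) (auto simp: assign_def l_def dest: n)
    have "\<exists>a. a \<in> universe M \<and> \<not> sat M ((assign d l)(x := a)) \<phi>" using that same by blast
    from someI_ex[OF this] have "w (\<phi>, x, l) \<in> universe M \<and> \<not> sat M ((assign d l)(x := w (\<phi>, x, l))) \<phi>"
      unfolding w_def by simp
    moreover have "(\<phi>, x, l) \<in> ?I" using that l by simp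
    ultimately show ?thesis unfolding same B_def by blast
  qed
  ultimately show ?thesis using A(2) unfolding contains_witnesses_def by (intro exI[of _ B]) (auto simp: B_def)
qed

text \<open>Variables serve as names for the elements of the predicates. Each stage of the chain names the
  elements of countable sets by the variables of two new blocks.\<close>

definition block :: "nat \<Rightarrow> nat" where "block x = fst (prod_decode x)"

lemma equivalent_on_extend_block:
  fixes M :: "('u, 'f, 'r psym) struct" and N :: "('v, 'f, 'r psym) struct"
  assumes N: "saturated N" and L: "countable {\<theta>. wf_fm L \<theta>}"
    and e: "range e \<subseteq> universe (induced M)" and e': "range e' \<subseteq> universe (induced N)"
    and eq: "equivalent_on L (induced M) (induced N) {x. block x < n} e e'"
    and C: "countable C" "C \<subseteq> universe (induced M)"
  shows "\<exists>e1 e1'. range e1 \<subseteq> universe (induced M) \<and> range e1' \<subseteq> universe (induced N) \<and>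
    equivalent_on L (induced M) (induced N) {x. block x < Suc n} e1 e1' \<and>
    (\<forall>x. block x < n \<longrightarrow> e1 x = e x \<and> e1' x = e' x) \<and> C \<subseteq> e1 ` {x. block x < Suc n}"
proof -
  \<comment> \<open>\<open>C\<close> may be empty; adding \<open>e 0\<close> guarantees a surjective
    enumeration.\<close>
  define c where "c = from_nat_into (insert (e 0) C)"
  have c: "range c = insert (e 0) C" unfolding c_def using C by (intro range_from_nat_into) auto
  let ?W = "{x. block x = n}"
  define e1 where "e1 x = (if block x = n then c (snd (prod_decode x)) else e x)" for x
  have cI: "c i \<in> universe (induced M)" for i using c C(2) e by (metis insert_subset rangeI range_subsetD subsetD)
  then have e1: "range e1 \<subseteq> universe (induced M)" using e unfolding e1_def by auto
  have "\<exists>e1'. range e1' \<subseteq> universe (induced N) \<and> (\<forall>x. x \<notin> ?W \<longrightarrow> e1' x = e' x) \<and>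
    equivalent_on L (induced M) (induced N) ({x. block x < n} \<union> ?W) e1 e1'"
    by (rule equivalent_on_extend[OF N L e e' eq e1]) (auto simp: e1_def)
  moreover have "{x. block x < n} \<union> ?W = {x. block x < Suc n}" by auto
  ultimately obtain e1' where e1': "range e1' \<subseteq> universe (induced N)" "\<forall>x. x \<notin> ?W \<longrightarrow> e1' x = e' x"
    "equivalent_on L (induced M) (induced N) {x. block x < Suc n} e1 e1'" by auto
  have "C \<subseteq> e1 ` {x. block x < Suc n}"
  proof
    fix a assume "a \<in> C"
    then obtain i where "a = c i" using c by (metis insertI2 rangeE)
    then have "e1 (prod_encode (n, i)) = a" "block (prod_encode (n, i)) = n" unfolding e1_def block_def by auto
    then show "a \<in> e1 ` {x. block x < Suc n}" by (metis (mono_tags) imageI lessI mem_Collect_eq)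
  qed
  moreover have "\<forall>x. block x < n \<longrightarrow> e1 x = e x \<and> e1' x = e' x" using e1'(2) by (auto simp: e1_def)
  ultimately show ?thesis using e1 e1' by blast
qed

lemma equivalent_on_cong:
  assumes "equivalent_on L K K' V e e'" "\<And>x. x \<in> V \<Longrightarrow> e x = f x" "\<And>x. x \<in> V \<Longrightarrow> e' x = f' x"
  shows "equivalent_on L K K' V f f'"
  unfolding equivalent_on_def
proof (intro allI impI)
  fix \<theta> assume \<theta>: "wf_fm L \<theta>" "fv \<theta> \<subseteq> V"
  have "sat K f \<theta> \<longleftrightarrow> sat K e \<theta>" by (rule sat_cong) (use assms(2) \<theta> in auto)
  moreover have "sat K' f' \<theta> \<longleftrightarrow> sat K' e' \<theta>" by (rule sat_cong) (use assms(3) \<theta> in auto)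
  ultimately show "sat K f \<theta> \<longleftrightarrow> sat K' f' \<theta>" using assms(1) \<theta> unfolding equivalent_on_def by blast
qed

text \<open>Finitely many parameters of the limit lie in a common \<open>A n\<close>, and their
  witnesses are in \<open>B n\<close>, hence in the next stage.\<close>

lemma elementary_chain_limit:
  fixes M :: "('u, 'f, 'r psym) struct" and A :: "nat \<Rightarrow> 'u set"
  assumes sub: "\<And>n. A n \<subseteq> universe M" and ne: "A 0 \<noteq> {}"
    and B: "\<And>n. contains_witnesses L M Tr (A n) (B n)" "\<And>n. B n \<subseteq> A (Suc n)"
  shows "elementary_subset L M (\<Union>n. A n)" and "\<forall>l. set l \<subseteq> (\<Union>n. A n) \<longrightarrow> (\<exists>b\<in>(\<Union>n. A n). Tr l b)"
proof -
  have AB: "A n \<subseteq> B n" for n using B(1) unfolding contains_witnesses_def by blast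
  have wTr: "\<exists>b\<in>B n. Tr l b" if "set l \<subseteq> A n" for l n
    using B(1)[of n] that unfolding contains_witnesses_def by blast
  have w: "\<exists>a\<in>B n. \<not> sat M (e(x := a)) \<phi>"
    if "wf_fm L \<phi>" "e ` fv \<phi> \<subseteq> A n" "\<exists>a\<in>universe M. \<not> sat M (e(x := a)) \<phi>" for \<phi> x e n
    using B(1)[of n] that unfolding contains_witnesses_def by blast
  have "A n \<subseteq> A (Suc n)" for n using AB B(2) by blast
  then have mono: "A m \<subseteq> A n" if "m \<le> n" for m n using that by (rule lift_Suc_mono_le)
  have fin: "\<exists>n. Y \<subseteq> A n" if "finite Y" "Y \<subseteq> (\<Union>n. A n)" for Y
    using that
  proof (induction Y rule: finite_induct)
    case (insert a Y)
    then obtain m n where "Y \<subseteq> A m" "a \<in> A n" by auto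
    then have "insert a Y \<subseteq> A (max m n)" using mono[of m "max m n"] mono[of n "max m n"] by auto
    then show ?case by blast
  qed simp
  show "\<forall>l. set l \<subseteq> (\<Union>n. A n) \<longrightarrow> (\<exists>b\<in>(\<Union>n. A n). Tr l b)"
  proof (intro allI impI)
    fix l assume l: "set l \<subseteq> (\<Union>n. A n)"
    obtain n where "set l \<subseteq> A n" using fin[OF _ l] by auto
    then show "\<exists>b\<in>(\<Union>n. A n). Tr l b" using wTr[of l n] B(2)[of n] by blast
  qed
  show "elementary_subset L M (\<Union>n. A n)"
    unfolding elementary_subset_def
  proof (intro conjI allI impI)
    fix \<phi> x and e :: "nat \<Rightarrow> 'u"
    assume *: "wf_fm L \<phi>" "range e \<subseteq> (\<Union>n. A n)" "\<exists>a\<in>universe M. \<not> sat M (e(x := a)) \<phi>"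
    have "finite (e ` fv \<phi>)" using finite_fv by (rule finite_imageI)
    moreover have "e ` fv \<phi> \<subseteq> (\<Union>n. A n)" using *(2) by (meson image_mono order_trans subset_UNIV)
    ultimately obtain n where "e ` fv \<phi> \<subseteq> A n" using fin by blast
    from w[OF *(1) this *(3)] obtain a where "a \<in> B n" "\<not> sat M (e(x := a)) \<phi>" by (rule bexE)
    moreover from this(1) have "a \<in> (\<Union>n. A n)" using B(2)[of n] by blast
    ultimately show "\<exists>a\<in>(\<Union>n. A n). \<not> sat M (e(x := a)) \<phi>" by (intro bexI)
  qed (use sub ne in auto)
qed

text \<open>The common variables enumerate exactly the predicates of the two submodels. Equivalence
  of all formulas under these enumerations contains the isomorphism, since equality and the symbols
  of \<open>L\<close> are atomic formulas.\<close>

theorem exists_isomorphic_predicates: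
  fixes M :: "('u, 'f, 'r psym) struct" and N :: "('v, 'f, 'r psym) struct"
  assumes M: "saturated M" and N: "saturated N"
    and L: "countable {\<theta>. wf_fm L \<theta>}" "countable {\<phi>. wf_fm LP \<phi>}"
    and neM: "d \<in> universe (induced M)" and neN: "d' \<in> universe (induced N)"
    and eq: "\<And>\<theta>. \<theta> \<in> sentences L \<Longrightarrow> holds (induced M) \<theta> \<longleftrightarrow> holds (induced N) \<theta>"
    and TrM: "\<And>l. set l \<subseteq> universe M \<Longrightarrow> \<exists>b\<in>universe M. TrM l b"
    and TrN: "\<And>l. set l \<subseteq> universe N \<Longrightarrow> \<exists>b\<in>universe N. TrN l b"
  shows "\<exists>A B e e'. elementary_subset LP M A \<and> elementary_subset LP N B \<and>
    range e = A \<inter> universe (induced M) \<and> range e' = B \<inter> universe (induced N) \<and>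
    equivalent_on L (induced M) (induced N) UNIV e e' \<and>
    (\<forall>l. set l \<subseteq> A \<longrightarrow> (\<exists>b\<in>A. TrM l b)) \<and> (\<forall>l. set l \<subseteq> B \<longrightarrow> (\<exists>b\<in>B. TrN l b))"
proof -
  let ?M = "universe (induced M)" and ?N = "universe (induced N)"
  have PM: "?M \<subseteq> universe M" and PN: "?N \<subseteq> universe N" by (auto simp: induced_def)
  \<comment> \<open>Each stage consumes two blocks of variables, one per side; hence the factor
    2.\<close>
  define good where "good n = (\<lambda>(A, B, e, e'). countable A \<and> A \<subseteq> universe M \<and> countable B \<and> B \<subseteq> universe N \<and>
    d \<in> A \<and> d' \<in> B \<and> range e \<subseteq> ?M \<and> range e' \<subseteq> ?N \<and> equivalent_on L (induced M) (induced N) {x. block x < 2 * n} e e')"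
    for n
  \<comment> \<open>The next stage contains all witnesses, names those that lie in the predicate and
    absorbs every named element. Names given earlier are never changed, so the two enumerations
    converge.\<close>
  define step where "step n = (\<lambda>(A, B, e, e') (A1, B1, e1, e1').
    (\<exists>A'. contains_witnesses LP M TrM A A' \<and> A' \<subseteq> A1 \<and> A' \<inter> ?M \<subseteq> e1 ` {x. block x < 2 * Suc n}) \<and>
    (\<exists>B'. contains_witnesses LP N TrN B B' \<and> B' \<subseteq> B1 \<and> B' \<inter> ?N \<subseteq> e1' ` {x. block x < 2 * Suc n}) \<and>
    range e1 \<subseteq> A1 \<and> range e1' \<subseteq> B1 \<and>
    (\<forall>x. block x < 2 * n \<longrightarrow> e1 x = e x \<and> e1' x = e' x))" for n
  have start: "\<exists>S. good 0 S"
  proof -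
    \<comment> \<open>Before any names are given only sentences count, and on these the predicates
      agree by assumption.\<close>
    have "equivalent_on L (induced M) (induced N) {} (\<lambda>_. d) (\<lambda>_. d')"
      unfolding equivalent_on_def
    proof (intro allI impI)
      fix \<theta> assume \<theta>: "wf_fm L \<theta>" "fv \<theta> \<subseteq> {}"
      then have "holds (induced M) \<theta> \<longleftrightarrow> sat (induced M) (\<lambda>_. d) \<theta>" using neM by (intro holds_iff_sat) auto
      moreover have "holds (induced N) \<theta> \<longleftrightarrow> sat (induced N) (\<lambda>_. d') \<theta>" using neN \<theta> by (intro holds_iff_sat) auto
      ultimately show "sat (induced M) (\<lambda>_. d) \<theta> \<longleftrightarrow> sat (induced N) (\<lambda>_. d') \<theta>"
        using eq[of \<theta>] \<theta> by (simp add: sentences_def)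
    qed
    then have "good 0 ({d}, {d'}, (\<lambda>_. d), (\<lambda>_. d'))" unfolding good_def using neM neN PM PN by auto
    then show ?thesis by blast
  qed
  have ext: "\<exists>S'. good (Suc n) S' \<and> step n S S'" if S: "good n S" for n S
  proof -
    obtain A B e e' where S': "S = (A, B, e, e')" by (cases S)
    have g: "countable A" "A \<subseteq> universe M" "countable B" "B \<subseteq> universe N" "d \<in> A" "d' \<in> B"
      "range e \<subseteq> ?M" "range e' \<subseteq> ?N" "equivalent_on L (induced M) (induced N) {x. block x < 2 * n} e e'"
      using S unfolding S' good_def by auto
    obtain A' where A': "countable A'" "A' \<subseteq> universe M" "contains_witnesses LP M TrM A A'"
      using countable_closure[OF L(2) g(1,2,5), of TrM] TrM by blast
    obtain B' where B': "countable B'" "B' \<subseteq> universe N" "contains_witnesses LP N TrN B B'"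
      using countable_closure[OF L(2) g(3,4,6), of TrN] TrN by blast
    obtain e1 e1' where 1: "range e1 \<subseteq> ?M" "range e1' \<subseteq> ?N"
      "equivalent_on L (induced M) (induced N) {x. block x < Suc (2 * n)} e1 e1'"
      "\<forall>x. block x < 2 * n \<longrightarrow> e1 x = e x \<and> e1' x = e' x" "A' \<inter> ?M \<subseteq> e1 ` {x. block x < Suc (2 * n)}"
      using equivalent_on_extend_block[OF N L(1) g(7,8,9), of "A' \<inter> ?M"] A'(1) by (auto simp: countable_Int1)
    \<comment> \<open>The second block of the stage, with the two sides exchanged, names the
      predicate elements of the new set in \<open>N\<close>.\<close>
    obtain e2' e2 where 2: "range e2' \<subseteq> ?N" "range e2 \<subseteq> ?M"
      "equivalent_on L (induced N) (induced M) {x. block x < Suc (Suc (2 * n))} e2' e2"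
      "\<forall>x. block x < Suc (2 * n) \<longrightarrow> e2' x = e1' x \<and> e2 x = e1 x" "B' \<inter> ?N \<subseteq> e2' ` {x. block x < Suc (Suc (2 * n))}"
      using equivalent_on_extend_block[OF M L(1) 1(2,1) equivalent_on_sym[OF 1(3)], of "B' \<inter> ?N"] B'(1)
      by (auto simp: countable_Int1)
    let ?S = "(A' \<union> range e2, B' \<union> range e2', e2, e2')"
    have "good (Suc n) ?S"
      unfolding good_def using A' B' 2(1,2) equivalent_on_sym[OF 2(3)] g(5,6) PM PN
      by (auto simp: contains_witnesses_def)
    moreover have "step n S ?S"
    proof -
      have "A' \<inter> ?M \<subseteq> e2 ` {x. block x < 2 * Suc n}"
      proof
        fix a assume "a \<in> A' \<inter> ?M"
        then obtain x where "block x < Suc (2 * n)" "a = e1 x" using 1(5) by auto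
        then show "a \<in> e2 ` {x. block x < 2 * Suc n}" using 2(4) by (intro image_eqI[of _ _ x]) auto
      qed
      moreover have "B' \<inter> ?N \<subseteq> e2' ` {x. block x < 2 * Suc n}" using 2(5) by simp
      moreover have "\<forall>x. block x < 2 * n \<longrightarrow> e2 x = e x \<and> e2' x = e' x" using 1(4) 2(4) by simp
      ultimately show ?thesis unfolding step_def S' using A'(3) B'(3) by auto
    qed
    ultimately show ?thesis by blast
  qed
  obtain S where S: "\<And>n. good n (S n)" "\<And>n. step n (S n) (S (Suc n))"
    using dependent_nat_choice[of good step] start ext by metis
  define A B E E' where "A n = fst (S n)" and "B n = fst (snd (S n))" and "E n = fst (snd (snd (S n)))"
    and "E' n = snd (snd (snd (S n)))" for n
  have S_eq: "S n = (A n, B n, E n, E' n)" for n by (simp add: A_def B_def E_def E'_def)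
  have g: "A n \<subseteq> universe M" "B n \<subseteq> universe N" "d \<in> A n" "d' \<in> B n"
      "range (E n) \<subseteq> ?M" "range (E' n) \<subseteq> ?N"
      "equivalent_on L (induced M) (induced N) {x. block x < 2 * n} (E n) (E' n)" for n
    using S(1)[of n] unfolding S_eq good_def by auto
  have "\<exists>A'. contains_witnesses LP M TrM (A n) A' \<and> A' \<subseteq> A (Suc n) \<and> A' \<inter> ?M \<subseteq> E (Suc n) ` {x. block x < 2 * Suc n}" for n
    using S(2)[of n] unfolding S_eq step_def by auto
  then obtain CA where CA: "\<And>n. contains_witnesses LP M TrM (A n) (CA n)" "\<And>n. CA n \<subseteq> A (Suc n)"
    "\<And>n. CA n \<inter> ?M \<subseteq> E (Suc n) ` {x. block x < 2 * Suc n}" by metis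
  have "\<exists>B'. contains_witnesses LP N TrN (B n) B' \<and> B' \<subseteq> B (Suc n) \<and> B' \<inter> ?N \<subseteq> E' (Suc n) ` {x. block x < 2 * Suc n}" for n
    using S(2)[of n] unfolding S_eq step_def by auto
  then obtain CB where CB: "\<And>n. contains_witnesses LP N TrN (B n) (CB n)" "\<And>n. CB n \<subseteq> B (Suc n)"
    "\<And>n. CB n \<inter> ?N \<subseteq> E' (Suc n) ` {x. block x < 2 * Suc n}" by metis
  have rE: "range (E (Suc n)) \<subseteq> A (Suc n)" "range (E' (Suc n)) \<subseteq> B (Suc n)"
    "\<And>x. block x < 2 * n \<Longrightarrow> E (Suc n) x = E n x \<and> E' (Suc n) x = E' n x" for n
    using S(2)[of n] unfolding S_eq step_def by auto
  \<comment> \<open>A variable of block k is settled from stage k + 1 on, because k < 2 (k +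
    1).\<close>
  define e e' where "e x = E (Suc (block x)) x" and "e' x = E' (Suc (block x)) x" for x
  have stable: "E n x = e x \<and> E' n x = e' x" if "block x < 2 * n" for n x
  proof -
    have *: "E (m + k) x = E m x \<and> E' (m + k) x = E' m x" if "block x < 2 * m" for m k
      by (induction k) (use rE(3)[of x "m + _"] that in auto)
    show ?thesis
    proof (cases "n \<le> Suc (block x)")
      case True
      then show ?thesis using *[OF that, of "Suc (block x) - n"] unfolding e_def e'_def by simp
    next
      case False
      then show ?thesis using *[of "Suc (block x)" "n - Suc (block x)"] unfolding e_def e'_def by simp
    qed
  qed
  have "equivalent_on L (induced M) (induced N) UNIV e e'"
    unfolding equivalent_on_def
  proof (intro allI impI)
    fix \<theta> assume \<theta>: "wf_fm L \<theta>" "fv \<theta> \<subseteq> UNIV"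
    have "finite (block ` fv \<theta>)" using finite_fv by blast
    then obtain n where n: "\<And>x. x \<in> fv \<theta> \<Longrightarrow> block x < n"
      unfolding finite_nat_set_iff_bounded by blast
    have "equivalent_on L (induced M) (induced N) {x. block x < 2 * n} e e'"
      by (rule equivalent_on_cong[OF g(7)]) (use stable in auto)
    moreover have "fv \<theta> \<subseteq> {x. block x < 2 * n}" using n by fastforce
    ultimately show "sat (induced M) e \<theta> \<longleftrightarrow> sat (induced N) e' \<theta>" using \<theta> unfolding equivalent_on_def by blast
  qed
  moreover have "range e = (\<Union>n. A n) \<inter> ?M"
  proof
    show "range e \<subseteq> (\<Union>n. A n) \<inter> ?M" unfolding e_def using rE(1) g(5) by blast
    show "(\<Union>n. A n) \<inter> ?M \<subseteq> range e"
    proof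
      fix a assume "a \<in> (\<Union>n. A n) \<inter> ?M"
      then obtain n where "a \<in> CA n \<inter> ?M" using CA(1) unfolding contains_witnesses_def by blast
      then obtain x where "block x < 2 * Suc n" "a = E (Suc n) x" using CA(3) by blast
      then show "a \<in> range e" using stable[of x "Suc n"] by auto
    qed
  qed
  moreover have "range e' = (\<Union>n. B n) \<inter> ?N"
  proof
    show "range e' \<subseteq> (\<Union>n. B n) \<inter> ?N" unfolding e'_def using rE(2) g(6) by blast
    show "(\<Union>n. B n) \<inter> ?N \<subseteq> range e'"
    proof
      fix a assume "a \<in> (\<Union>n. B n) \<inter> ?N"
      then obtain n where "a \<in> CB n \<inter> ?N" using CB(1) unfolding contains_witnesses_def by blast
      then obtain x where "block x < 2 * Suc n" "a = E' (Suc n) x" using CB(3) by blast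
      then show "a \<in> range e'" using stable[of x "Suc n"] by auto
    qed
  qed
  moreover have ne: "A 0 \<noteq> {}" "B 0 \<noteq> {}" using g(3,4)[of 0] by auto
  moreover note elementary_chain_limit[of A M LP TrM CA, OF g(1) ne(1) CA(1,2)]
    elementary_chain_limit[of B N LP TrN CB, OF g(2) ne(2) CB(1,2)]
  ultimately show ?thesis by (intro exI[of _ "\<Union>n. A n"] exI[of _ "\<Union>n. B n"] exI[of _ e] exI[of _ e'] conjI)
qed

section \<open>Meaning of the axioms\<close>

definition ring_of :: "('u, 'f fsym, 'r) struct \<Rightarrow> 'u ring" where
  "ring_of M = \<lparr>carrier = universe M, monoid.mult = (\<lambda>a b. fint M RMul [a, b]), one = fint M ROne [],
     zero = fint M RZero [], add = (\<lambda>a b. fint M RAdd [a, b])\<rparr>"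

lemma ring_of_simps:
  "carrier (ring_of M) = universe M" "a \<otimes>\<^bsub>ring_of M\<^esub> b = fint M RMul [a, b]"
  "a \<oplus>\<^bsub>ring_of M\<^esub> b = fint M RAdd [a, b]" "\<one>\<^bsub>ring_of M\<^esub> = fint M ROne []" "\<zero>\<^bsub>ring_of M\<^esub> = fint M RZero []"
  by (simp_all add: ring_of_def)

text \<open>A \<open>ring\<close> record has no field for negation, so the symbol
  \<open>RNeg\<close> has to be tied to the additive inverse separately.\<close>

definition field_struct :: "('u, 'f fsym, 'r) struct \<Rightarrow> bool" where
  "field_struct M \<longleftrightarrow> field (ring_of M) \<and> (\<forall>a\<in>universe M. fint M RNeg [a] = \<ominus>\<^bsub>ring_of M\<^esub> a)"

lemma ring_closed:
  assumes "is_structure L M" "sublang L_rings L"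
  shows "fint M RZero [] \<in> universe M" "fint M ROne [] \<in> universe M"
    "a \<in> universe M \<Longrightarrow> fint M RNeg [a] \<in> universe M"
    "a \<in> universe M \<Longrightarrow> b \<in> universe M \<Longrightarrow> fint M RAdd [a, b] \<in> universe M"
    "a \<in> universe M \<Longrightarrow> b \<in> universe M \<Longrightarrow> fint M RMul [a, b] \<in> universe M"
proof -
  have f: "funs L RZero = Some 0" "funs L ROne = Some 0" "funs L RNeg = Some 1" "funs L RAdd = Some 2"
    "funs L RMul = Some 2"
    using assms(2) unfolding sublang_def map_le_def L_rings_def by (auto split: if_splits)
  have c: "fint M f as \<in> universe M" if "funs L f = Some (length as)" "set as \<subseteq> universe M" for f as
    using assms(1) that unfolding is_structure_def by blast
  show "fint M RZero [] \<in> universe M" "fint M ROne [] \<in> universe M"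
    "a \<in> universe M \<Longrightarrow> fint M RNeg [a] \<in> universe M"
    "a \<in> universe M \<Longrightarrow> b \<in> universe M \<Longrightarrow> fint M RAdd [a, b] \<in> universe M"
    "a \<in> universe M \<Longrightarrow> b \<in> universe M \<Longrightarrow> fint M RMul [a, b] \<in> universe M"
    using c[of RZero "[]"] c[of ROne "[]"] c[of RNeg "[a]"] c[of RAdd "[a, b]"] c[of RMul "[a, b]"] f
    by (simp_all add: numeral_2_eq_2)
qed

lemma field_struct_if_field_axioms:
  assumes M: "is_structure L M" "sublang L_rings L" and ax: "\<And>\<phi>. \<phi> \<in> Defs.field_axioms \<Longrightarrow> holds M \<phi>"
  shows "field_struct M"
proof -
  note cl = ring_closed[OF M]
  obtain d where d: "d \<in> universe M" using M unfolding is_structure_def by blast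
  have s: "sat M (\<lambda>_. d) \<phi>" if "\<phi> \<in> Defs.field_axioms" for \<phi>
    using ax[OF that] d unfolding holds_def by auto
  have add_assoc: "fint M RAdd [fint M RAdd [a, b], c] = fint M RAdd [a, fint M RAdd [b, c]]"
    and mul_assoc: "fint M RMul [fint M RMul [a, b], c] = fint M RMul [a, fint M RMul [b, c]]"
    and distrib: "fint M RMul [a, fint M RAdd [b, c]] = fint M RAdd [fint M RMul [a, b], fint M RMul [a, c]]"
    if "a \<in> universe M" "b \<in> universe M" "c \<in> universe M" for a b c
    using s[of "Foralls [0, 1, 2] (Eq (tadd (tadd (Var 0) (Var 1)) (Var 2)) (tadd (Var 0) (tadd (Var 1) (Var 2))))"]
      s[of "Foralls [0, 1, 2] (Eq (tmul (tmul (Var 0) (Var 1)) (Var 2)) (tmul (Var 0) (tmul (Var 1) (Var 2))))"]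
      s[of "Foralls [0, 1, 2] (Eq (tmul (Var 0) (tadd (Var 1) (Var 2))) (tadd (tmul (Var 0) (Var 1)) (tmul (Var 0) (Var 2))))"]
      that by (auto simp: Defs.field_axioms_def Foralls_def Let_def)
  have add_comm: "fint M RAdd [a, b] = fint M RAdd [b, a]" and mul_comm: "fint M RMul [a, b] = fint M RMul [b, a]"
    if "a \<in> universe M" "b \<in> universe M" for a b
    using s[of "Foralls [0, 1] (Eq (tadd (Var 0) (Var 1)) (tadd (Var 1) (Var 0)))"]
      s[of "Foralls [0, 1] (Eq (tmul (Var 0) (Var 1)) (tmul (Var 1) (Var 0)))"]
      that by (auto simp: Defs.field_axioms_def Foralls_def Let_def)
  have add_0: "fint M RAdd [a, fint M RZero []] = a" and neg: "fint M RAdd [a, fint M RNeg [a]] = fint M RZero []"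
    and mul_1: "fint M RMul [a, fint M ROne []] = a"
    and inv: "a \<noteq> fint M RZero [] \<Longrightarrow> \<exists>b\<in>universe M. fint M RMul [a, b] = fint M ROne []"
    if "a \<in> universe M" for a
    using s[of "Foralls [0] (Eq (tadd (Var 0) tzero) (Var 0))"]
      s[of "Foralls [0] (Eq (tadd (Var 0) (tneg (Var 0))) tzero)"]
      s[of "Foralls [0] (Eq (tmul (Var 0) tone) (Var 0))"]
      s[of "Foralls [0] (Imp (Neg (Eq (Var 0) tzero)) (Exists 1 (Eq (tmul (Var 0) (Var 1)) tone)))"]
      that by (auto simp: Defs.field_axioms_def Foralls_def Let_def)
  have one_zero: "fint M RZero [] \<noteq> fint M ROne []"
    using s[of "Neg (Eq tzero tone)"] by (auto simp: Defs.field_axioms_def Let_def)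
  have "abelian_group (ring_of M)"
  proof (rule abelian_groupI)
    fix x assume "x \<in> carrier (ring_of M)"
    then show "\<exists>y\<in>carrier (ring_of M). y \<oplus>\<^bsub>ring_of M\<^esub> x = \<zero>\<^bsub>ring_of M\<^esub>"
      using neg[of x] add_comm[of x "fint M RNeg [x]"] cl by (auto simp: ring_of_simps)
    show "\<zero>\<^bsub>ring_of M\<^esub> \<oplus>\<^bsub>ring_of M\<^esub> x = x" if "x \<in> carrier (ring_of M)"
      using that add_0[of x] add_comm[of x "fint M RZero []"] cl by (simp add: ring_of_simps)
  qed (auto simp: ring_of_simps cl add_assoc intro: add_comm)
  moreover have "comm_monoid (ring_of M)"
  proof (rule comm_monoidI)
    show "\<one>\<^bsub>ring_of M\<^esub> \<otimes>\<^bsub>ring_of M\<^esub> x = x" if "x \<in> carrier (ring_of M)" for x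
      using that mul_1[of x] mul_comm[of x "fint M ROne []"] cl by (simp add: ring_of_simps)
  qed (auto simp: ring_of_simps cl mul_assoc intro: mul_comm)
  moreover have "(x \<oplus>\<^bsub>ring_of M\<^esub> y) \<otimes>\<^bsub>ring_of M\<^esub> z = x \<otimes>\<^bsub>ring_of M\<^esub> z \<oplus>\<^bsub>ring_of M\<^esub> y \<otimes>\<^bsub>ring_of M\<^esub> z"
    if "x \<in> carrier (ring_of M)" "y \<in> carrier (ring_of M)" "z \<in> carrier (ring_of M)" for x y z
    using that distrib[of z x y] mul_comm[of z] cl by (simp add: ring_of_simps)
  ultimately have "cring (ring_of M)" by (rule cringI)
  then interpret cring "ring_of M" .
  have "field (ring_of M)"
  proof (rule cring_fieldI2)
    show "\<zero>\<^bsub>ring_of M\<^esub> \<noteq> \<one>\<^bsub>ring_of M\<^esub>" using one_zero by (simp add: ring_of_simps)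
    show "\<exists>b\<in>carrier (ring_of M). a \<otimes>\<^bsub>ring_of M\<^esub> b = \<one>\<^bsub>ring_of M\<^esub>"
      if "a \<in> carrier (ring_of M)" "a \<noteq> \<zero>\<^bsub>ring_of M\<^esub>" for a
      using that inv[of a] by (simp add: ring_of_simps)
  qed
  moreover have "fint M RNeg [a] = \<ominus>\<^bsub>ring_of M\<^esub> a" if "a \<in> universe M" for a
  proof -
    have "a \<oplus>\<^bsub>ring_of M\<^esub> fint M RNeg [a] = \<zero>\<^bsub>ring_of M\<^esub>" using neg[OF that] by (simp add: ring_of_simps)
    moreover have "a \<in> carrier (ring_of M)" "fint M RNeg [a] \<in> carrier (ring_of M)"
      using that cl by (simp_all add: ring_of_simps)
    ultimately show ?thesis using sum_zero_eq_neg a_comm by metis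
  qed
  ultimately show ?thesis unfolding field_struct_def by blast
qed

section \<open>The axioms for algebraic closedness\<close>

lemma sat_Foralls:
  "sat M e (Foralls xs \<phi>) \<longleftrightarrow>
    (\<forall>e'. (\<forall>x. x \<notin> set xs \<longrightarrow> e' x = e x) \<longrightarrow> (\<forall>x\<in>set xs. e' x \<in> universe M) \<longrightarrow> sat M e' \<phi>)"
proof (induction xs arbitrary: e)
  case Nil
  have "(\<forall>x. e' x = e x) \<longleftrightarrow> e' = e" for e' by auto
  then show ?case by (simp add: Foralls_def)
next
  case (Cons y ys)
  have "sat M e (Foralls (y # ys) \<phi>) \<longleftrightarrow> (\<forall>a\<in>universe M. sat M (e(y := a)) (Foralls ys \<phi>))"
    by (simp add: Foralls_def)
  also have "\<dots> \<longleftrightarrow> (\<forall>e'. (\<forall>x. x \<notin> set (y # ys) \<longrightarrow> e' x = e x) \<longrightarrow>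
      (\<forall>x\<in>set (y # ys). e' x \<in> universe M) \<longrightarrow> sat M e' \<phi>)" (is "?l \<longleftrightarrow> ?r")
  proof
    assume l: ?l
    show ?r
    proof (intro allI impI)
      fix e' assume e': "\<forall>x. x \<notin> set (y # ys) \<longrightarrow> e' x = e x" "\<forall>x\<in>set (y # ys). e' x \<in> universe M"
      then have "sat M (e(y := e' y)) (Foralls ys \<phi>)" using l by simp
      then show "sat M e' \<phi>" unfolding Cons.IH using e' by simp
    qed
  next
    assume r: ?r
    show ?l
    proof
      fix a assume "a \<in> universe M"
      then show "sat M (e(y := a)) (Foralls ys \<phi>)" unfolding Cons.IH
      proof (intro allI impI)
        fix e' assume *: "\<forall>x. x \<notin> set ys \<longrightarrow> e' x = (e(y := a)) x" "\<forall>x\<in>set ys. e' x \<in> universe M" "a \<in> universe M"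
        show "sat M e' \<phi>"
        proof (rule r[rule_format])
          show "e' x = e x" if "x \<notin> set (y # ys)" for x using * that by simp
          show "e' x \<in> universe M" if "x \<in> set (y # ys)" for x
            using * that by (cases "x \<in> set ys") auto
        qed
      qed
    qed
  qed
  finally show ?case .
qed

lemma holds_Foralls_upt:
  assumes d: "d \<in> universe M" and fv: "fv \<phi> \<subseteq> {..<n}"
  shows "holds M (Foralls [0..<n] \<phi>) \<longleftrightarrow>
    (\<forall>as. length as = n \<longrightarrow> set as \<subseteq> universe M \<longrightarrow> sat M (assign d as) \<phi>)"
proof
  assume h: "holds M (Foralls [0..<n] \<phi>)"
  show "\<forall>as. length as = n \<longrightarrow> set as \<subseteq> universe M \<longrightarrow> sat M (assign d as) \<phi>"
  proof (intro allI impI)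
    fix as assume as: "length as = n" "set as \<subseteq> universe M"
    have "sat M (\<lambda>_. d) (Foralls [0..<n] \<phi>)" using h d unfolding holds_def by auto
    moreover have "\<forall>x. x \<notin> set [0..<n] \<longrightarrow> assign d as x = d" using as by (auto simp: assign_def)
    moreover have "\<forall>x\<in>set [0..<n]. assign d as x \<in> universe M"
      using as nth_mem[of _ as] by (auto simp: assign_def)
    ultimately show "sat M (assign d as) \<phi>" unfolding sat_Foralls by blast
  qed
next
  assume h: "\<forall>as. length as = n \<longrightarrow> set as \<subseteq> universe M \<longrightarrow> sat M (assign d as) \<phi>"
  show "holds M (Foralls [0..<n] \<phi>)"
    unfolding holds_def sat_Foralls
  proof (intro allI impI)
    fix e e' assume e': "\<forall>x\<in>set [0..<n]. e' x \<in> universe M"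
    then have "sat M (assign d (map e' [0..<n])) \<phi>" by (intro h[rule_format]) auto
    moreover have "sat M e' \<phi> \<longleftrightarrow> sat M (assign d (map e' [0..<n])) \<phi>"
      by (rule sat_cong) (use fv in \<open>auto simp: assign_def\<close>)
    ultimately show "sat M e' \<phi>" by simp
  qed
qed

lemma eval_tpow:
  assumes "field_struct M" "eval_tm M e t \<in> universe M"
  shows "eval_tm M e (tpow t n) = eval_tm M e t [^]\<^bsub>ring_of M\<^esub> n"
proof (induction n)
  case (Suc n)
  interpret field "ring_of M" using assms(1) unfolding field_struct_def by blast
  have "eval_tm M e t \<in> carrier (ring_of M)" using assms(2) by (simp add: ring_of_simps)
  then have "eval_tm M e t \<otimes>\<^bsub>ring_of M\<^esub> eval_tm M e t [^]\<^bsub>ring_of M\<^esub> n = eval_tm M e t [^]\<^bsub>ring_of M\<^esub> Suc n"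
    by (simp add: m_comm)
  then show ?case using Suc by (simp add: ring_of_simps)
qed (simp add: ring_of_simps nat_pow_def)

lemma eval_tsum: "eval_tm M e (tsum ts) = foldr (\<oplus>\<^bsub>ring_of M\<^esub>) (map (eval_tm M e) ts) \<zero>\<^bsub>ring_of M\<^esub>"
  unfolding tsum_def by (induction ts) (simp_all add: ring_of_simps)

text \<open>\<open>tsum\<close> adds ascending powers, associated to the right, while
  \<open>eval\<close> reads descending ones; both orders have to be reversed.\<close>

lemma (in ring) foldr_add_eq_eval:
  assumes "x \<in> carrier R" "\<And>i. i < n \<Longrightarrow> c i \<in> carrier R"
  shows "foldr (\<oplus>) (map (\<lambda>i. c i \<otimes> x [^] i) [0..<n]) \<zero> = eval (map c (rev [0..<n])) x"
  using assms(2)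
proof (induction n)
  case (Suc n)
  have *: "foldr (\<oplus>) xs a = foldr (\<oplus>) xs \<zero> \<oplus> a" if "set xs \<subseteq> carrier R" "a \<in> carrier R" for xs a
  proof -
    have "foldr (\<oplus>) xs \<zero> \<in> carrier R \<and> foldr (\<oplus>) xs a = foldr (\<oplus>) xs \<zero> \<oplus> a"
      using that by (induction xs) (auto simp: a_assoc)
    then show ?thesis by blast
  qed
  have IH: "foldr (\<oplus>) (map (\<lambda>i. c i \<otimes> x [^] i) [0..<n]) \<zero> = eval (map c (rev [0..<n])) x"
    using Suc by simp
  have set: "set (map (\<lambda>i. c i \<otimes> x [^] i) [0..<n]) \<subseteq> carrier R" using Suc.prems assms(1) by auto
  have ev: "eval (map c (rev [0..<n])) x \<in> carrier R" by (rule eval_in_carrier) (use Suc.prems assms(1) in auto)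
  have t: "c n \<otimes> x [^] n \<in> carrier R" using Suc.prems assms(1) by simp
  have "foldr (\<oplus>) (map (\<lambda>i. c i \<otimes> x [^] i) [0..<Suc n]) \<zero>
      = foldr (\<oplus>) (map (\<lambda>i. c i \<otimes> x [^] i) [0..<n]) (c n \<otimes> x [^] n \<oplus> \<zero>)" by simp
  also have "\<dots> = foldr (\<oplus>) (map (\<lambda>i. c i \<otimes> x [^] i) [0..<n]) \<zero> \<oplus> c n \<otimes> x [^] n"
    using *[OF set, of "c n \<otimes> x [^] n"] t by simp
  also have "\<dots> = eval (map c (rev [0..<Suc n])) x" unfolding IH using ev t by (simp add: a_comm)
  finally show ?case .
qed simp

lemma fv_tpow: "fv_tm (tpow t n) \<subseteq> fv_tm t"
  by (induction n) auto

lemma fv_tsum: "fv_tm (tsum ts) = (\<Union>t\<in>set ts. fv_tm t)"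
  unfolding tsum_def by (induction ts) auto

lemma holds_monic_root:
  assumes M: "field_struct M"
  shows "holds M (monic_root n) \<longleftrightarrow> (\<forall>c. (\<forall>i<n. c i \<in> universe M) \<longrightarrow>
    (\<exists>x\<in>universe M. ring.eval (ring_of M) (\<one>\<^bsub>ring_of M\<^esub> # map c (rev [0..<n])) x = \<zero>\<^bsub>ring_of M\<^esub>))"
proof -
  interpret field "ring_of M" using M unfolding field_struct_def by blast
  define d where "d = \<zero>\<^bsub>ring_of M\<^esub>"
  have d: "d \<in> universe M" using zero_closed by (simp add: d_def ring_of_simps)
  let ?t = "tadd (tpow (Var n) n) (tsum (map (\<lambda>i. tmul (Var i) (tpow (Var n) i)) [0..<n])) :: 'b fsym tm"
  have ev: "eval_tm M e ?t = eval (\<one>\<^bsub>ring_of M\<^esub> # map e (rev [0..<n])) (e n)"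
    if e: "\<And>i. i \<le> n \<Longrightarrow> e i \<in> universe M" for e
  proof -
    have en: "e n \<in> carrier (ring_of M)" using e by (simp add: ring_of_simps)
    have pow: "eval_tm M e (tpow (Var n) i) = e n [^]\<^bsub>ring_of M\<^esub> i" for i
      using eval_tpow[OF M, of e "Var n" i] e by simp
    have "eval_tm M e (tsum (map (\<lambda>i. tmul (Var i) (tpow (Var n) i)) [0..<n]))
        = foldr (\<oplus>\<^bsub>ring_of M\<^esub>) (map (\<lambda>i. e i \<otimes>\<^bsub>ring_of M\<^esub> e n [^]\<^bsub>ring_of M\<^esub> i) [0..<n]) \<zero>\<^bsub>ring_of M\<^esub>"
      unfolding eval_tsum by (simp add: comp_def pow ring_of_simps(2))
    also have "\<dots> = eval (map e (rev [0..<n])) (e n)"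
      by (rule foldr_add_eq_eval[OF en]) (use e in \<open>simp add: ring_of_simps\<close>)
    finally show ?thesis using en pow by (simp add: ring_of_simps(3)[symmetric])
  qed
  let ?\<phi> = "Exists n (Eq ?t tzero)"
  have "fv ?\<phi> \<subseteq> {..<n}" using fv_tpow[of "Var n"] by (fastforce simp: fv_tsum)
  then have "holds M (monic_root n) \<longleftrightarrow> (\<forall>as. length as = n \<longrightarrow> set as \<subseteq> universe M \<longrightarrow>
      (\<exists>x\<in>universe M. eval_tm M ((assign d as)(n := x)) ?t = \<zero>\<^bsub>ring_of M\<^esub>))"
    unfolding monic_root_def using holds_Foralls_upt[OF d, of ?\<phi> n] by (simp add: ring_of_simps)
  also have "\<dots> \<longleftrightarrow> (\<forall>as. length as = n \<longrightarrow> set as \<subseteq> universe M \<longrightarrow>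
      (\<exists>x\<in>universe M. eval (\<one>\<^bsub>ring_of M\<^esub> # map ((!) as) (rev [0..<n])) x = \<zero>\<^bsub>ring_of M\<^esub>))"
  proof (intro all_cong1 imp_cong refl bex_cong)
    fix as x assume as: "length as = n" "set as \<subseteq> universe M" "x \<in> universe M"
    have m: "map ((assign d as)(n := x)) (rev [0..<n]) = map ((!) as) (rev [0..<n])"
      using as by (auto simp: assign_def)
    have "eval_tm M ((assign d as)(n := x)) ?t
        = eval (\<one>\<^bsub>ring_of M\<^esub> # map ((assign d as)(n := x)) (rev [0..<n])) (((assign d as)(n := x)) n)"
      by (rule ev) (use as d nth_mem[of _ as] in \<open>auto simp: assign_def\<close>)
    then have "eval_tm M ((assign d as)(n := x)) ?t = eval (\<one>\<^bsub>ring_of M\<^esub> # map ((!) as) (rev [0..<n])) x"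
      unfolding m fun_upd_same .
    then show "(eval_tm M ((assign d as)(n := x)) ?t = \<zero>\<^bsub>ring_of M\<^esub>) \<longleftrightarrow>
       (eval (\<one>\<^bsub>ring_of M\<^esub> # map ((!) as) (rev [0..<n])) x = \<zero>\<^bsub>ring_of M\<^esub>)" by simp
  qed
  also have "\<dots> \<longleftrightarrow> (\<forall>c. (\<forall>i<n. c i \<in> universe M) \<longrightarrow>
    (\<exists>x\<in>universe M. eval (\<one>\<^bsub>ring_of M\<^esub> # map c (rev [0..<n])) x = \<zero>\<^bsub>ring_of M\<^esub>))" (is "?l \<longleftrightarrow> ?r")
  proof
    assume l: ?l
    show ?r
    proof (intro allI impI)
      fix c assume c: "\<forall>i<n. c i \<in> universe M"
      have m: "map ((!) (map c [0..<n])) (rev [0..<n]) = map c (rev [0..<n])" by auto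
      show "\<exists>x\<in>universe M. eval (\<one>\<^bsub>ring_of M\<^esub> # map c (rev [0..<n])) x = \<zero>\<^bsub>ring_of M\<^esub>"
      proof -
        have "set (map c [0..<n]) \<subseteq> universe M" using c by auto
        from l[rule_format, OF _ this] show ?thesis unfolding m by simp
      qed
    qed
  next
    assume ?r
    then show ?l using nth_mem by blast
  qed
  finally show ?thesis .
qed

lemma algebraically_closed_iff:
  assumes M: "field_struct M"
  shows "algebraically_closed (ring_of M) \<longleftrightarrow> (\<forall>n\<ge>1. holds M (monic_root n))"
proof
  assume "algebraically_closed (ring_of M)"
  then interpret algebraically_closed "ring_of M" .
  show "\<forall>n\<ge>1. holds M (monic_root n)"
    unfolding holds_monic_root[OF M]
  proof (intro allI impI)
    fix n :: nat and c assume n: "1 \<le> n" and c: "\<forall>i<n. c i \<in> universe M"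
    let ?p = "\<one>\<^bsub>ring_of M\<^esub> # map c (rev [0..<n])"
    have "?p \<in> carrier (poly_ring (ring_of M))"
      using c by (auto simp: univ_poly_def polynomial_def ring_of_simps(1)[symmetric])
    then show "\<exists>x\<in>universe M. eval ?p x = \<zero>\<^bsub>ring_of M\<^esub>"
      using exists_root[of ?p] n by (simp add: ring_of_simps(1))
  qed
next
  assume h: "\<forall>n\<ge>1. holds M (monic_root n)"
  interpret field "ring_of M" using M unfolding field_struct_def by blast
  show "algebraically_closed (ring_of M)"
  proof (rule algebraically_closedI)
    fix p assume p: "p \<in> carrier (poly_ring (ring_of M))" "degree p > 1"
    obtain a ps where ap: "p = a # ps" using p(2) by (cases p) auto
    have a: "a \<in> carrier (ring_of M)" "a \<noteq> \<zero>\<^bsub>ring_of M\<^esub>" and ps: "set ps \<subseteq> carrier (ring_of M)"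
      using p(1) unfolding ap by (auto simp: univ_poly_def polynomial_def)
    have ia: "inv\<^bsub>ring_of M\<^esub> a \<in> carrier (ring_of M)" "a \<otimes>\<^bsub>ring_of M\<^esub> inv\<^bsub>ring_of M\<^esub> a = \<one>\<^bsub>ring_of M\<^esub>"
      using a by (auto simp: field_Units)
    define n where "n = length ps"
    \<comment> \<open>Dividing by the leading coefficient makes the polynomial monic;
      \<open>rev\<close> gives the i-th coefficient the index i, as in
      \<open>monic_root\<close>.\<close>
    define c where "c i = inv\<^bsub>ring_of M\<^esub> a \<otimes>\<^bsub>ring_of M\<^esub> (rev ps ! i)" for i
    have "c i \<in> universe M" if "i < n" for i
      using that ia(1) ps nth_mem[of i "rev ps"] unfolding c_def n_def ring_of_simps(1)[symmetric] by auto
    moreover have "1 \<le> n" using p(2) unfolding ap n_def by simp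
    ultimately obtain x where x: "x \<in> universe M"
      "eval (\<one>\<^bsub>ring_of M\<^esub> # map c (rev [0..<n])) x = \<zero>\<^bsub>ring_of M\<^esub>"
      using h unfolding holds_monic_root[OF M] by blast
    have xc: "x \<in> carrier (ring_of M)" using x(1) by (simp add: ring_of_simps)
    have "map c (rev [0..<n]) = map ((\<otimes>\<^bsub>ring_of M\<^esub>) (inv\<^bsub>ring_of M\<^esub> a)) ps"
      unfolding c_def n_def by (rule nth_equalityI) (auto simp: rev_nth)
    then have "eval (map c (rev [0..<n])) x = inv\<^bsub>ring_of M\<^esub> a \<otimes>\<^bsub>ring_of M\<^esub> eval ps x"
      using eval_smult[OF ps xc ia(1)] by simp
    then have z: "x [^]\<^bsub>ring_of M\<^esub> n \<oplus>\<^bsub>ring_of M\<^esub> inv\<^bsub>ring_of M\<^esub> a \<otimes>\<^bsub>ring_of M\<^esub> eval ps x = \<zero>\<^bsub>ring_of M\<^esub>"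
      using x(2) xc by (simp add: n_def)
    have e: "eval ps x \<in> carrier (ring_of M)" using eval_in_carrier[OF ps xc] .
    have "eval p x = a \<otimes>\<^bsub>ring_of M\<^esub> (x [^]\<^bsub>ring_of M\<^esub> n \<oplus>\<^bsub>ring_of M\<^esub> inv\<^bsub>ring_of M\<^esub> a \<otimes>\<^bsub>ring_of M\<^esub> eval ps x)"
      using a ia e xc unfolding ap n_def by (simp add: r_distr m_assoc[symmetric])
    then have "eval p x = \<zero>\<^bsub>ring_of M\<^esub>" using z a by simp
    then show "\<exists>x\<in>carrier (ring_of M). eval p x = \<zero>\<^bsub>ring_of M\<^esub>" using xc by blast
  qed
qed

section \<open>The axioms about the predicate\<close>

lemma in_induced: "a \<in> universe (induced M) \<longleftrightarrow> a \<in> universe M \<and> rint M P [a]"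
  by (simp add: induced_def)

lemma subfield_induced_iff:
  assumes M: "field_struct M"
  shows "(\<forall>\<phi>\<in>Defs.subfield_axioms. holds M \<phi>) \<longleftrightarrow> subfield (universe (induced M)) (ring_of M)"
proof -
  interpret field "ring_of M" using M unfolding field_struct_def by blast
  have neg: "fint M RNeg [a] = \<ominus>\<^bsub>ring_of M\<^esub> a" if "a \<in> universe M" for a
    using M that unfolding field_struct_def by blast
  let ?K = "universe (induced M)"
  have d: "\<zero>\<^bsub>ring_of M\<^esub> \<in> universe M" using zero_closed by (simp add: ring_of_simps)
  have KM: "?K \<subseteq> carrier (ring_of M)" by (auto simp: induced_def ring_of_simps)
  have cl: "fint M RAdd [a, b] \<in> universe M" "fint M RMul [a, b] \<in> universe M"
    if "a \<in> universe M" "b \<in> universe M" for a b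
    using that a_closed[of a b] m_closed[of a b] by (simp_all add: ring_of_simps)
  have cl1: "\<ominus>\<^bsub>ring_of M\<^esub> a \<in> universe M" if "a \<in> universe M" for a
    using that a_inv_closed[of a] by (simp add: ring_of_simps(1))
  have one: "fint M ROne [] \<in> universe M" using one_closed by (simp add: ring_of_simps)
  show ?thesis
  proof
    assume "\<forall>\<phi>\<in>Defs.subfield_axioms. holds M \<phi>"
    then have s: "sat M (\<lambda>_. \<zero>\<^bsub>ring_of M\<^esub>) \<phi>" if "\<phi> \<in> Defs.subfield_axioms" for \<phi>
      using that d unfolding holds_def by auto
    have P1: "rint M P [fint M ROne []]"
      using s[of "inP tone"] by (simp add: Defs.subfield_axioms_def Let_def)
    have P2: "rint M P [fint M RAdd [a, b]]" "rint M P [fint M RMul [a, b]]" if "a \<in> ?K" "b \<in> ?K" for a b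
      using s[of "Foralls [0, 1] (Imp (inP (Var 0)) (Imp (inP (Var 1)) (inP (tadd (Var 0) (Var 1)))))"]
        s[of "Foralls [0, 1] (Imp (inP (Var 0)) (Imp (inP (Var 1)) (inP (tmul (Var 0) (Var 1)))))"] that
      by (auto simp: Defs.subfield_axioms_def Let_def Foralls_def in_induced)
    have P3: "rint M P [fint M RNeg [a]]"
      "a \<noteq> fint M RZero [] \<Longrightarrow> \<exists>b\<in>universe M. rint M P [b] \<and> fint M RMul [a, b] = fint M ROne []" if "a \<in> ?K" for a
      using s[of "Foralls [0] (Imp (inP (Var 0)) (inP (tneg (Var 0))))"]
        s[of "Foralls [0] (Imp (inP (Var 0)) (Imp (Neg (Eq (Var 0) tzero)) (Exists 1 (Conj (inP (Var 1)) (Eq (tmul (Var 0) (Var 1)) tone)))))"] that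
      by (auto simp: Defs.subfield_axioms_def Let_def Foralls_def in_induced)
    show "subfield ?K (ring_of M)"
    proof (rule subfieldI')
      show "subring ?K (ring_of M)"
      proof (rule subringI[OF KM])
        show "\<one>\<^bsub>ring_of M\<^esub> \<in> ?K" using P1 one by (simp add: in_induced ring_of_simps)
        show "\<ominus>\<^bsub>ring_of M\<^esub> h \<in> ?K" if "h \<in> ?K" for h
          using P3(1)[OF that] that neg cl1 by (simp add: in_induced)
      qed (use P2 cl in \<open>auto simp: in_induced ring_of_simps\<close>)
      fix k assume k: "k \<in> ?K - {\<zero>\<^bsub>ring_of M\<^esub>}"
      then obtain b where b: "b \<in> universe M" "rint M P [b]" "fint M RMul [k, b] = fint M ROne []"
        using P3(2)[of k] by (auto simp: ring_of_simps)
      have "inv\<^bsub>ring_of M\<^esub> k = b"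
        by (rule comm_inv_char) (use k b KM in \<open>auto simp: ring_of_simps\<close>)
      then show "inv\<^bsub>ring_of M\<^esub> k \<in> ?K" using b by (simp add: in_induced)
    qed
  next
    assume K: "subfield ?K (ring_of M)"
    note Kr = subringE[OF subfieldE(1)[OF K]]
    have c0: "rint M P [fint M RZero []]" "rint M P [fint M ROne []]"
      using Kr(2,3) by (auto simp: in_induced ring_of_simps)
    have c1: "rint M P [fint M RAdd [a, b]]" "rint M P [fint M RMul [a, b]]"
      if "a \<in> universe M" "b \<in> universe M" "rint M P [a]" "rint M P [b]" for a b
      using Kr(6,7)[of a b] that by (auto simp: in_induced ring_of_simps)
    have c2: "rint M P [fint M RNeg [a]]" if "a \<in> universe M" "rint M P [a]" for a
      using Kr(5)[of a] that neg by (auto simp: in_induced)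
    have c3: "\<exists>b\<in>universe M. rint M P [b] \<and> fint M RMul [a, b] = fint M ROne []"
      if "a \<in> universe M" "rint M P [a]" "a \<noteq> fint M RZero []" for a
      using subfield_m_inv[OF K, of a] that by (auto simp: in_induced ring_of_simps)
    show "\<forall>\<phi>\<in>Defs.subfield_axioms. holds M \<phi>"
      by (auto simp: Defs.subfield_axioms_def Let_def Foralls_def holds_def c0 c1 c2 c3)
  qed
qed

lemma fv_Foralls: "fv (Foralls xs \<phi>) = fv \<phi> - set xs"
  unfolding Foralls_def by (induction xs) auto

lemma fv_map2_tmul:
  "(\<Union>u\<in>set (map2 tmul ss ts). fv_tm u) \<subseteq> (\<Union>s\<in>set ss. fv_tm s) \<union> (\<Union>t\<in>set ts. fv_tm t)"
  by (induction ss ts rule: list_induct2') auto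

lemma fv_degree_ge: "fv (degree_ge n) = {}"
proof -
  have "x < 2 * n" if "x \<in> fv_tm (tsum (map2 tmul (map Var [n..<2 * n]) (map Var [0..<n])))" for x
    using that fv_map2_tmul[of "map Var [n..<2 * n]" "map Var [0..<n]"] unfolding fv_tsum by fastforce
  then show ?thesis
    unfolding degree_ge_def Let_def fv_Existss fv_Foralls by (fastforce simp: fv_Conjs)
qed

lemma (in ring) foldr_map2_eq_combine:
  "foldr (\<oplus>) (map2 (\<otimes>) Ks Us) \<zero> = combine Ks Us"
  by (induction Ks Us rule: combine.induct) auto

lemma holds_degree_ge:
  assumes M: "field_struct M" and K: "subfield (universe (induced M)) (ring_of M)"
  shows "holds M (degree_ge n) \<longleftrightarrow>
    (\<exists>Us. length Us = n \<and> ring.independent (ring_of M) (universe (induced M)) Us)"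
proof -
  interpret field "ring_of M" using M unfolding field_struct_def by blast
  let ?K = "universe (induced M)"
  define d where "d = \<zero>\<^bsub>ring_of M\<^esub>"
  have d: "d \<in> universe M" using zero_closed by (simp add: d_def ring_of_simps)
  have dK: "d \<in> ?K" using subringE(2)[OF subfieldE(1)[OF K]] by (simp add: d_def)
  let ?xs = "map Var [0..<n] :: 'b fsym tm list" and ?ys = "map Var [n..<2 * n] :: 'b fsym tm list"
  let ?body = "Imp (Conjs (map inP ?ys)) (Imp (Eq (tsum (map2 tmul ?ys ?xs)) tzero) (Conjs (map (\<lambda>y. Eq y tzero) ?ys)))"
  have ev: "eval_tm M e (tsum (map2 tmul ?ys ?xs)) = combine (map e [n..<2 * n]) (map e [0..<n])" for e
  proof -
    have "map (eval_tm M e) (map2 tmul ?ys ?xs) = map2 (\<otimes>\<^bsub>ring_of M\<^esub>) (map e [n..<2 * n]) (map e [0..<n])"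
      by (rule nth_equalityI) (auto simp: ring_of_simps)
    then show ?thesis unfolding eval_tsum using foldr_map2_eq_combine by metis
  qed
  have body: "sat M e ?body \<longleftrightarrow> ((\<forall>y\<in>{n..<2 * n}. rint M P [e y]) \<longrightarrow>
      combine (map e [n..<2 * n]) (map e [0..<n]) = \<zero>\<^bsub>ring_of M\<^esub> \<longrightarrow> (\<forall>y\<in>{n..<2 * n}. e y = \<zero>\<^bsub>ring_of M\<^esub>))" for e
    unfolding sat.simps ev by (simp add: sat_Conjs ring_of_simps)
  have "fv (degree_ge n :: ('b fsym, 'c psym) fm) = {}" by (rule fv_degree_ge)
  then have "holds M (degree_ge n) \<longleftrightarrow> sat M (\<lambda>_. d) (degree_ge n)" using d by (intro holds_iff_sat) auto
  also have "\<dots> \<longleftrightarrow> (\<exists>e. (\<forall>x. x \<notin> {0..<n} \<longrightarrow> e x = d) \<and> (\<forall>x\<in>{0..<n}. e x \<in> universe M) \<and>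
     (\<forall>e'. (\<forall>x. x \<notin> {n..<2 * n} \<longrightarrow> e' x = e x) \<longrightarrow> (\<forall>x\<in>{n..<2 * n}. e' x \<in> universe M) \<longrightarrow> sat M e' ?body))"
    unfolding degree_ge_def Let_def sat_Existss sat_Foralls by simp
  also have "\<dots> \<longleftrightarrow> (\<exists>Us. length Us = n \<and> independent ?K Us)"
  proof
    assume "\<exists>e. (\<forall>x. x \<notin> {0..<n} \<longrightarrow> e x = d) \<and> (\<forall>x\<in>{0..<n}. e x \<in> universe M) \<and>
     (\<forall>e'. (\<forall>x. x \<notin> {n..<2 * n} \<longrightarrow> e' x = e x) \<longrightarrow> (\<forall>x\<in>{n..<2 * n}. e' x \<in> universe M) \<longrightarrow> sat M e' ?body)"
    then obtain e where e: "\<forall>x\<in>{0..<n}. e x \<in> universe M"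
      "\<And>e'. (\<forall>x. x \<notin> {n..<2 * n} \<longrightarrow> e' x = e x) \<Longrightarrow> (\<forall>x\<in>{n..<2 * n}. e' x \<in> universe M) \<Longrightarrow> sat M e' ?body"
      by blast
    let ?Us = "map e [0..<n]"
    have "independent ?K ?Us"
    proof (rule ccontr)
      assume "\<not> independent ?K ?Us"
      moreover have "set ?Us \<subseteq> carrier (ring_of M)" using e(1) by (auto simp: ring_of_simps)
      ultimately obtain Ks where Ks: "length Ks = length ?Us" "combine Ks ?Us = \<zero>\<^bsub>ring_of M\<^esub>" "set Ks \<subseteq> ?K"
        "set Ks \<noteq> {\<zero>\<^bsub>ring_of M\<^esub>}"
        using dependent_imp_non_trivial_combine[OF K] by metis
      have n0: "n \<noteq> 0" using \<open>\<not> independent ?K ?Us\<close> by (cases n) auto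
      have len: "length Ks = n" using Ks(1) by simp
      \<comment> \<open>A nontrivial relation is written into the variables n to 2n - 1, which stand
        for the coefficients in \<open>degree_ge\<close>.\<close>
      define e' where "e' x = (if x \<in> {n..<2 * n} then Ks ! (x - n) else e x)" for x
      have KsK: "Ks ! i \<in> ?K" if "i < n" for i using that Ks(3) len nth_mem by blast
      have m: "map e' [n..<2 * n] = Ks" "map e' [0..<n] = ?Us"
        using len by (auto simp: e'_def intro!: nth_equalityI)
      have "sat M e' ?body" by (rule e(2)) (use KsK in \<open>auto simp: e'_def in_induced\<close>)
      moreover have "\<forall>y\<in>{n..<2 * n}. rint M P [e' y]" using KsK by (auto simp: e'_def in_induced)
      ultimately have "\<forall>y\<in>{n..<2 * n}. e' y = \<zero>\<^bsub>ring_of M\<^esub>" unfolding body m using Ks(2) by blast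
      then have "set (map e' [n..<2 * n]) \<subseteq> {\<zero>\<^bsub>ring_of M\<^esub>}" by auto
      then have "set Ks \<subseteq> {\<zero>\<^bsub>ring_of M\<^esub>}" unfolding m .
      then show False using Ks(4) len n0 by (cases Ks) auto
    qed
    then show "\<exists>Us. length Us = n \<and> independent ?K Us" by (intro exI[of _ ?Us]) simp
  next
    assume "\<exists>Us. length Us = n \<and> independent ?K Us"
    then obtain Us where Us: "length Us = n" "independent ?K Us" by blast
    have UsM: "set Us \<subseteq> universe M" using independent_in_carrier[OF Us(2)] by (simp add: ring_of_simps)
    let ?e = "assign d Us"
    have "sat M e' ?body" if e': "\<forall>x. x \<notin> {n..<2 * n} \<longrightarrow> e' x = ?e x" "\<forall>x\<in>{n..<2 * n}. e' x \<in> universe M" for e'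
      unfolding body
    proof (intro impI)
      assume P: "\<forall>y\<in>{n..<2 * n}. rint M P [e' y]"
        and c: "combine (map e' [n..<2 * n]) (map e' [0..<n]) = \<zero>\<^bsub>ring_of M\<^esub>"
      have m: "map e' [0..<n] = Us" using e'(1) Us(1) by (auto simp: assign_def intro!: nth_equalityI)
      have "set (map e' [n..<2 * n]) \<subseteq> ?K" using P e'(2) by (auto simp: in_induced)
      from independent_imp_trivial_combine[OF K Us(2) this] c
      have "set (take (length Us) (map e' [n..<2 * n])) \<subseteq> {\<zero>\<^bsub>ring_of M\<^esub>}" unfolding m by blast
      then have "set (map e' [n..<2 * n]) \<subseteq> {\<zero>\<^bsub>ring_of M\<^esub>}" using Us(1) by simp
      then show "\<forall>y\<in>{n..<2 * n}. e' y = \<zero>\<^bsub>ring_of M\<^esub>" by auto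
    qed
    then show "\<exists>e. (\<forall>x. x \<notin> {0..<n} \<longrightarrow> e x = d) \<and> (\<forall>x\<in>{0..<n}. e x \<in> universe M) \<and>
     (\<forall>e'. (\<forall>x. x \<notin> {n..<2 * n} \<longrightarrow> e' x = e x) \<longrightarrow> (\<forall>x\<in>{n..<2 * n}. e' x \<in> universe M) \<longrightarrow> sat M e' ?body)"
      using Us(1) UsM nth_mem[of _ Us] by (intro exI[of _ ?e]) (auto simp: assign_def)
  qed
  finally show ?thesis .
qed

text \<open>In infinite dimension an independent list never spans, so it can always be lengthened by
  a vector outside its span. Conversely, a finite dimension bounds the length of independent
  lists.\<close>

lemma infinite_dimension_iff:
  assumes M: "field_struct M" and K: "subfield (universe (induced M)) (ring_of M)"
  shows "(\<forall>n. holds M (degree_ge n)) \<longleftrightarrow>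
    ring.infinite_dimension (ring_of M) (universe (induced M)) (universe M)"
proof -
  interpret field "ring_of M" using M unfolding field_struct_def by blast
  let ?K = "universe (induced M)"
  have "(\<forall>n. \<exists>Us. length Us = n \<and> independent ?K Us) \<longleftrightarrow> infinite_dimension ?K (carrier (ring_of M))"
  proof
    assume h: "\<forall>n. \<exists>Us. length Us = n \<and> independent ?K Us"
    show "infinite_dimension ?K (carrier (ring_of M))"
    proof
      assume "finite_dimension ?K (carrier (ring_of M))"
      then obtain m where m: "dimension m ?K (carrier (ring_of M))" by blast
      obtain Us where Us: "length Us = Suc m" "independent ?K Us" using h by blast
      then show False
        using independent_length_le_dimension[OF K m Us(2) independent_in_carrier[OF Us(2)]] by simp
    qed
  next
    assume inf: "infinite_dimension ?K (carrier (ring_of M))"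
    show "\<forall>n. \<exists>Us. length Us = n \<and> independent ?K Us"
    proof
      fix n show "\<exists>Us. length Us = n \<and> independent ?K Us"
      proof (induction n)
        case (Suc n)
        then obtain Us where Us: "length Us = n" "independent ?K Us" by blast
        have "Span ?K Us \<noteq> carrier (ring_of M)"
          using inf finite_dimensionI[OF dimension_independent[OF Us(2)]] by auto
        moreover have "Span ?K Us \<subseteq> carrier (ring_of M)"
          by (rule Span_in_carrier[OF subringE(1)[OF subfieldE(1)[OF K]] independent_in_carrier[OF Us(2)]])
        ultimately obtain u where "u \<in> carrier (ring_of M)" "u \<notin> Span ?K Us" by blast
        then have "independent ?K (u # Us)" using li_Cons Us(2) by blast
        then show ?case using Us(1) by (intro exI[of _ "u # Us"]) simp
      qed auto
    qed
  qed
  then show ?thesis unfolding holds_degree_ge[OF M K] by (simp add: ring_of_simps(1))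
qed

lemma map_assign: "length as = n \<Longrightarrow> map (assign d as) [0..<n] = as"
  by (auto simp: assign_def intro: nth_equalityI)

lemma sat_all_inP:
  assumes "length as = n" "set as \<subseteq> universe M"
  shows "sat M (assign d as) (Conjs (map inP (map Var [0..<n]))) \<longleftrightarrow> set as \<subseteq> universe (induced M)"
proof -
  have "sat M (assign d as) (Conjs (map inP (map Var [0..<n]))) \<longleftrightarrow> (\<forall>a\<in>set (map (assign d as) [0..<n]). rint M P [a])"
    by (simp add: sat_Conjs)
  then show ?thesis unfolding map_assign[OF assms(1)] using assms(2) by (auto simp: in_induced)
qed

lemma holds_function_axioms:
  fixes M :: "('u, 'f fsym, 'r psym) struct" and L :: "('f fsym, 'r) lang"
  assumes M: "is_structure (lang_P L) M"
  shows "(\<forall>\<phi>\<in>function_axioms L. holds M \<phi>) \<longleftrightarrow>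
    (\<forall>f n as. funs L f = Some n \<longrightarrow> f \<notin> dom (funs (L_rings :: ('f fsym, 'r) lang)) \<longrightarrow> length as = n \<longrightarrow>
      set as \<subseteq> universe M \<longrightarrow> (if set as \<subseteq> universe (induced M) then fint M f as \<in> universe (induced M)
        else fint M f as = fint M RZero []))"
proof -
  obtain d where d: "d \<in> universe M" using M unfolding is_structure_def by blast
  have fvs: "fv (Conjs (map inP (map Var [0..<n]))) \<subseteq> {..<n}" for n by (auto simp: fv_Conjs)
  have *: "holds M (Foralls [0..<n] (Imp (Conjs (map inP (map Var [0..<n]))) (inP (App f (map Var [0..<n]))))) \<and>
      holds M (Foralls [0..<n] (Imp (Neg (Conjs (map inP (map Var [0..<n])))) (Eq (App f (map Var [0..<n])) tzero)))
    \<longleftrightarrow> (\<forall>as. length as = n \<longrightarrow> set as \<subseteq> universe M \<longrightarrow> (if set as \<subseteq> universe (induced M)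
        then fint M f as \<in> universe (induced M) else fint M f as = fint M RZero []))" (is "?a \<and> ?b \<longleftrightarrow> ?c")
    if f: "funs L f = Some n" for f n
  proof -
    have ev: "eval_tm M (assign d as) (App f (map Var [0..<n])) = fint M f as" if "length as = n" for as
      using map_assign[OF that] by (simp add: comp_def)
    have cl: "fint M f as \<in> universe M" if "length as = n" "set as \<subseteq> universe M" for as
      using M f that unfolding is_structure_def lang_P_def by simp
    have "?a \<longleftrightarrow> (\<forall>as. length as = n \<longrightarrow> set as \<subseteq> universe M \<longrightarrow> set as \<subseteq> universe (induced M) \<longrightarrow>
        fint M f as \<in> universe (induced M))"
      by (subst holds_Foralls_upt[OF d])
        (use fvs in \<open>auto simp: sat_all_inP[unfolded map_map] ev cl in_induced simp del: eval_tm.simps(2)\<close>)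
    moreover have "?b \<longleftrightarrow> (\<forall>as. length as = n \<longrightarrow> set as \<subseteq> universe M \<longrightarrow> \<not> set as \<subseteq> universe (induced M) \<longrightarrow>
        fint M f as = fint M RZero [])"
    proof -
      have "eval_tm M e tzero = fint M RZero []" for e by simp
      then show ?thesis
        by (subst holds_Foralls_upt[OF d])
          (use fvs in \<open>auto simp: sat_all_inP[unfolded map_map] ev simp del: eval_tm.simps(2)\<close>)
    qed
    ultimately show ?thesis by auto
  qed
  have "(\<forall>\<phi>\<in>function_axioms L. holds M \<phi>) \<longleftrightarrow> (\<forall>f n. funs L f = Some n \<longrightarrow>
     f \<notin> dom (funs (L_rings :: ('f fsym, 'r) lang)) \<longrightarrow>
      holds M (Foralls [0..<n] (Imp (Conjs (map inP (map Var [0..<n]))) (inP (App f (map Var [0..<n]))))) \<and>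
      holds M (Foralls [0..<n] (Imp (Neg (Conjs (map inP (map Var [0..<n])))) (Eq (App f (map Var [0..<n])) tzero))))"
    unfolding function_axioms_def Let_def by auto
  also have "\<dots> \<longleftrightarrow> (\<forall>f n. funs L f = Some n \<longrightarrow> f \<notin> dom (funs (L_rings :: ('f fsym, 'r) lang)) \<longrightarrow>
    (\<forall>as. length as = n \<longrightarrow> set as \<subseteq> universe M \<longrightarrow> (if set as \<subseteq> universe (induced M)
        then fint M f as \<in> universe (induced M) else fint M f as = fint M RZero [])))"
    by (intro all_cong1 imp_cong refl *)
  finally show ?thesis by blast
qed

lemma holds_relation_axioms:
  assumes M: "is_structure (lang_P L) M"
  shows "(\<forall>\<phi>\<in>relation_axioms L. holds M \<phi>) \<longleftrightarrow>
    (\<forall>r n as. rels L r = Some n \<longrightarrow> length as = n \<longrightarrow> set as \<subseteq> universe M \<longrightarrow>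
      rint M (Base r) as \<longrightarrow> set as \<subseteq> universe (induced M))"
proof -
  obtain d where d: "d \<in> universe M" using M unfolding is_structure_def by blast
  have fvs: "fv (Conjs (map inP (map Var [0..<n]))) \<subseteq> {..<n}" for n by (auto simp: fv_Conjs)
  have *: "holds M (Foralls [0..<n] (Imp (Neg (Conjs (map inP (map Var [0..<n])))) (Neg (Rel (Base r) (map Var [0..<n])))))
    \<longleftrightarrow> (\<forall>as. length as = n \<longrightarrow> set as \<subseteq> universe M \<longrightarrow>
      rint M (Base r) as \<longrightarrow> set as \<subseteq> universe (induced M))" for r n
  proof -
    have ev: "sat M (assign d as) (Rel (Base r) (map Var [0..<n])) \<longleftrightarrow> rint M (Base r) as" if "length as = n" for as
      using map_assign[OF that] by (simp add: comp_def)
    show ?thesis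
      by (subst holds_Foralls_upt[OF d])
        (use fvs in \<open>auto simp: sat_all_inP[unfolded map_map] ev simp del: sat.simps(3)\<close>)
  qed
  have "(\<forall>\<phi>\<in>relation_axioms L. holds M \<phi>) \<longleftrightarrow> (\<forall>r n. rels L r = Some n \<longrightarrow>
      holds M (Foralls [0..<n] (Imp (Neg (Conjs (map inP (map Var [0..<n])))) (Neg (Rel (Base r) (map Var [0..<n]))))))"
    unfolding relation_axioms_def Let_def by blast
  then show ?thesis unfolding * by blast
qed

lemma sublang_L_rings_lang_P: "sublang L_rings L \<Longrightarrow> sublang L_rings (lang_P L)"
  by (simp add: sublang_def lang_P_def L_rings_def)

section \<open>Models of the axioms other than T and the degree\<close>

text \<open>Separated from \<open>ACF_T\<close> because \<open>T\<close> will enter only through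
  equivalence of the predicates, and infinite degree only through transcendental elements. What is
  left passes to sublanguages and to elementary submodels.\<close>

definition pair_model :: "('f fsym, 'r) lang \<Rightarrow> ('u, 'f fsym, 'r psym) struct \<Rightarrow> bool" where
  "pair_model L M \<longleftrightarrow> is_structure (lang_P L) M \<and> field_struct M \<and> algebraically_closed (ring_of M) \<and>
    subfield (universe (induced M)) (ring_of M) \<and>
    (\<forall>f n as. funs L f = Some n \<longrightarrow> f \<notin> dom (funs (L_rings :: ('f fsym, 'r) lang)) \<longrightarrow> length as = n \<longrightarrow>
      set as \<subseteq> universe M \<longrightarrow> (if set as \<subseteq> universe (induced M) then fint M f as \<in> universe (induced M)
        else fint M f as = fint M RZero [])) \<and>
    (\<forall>r n as. rels L r = Some n \<longrightarrow> length as = n \<longrightarrow> set as \<subseteq> universe M \<longrightarrow>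
      rint M (Base r) as \<longrightarrow> set as \<subseteq> universe (induced M))"

definition pair_axioms :: "('f fsym, 'r) lang \<Rightarrow> ('f fsym, 'r psym) fm set" where
  "pair_axioms L = ACF \<union> Defs.subfield_axioms \<union> function_axioms L \<union> relation_axioms L"

lemma pair_model_iff:
  assumes M: "is_structure (lang_P L) M" and L: "sublang L_rings L"
  shows "(\<forall>\<phi>\<in>pair_axioms L. holds M \<phi>) \<longleftrightarrow> pair_model L M \<and> (\<forall>\<phi>\<in>Defs.field_axioms. holds M \<phi>)"
proof (cases "\<forall>\<phi>\<in>Defs.field_axioms. holds M \<phi>")
  case True
  have F: "field_struct M"
    using field_struct_if_field_axioms[OF M sublang_L_rings_lang_P[OF L]] True by blast
  have "(\<forall>\<phi>\<in>ACF. holds M \<phi>) \<longleftrightarrow> algebraically_closed (ring_of M)"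
    unfolding algebraically_closed_iff[OF F] ACF_def using True by auto
  then show ?thesis
    unfolding pair_axioms_def ball_Un holds_function_axioms[OF M] holds_relation_axioms[OF M]
      subfield_induced_iff[OF F] pair_model_def
    using M F True by blast
qed (auto simp: pair_axioms_def ACF_def)

lemma fv_monic_root: "fv (monic_root n) = {}"
  unfolding monic_root_def fv_Foralls using fv_tpow[of "Var n"] by (fastforce simp: fv_tsum)

lemma wf_Foralls: "wf_fm L (Foralls xs \<phi>) \<longleftrightarrow> wf_fm L \<phi>"
  unfolding Foralls_def by (induction xs) auto

lemma funs_L_rings:
  assumes "sublang L_rings L"
  shows "funs L RZero = Some 0" "funs L ROne = Some 0" "funs L RNeg = Some (Suc 0)"
    "funs L RAdd = Some (Suc (Suc 0))" "funs L RMul = Some (Suc (Suc 0))"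
  using assms unfolding sublang_def map_le_def L_rings_def
  by (auto simp: numeral_2_eq_2 split: if_splits dest!: sym[of "Some _"])

lemma wf_tpow: "sublang L_rings L \<Longrightarrow> wf_tm L t \<Longrightarrow> wf_tm L (tpow t n)"
  by (induction n) (auto simp: funs_L_rings)

lemma wf_tsum: "sublang L_rings L \<Longrightarrow> (\<And>t. t \<in> set ts \<Longrightarrow> wf_tm L t) \<Longrightarrow> wf_tm L (tsum ts)"
  unfolding tsum_def by (induction ts) (auto simp: funs_L_rings)

lemma field_axioms_sentences: "sublang L_rings L \<Longrightarrow> Defs.field_axioms \<subseteq> sentences L"
  by (auto simp: Defs.field_axioms_def sentences_def Let_def Foralls_def funs_L_rings)

lemma monic_root_sentence: "sublang L_rings L \<Longrightarrow> monic_root n \<in> sentences L"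
  unfolding sentences_def
  by (auto simp: fv_monic_root) (auto simp: monic_root_def wf_Foralls funs_L_rings intro!: wf_tpow wf_tsum)

lemma ACF_sentences: "sublang L_rings L \<Longrightarrow> ACF \<subseteq> sentences L"
  using field_axioms_sentences monic_root_sentence unfolding ACF_def by blast

lemma subfield_axioms_sentences: "sublang L_rings L \<Longrightarrow> Defs.subfield_axioms \<subseteq> sentences (lang_P L)"
  by (auto simp: Defs.subfield_axioms_def sentences_def Let_def Foralls_def lang_P_def funs_L_rings)

lemma function_axioms_sentences: "sublang L_rings L \<Longrightarrow> function_axioms L \<subseteq> sentences (lang_P L)"
  by (auto simp: function_axioms_def sentences_def Let_def fv_Foralls fv_Conjs wf_Foralls lang_P_def funs_L_rings
      list_all_iff intro!: wf_Conjs)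

lemma relation_axioms_sentences: "relation_axioms L \<subseteq> sentences (lang_P L)"
  by (auto simp: relation_axioms_def sentences_def Let_def fv_Foralls fv_Conjs wf_Foralls lang_P_def
      list_all_iff intro!: wf_Conjs)

lemma pair_axioms_sentences: "sublang L_rings L \<Longrightarrow> pair_axioms L \<subseteq> sentences (lang_P L)"
  unfolding pair_axioms_def
  using ACF_sentences[OF sublang_L_rings_lang_P] subfield_axioms_sentences function_axioms_sentences
    relation_axioms_sentences by blast

section \<open>Transcendental elements and back-and-forth\<close>

text \<open>The subring generated by \<open>S\<close>; zero arises as 1 + (-1). Only the operations
  are used, so passing to a smaller universe leaves it unchanged.\<close>

inductive_set generated :: "('u, 'f fsym, 'r) struct \<Rightarrow> 'u set \<Rightarrow> 'u set" for M S where
  base: "a \<in> S \<Longrightarrow> a \<in> generated M S"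
| one: "fint M ROne [] \<in> generated M S"
| neg: "a \<in> generated M S \<Longrightarrow> fint M RNeg [a] \<in> generated M S"
| add: "a \<in> generated M S \<Longrightarrow> b \<in> generated M S \<Longrightarrow> fint M RAdd [a, b] \<in> generated M S"
| mul: "a \<in> generated M S \<Longrightarrow> b \<in> generated M S \<Longrightarrow> fint M RMul [a, b] \<in> generated M S"

lemma generated_closed:
  assumes "is_structure L M" "sublang L_rings L" "S \<subseteq> universe M"
  shows "generated M S \<subseteq> universe M"
proof
  fix a assume "a \<in> generated M S"
  then show "a \<in> universe M"
    by (induction rule: generated.induct) (use assms(3) ring_closed[OF assms(1,2)] in auto)
qed

lemma generated_mono: "S \<subseteq> S' \<Longrightarrow> generated M S \<subseteq> generated M S'"
proof
  fix a assume "S \<subseteq> S'" "a \<in> generated M S"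
  from this(2,1) show "a \<in> generated M S'"
    by (induction rule: generated.induct) (auto intro: generated.intros)
qed

lemma generated_universe_update: "generated (M\<lparr>universe := A\<rparr>) S = generated M S"
proof
  show "generated (M\<lparr>universe := A\<rparr>) S \<subseteq> generated M S"
  proof
    fix a assume "a \<in> generated (M\<lparr>universe := A\<rparr>) S"
    then show "a \<in> generated M S"
      by (induction rule: generated.induct) (auto intro: generated.intros)
  qed
  show "generated M S \<subseteq> generated (M\<lparr>universe := A\<rparr>) S"
  proof
    fix a assume "a \<in> generated M S"
    then show "a \<in> generated (M\<lparr>universe := A\<rparr>) S"
    proof (induction rule: generated.induct)
      case (base a) then show ?case by (rule generated.base)
    next
      case one show ?case using generated.one[of "M\<lparr>universe := A\<rparr>" S] by simp
    next
      case (neg a) then show ?case using generated.neg[of a "M\<lparr>universe := A\<rparr>" S] by simp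
    next
      case (add a b) then show ?case using generated.add[of a "M\<lparr>universe := A\<rparr>" S b] by simp
    next
      case (mul a b) then show ?case using generated.mul[of a "M\<lparr>universe := A\<rparr>" S b] by simp
    qed
  qed
qed

lemma subring_generated:
  assumes "field_struct M" "S \<subseteq> universe M" "is_structure L M" "sublang L_rings L"
  shows "subring (generated M S) (ring_of M)"
proof -
  interpret field "ring_of M" using assms(1) unfolding field_struct_def by blast
  have sub: "generated M S \<subseteq> carrier (ring_of M)"
    using generated_closed[OF assms(3,4,2)] by (simp add: ring_of_simps)
  have "\<ominus>\<^bsub>ring_of M\<^esub> h \<in> generated M S" if "h \<in> generated M S" for h
    using generated.neg[OF that] assms(1) that sub unfolding field_struct_def by (auto simp: ring_of_simps)
  then show ?thesis
    by (intro subringI[OF sub]) (auto simp: ring_of_simps intro: generated.intros)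
qed

text \<open>Coefficients from the generated ring suffice, since denominators can be cleared. They
  form a list that may start with zeros, as in \<open>alg_le\<close>.\<close>

definition transcendental_over :: "('u, 'f fsym, 'r psym) struct \<Rightarrow> 'u list \<Rightarrow> 'u \<Rightarrow> bool" where
  "transcendental_over M l b \<longleftrightarrow> (\<forall>cs. set cs \<subseteq> generated M (universe (induced M) \<union> set l) \<longrightarrow>
    ring.eval (ring_of M) cs b = fint M RZero [] \<longrightarrow> set cs \<subseteq> {fint M RZero []})"

context ultrafilter
begin

lemma eventually_fint: "eventually (\<lambda>i. fint (ultrapower M) f as i = fint M f (map (\<lambda>a. a i) as)) U"
  unfolding ultrapower_def using germ by simp

lemma eventually_eval:
  fixes M :: "('u, 'f fsym, 'r) struct"
  assumes "ring (ring_of M)" "ring (ring_of (ultrapower M))"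
  shows "eventually (\<lambda>i. ring.eval (ring_of (ultrapower M)) cs b i
    = ring.eval (ring_of M) (map (\<lambda>c. c i) cs) (b i)) U"
proof -
  interpret R: ring "ring_of M" by fact
  interpret S: ring "ring_of (ultrapower M)" by fact
  let ?R = "ring_of M" and ?S = "ring_of (ultrapower M)"
  have pow: "eventually (\<lambda>i. (b [^]\<^bsub>?S\<^esub> n) i = b i [^]\<^bsub>?R\<^esub> n) U" for n :: nat
  proof (induction n)
    case 0
    show ?case using eventually_fint[of M ROne "[]"] by (simp add: ring_of_simps)
  next
    case (Suc n)
    show ?case using Suc eventually_fint[of M RMul "[b [^]\<^bsub>?S\<^esub> n, b]"]
      by eventually_elim (simp add: ring_of_simps)
  qed
  show ?thesis
  proof (induction cs)
    case Nil
    show ?case using eventually_fint[of M RZero "[]"] by (simp add: ring_of_simps)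
  next
    case (Cons c cs)
    let ?n = "length cs"
    from Cons.IH pow[of ?n] eventually_fint[of M RMul "[c, b [^]\<^bsub>?S\<^esub> ?n]"]
      eventually_fint[of M RAdd "[c \<otimes>\<^bsub>?S\<^esub> b [^]\<^bsub>?S\<^esub> ?n, S.eval cs b]"]
    show ?case by eventually_elim (simp add: ring_of_simps)
  qed
qed

text \<open>At index i choose \<open>b i\<close> outside the roots of all nonzero relations of
  length at most i over the extension generated by the i-th coordinates of \<open>l\<close>. A
  relation of fixed length in the ultrapower is of this kind at almost all indices, so each of its
  coefficients vanishes almost everywhere.\<close>

theorem exists_transcendental_ultrapower:
  fixes M :: "('u, 'f fsym, 'r psym) struct"
  assumes M: "pair_model L M" and L: "sublang L_rings L"
    and inf: "ring.infinite_dimension (ring_of M) (universe (induced M)) (universe M)"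
    and M': "pair_model L (ultrapower M)"
    and l: "set l \<subseteq> universe (ultrapower M)"
  shows "\<exists>b\<in>universe (ultrapower M). transcendental_over (ultrapower M) l b"
proof -
  interpret R: algebraically_closed "ring_of M" using M unfolding pair_model_def by blast
  interpret S: algebraically_closed "ring_of (ultrapower M)" using M' unfolding pair_model_def by blast
  let ?K = "universe (induced M)" and ?N = "ultrapower M"
  have K: "subfield ?K (ring_of M)" using M unfolding pair_model_def by blast
  note Kr = subfieldE(1)[OF K]
  have struct: "is_structure (lang_P L) M" "is_structure (lang_P L) ?N"
    using M M' unfolding pair_model_def by blast+
  have neg: "fint M RNeg [a] = \<ominus>\<^bsub>ring_of M\<^esub> a" if "a \<in> universe M" for a
    using M that unfolding pair_model_def field_struct_def by blast
  have "\<exists>g. \<forall>a\<in>set l. range (g a) \<subseteq> universe M \<and> a = germ (g a)"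
    using l by (intro bchoice) (metis in_ultrapowerE subsetD)
  then obtain g where g: "\<And>a. a \<in> set l \<Longrightarrow> range (g a) \<subseteq> universe M" "\<And>a. a \<in> set l \<Longrightarrow> a = germ (g a)" by blast
  define xs where "xs i = map (\<lambda>a. g a i) l" for i
  have xs: "set (xs i) \<subseteq> carrier (ring_of M)" for i using g(1) by (auto simp: xs_def ring_of_simps)
  let ?E = "\<lambda>i. R.finite_extension ?K (xs i)"
  have "\<exists>b. b \<in> carrier (ring_of M) \<and> \<not> R.alg_le (?E i) i b" for i
    using R.exists_large_degree[OF K _ xs[of i], of i] inf by (auto simp: ring_of_simps(1))
  then obtain b where b: "\<And>i. b i \<in> carrier (ring_of M)" "\<And>i. \<not> R.alg_le (?E i) i (b i)" by metis
  have bN: "germ b \<in> universe ?N" using b(1) by (intro germ_in_ultrapower) (simp add: ring_of_simps(1))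
  have E: "subring (?E i) (ring_of M)" for i using R.finite_extension_is_subring[OF Kr xs] .
  \<comment> \<open>The exceptional indices depend on \<open>c\<close>, which is harmless because a
    relation has only finitely many coefficients.\<close>
  have gen: "eventually (\<lambda>i. c i \<in> ?E i) U" if "c \<in> generated ?N (universe (induced ?N) \<union> set l)" for c
    using that
  proof (induction rule: generated.induct)
    case (base c)
    then show ?case
    proof
      assume "c \<in> universe (induced ?N)"
      then have c: "c \<in> universe ?N" "eventually (\<lambda>i. rint M P [c i]) U"
        by (auto simp: in_induced ultrapower_def)
      obtain f where f: "range f \<subseteq> universe M" "c = germ f" using in_ultrapowerE[OF c(1)] by blast
      from c(2) germ[of f] show ?case unfolding f(2)
      proof eventually_elim
        case (elim i)
        then have "germ f i \<in> ?K" using f(1) by (auto simp: in_induced)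
        then show ?case using R.finite_extension_incl[OF subringE(1)[OF Kr] xs[of i]] by blast
      qed
    next
      assume c: "c \<in> set l"
      from germ[of "g c"] have "eventually (\<lambda>i. germ (g c) i \<in> ?E i) U"
      proof eventually_elim
        case (elim i)
        have "g c i \<in> set (xs i)" using c by (simp add: xs_def)
        then show ?case using R.finite_extension_mem[OF Kr xs[of i]] elim by auto
      qed
      then show ?case using g(2)[OF c] by simp
    qed
  next
    case one
    from eventually_fint[of M ROne "[]"] show ?case
      by eventually_elim (use subringE(3)[OF E] in \<open>simp add: ring_of_simps\<close>)
  next
    case (neg a)
    from neg.IH eventually_fint[of M RNeg "[a]"] show ?case
    proof eventually_elim
      case (elim i)
      then have "a i \<in> universe M" using subringE(1)[OF E[of i]] by (auto simp: ring_of_simps)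
      then show ?case using elim subringE(5)[OF E[of i]] \<open>\<And>a. a \<in> universe M \<Longrightarrow> fint M RNeg [a] = _\<close> by simp
    qed
  next
    case (add a b)
    from add.IH eventually_fint[of M RAdd "[a, b]"] show ?case
      by eventually_elim (use subringE(7)[OF E] in \<open>simp add: ring_of_simps\<close>)
  next
    case (mul a b)
    from mul.IH eventually_fint[of M RMul "[a, b]"] show ?case
      by eventually_elim (use subringE(6)[OF E] in \<open>simp add: ring_of_simps\<close>)
  qed
  have genN: "generated ?N (universe (induced ?N) \<union> set l) \<subseteq> universe ?N"
    by (rule generated_closed[OF struct(2) sublang_L_rings_lang_P[OF L]]) (use l in \<open>auto simp: in_induced\<close>)
  have "transcendental_over ?N l (germ b)"
    unfolding transcendental_over_def
  proof (intro allI impI)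
    fix cs assume cs: "set cs \<subseteq> generated ?N (universe (induced ?N) \<union> set l)"
      "S.eval cs (germ b) = fint ?N RZero []"
    have 1: "eventually (\<lambda>i. \<forall>c\<in>set cs. c i \<in> ?E i) U"
      by (intro eventually_ball_finite) (use cs(1) gen in auto)
    have "eventually (\<lambda>i. set (map (\<lambda>c. c i) cs) \<subseteq> {fint M RZero []}) U"
      using 1 eventually_ge[of "length cs"] eventually_eval[OF R.ring_axioms S.ring_axioms, of cs "germ b"]
        eventually_fint[of M RZero "[]"] germ[of b]
    proof eventually_elim
      case (elim i)
      have "R.eval (map (\<lambda>c. c i) cs) (b i) = \<zero>\<^bsub>ring_of M\<^esub>"
        using elim cs(2) by (simp add: ring_of_simps)
      moreover have "set (map (\<lambda>c. c i) cs) \<subseteq> ?E i" using elim(1) by auto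
      moreover have "length (map (\<lambda>c. c i) cs) \<le> i" using elim(2) by simp
      ultimately have "set (map (\<lambda>c. c i) cs) \<subseteq> {\<zero>\<^bsub>ring_of M\<^esub>}"
        using b(2)[of i] unfolding R.alg_le_def by blast
      then show ?case by (simp add: ring_of_simps)
    qed
    then have z: "eventually (\<lambda>i. c i = fint M RZero []) U" if "c \<in> set cs" for c
      by eventually_elim (use that in auto)
    show "set cs \<subseteq> {fint ?N RZero []}"
    proof
      fix c assume c: "c \<in> set cs"
      then have "c \<in> universe ?N" using cs(1) genN by blast
      then obtain f where f: "c = germ f" using in_ultrapowerE by blast
      have "germ f = germ (\<lambda>i. fint M RZero [])" unfolding germ_eq_iff
        using z[OF c] germ[of f] unfolding f by eventually_elim simp
      then show "c \<in> {fint ?N RZero []}" unfolding f by (simp add: ultrapower_def)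
    qed
  qed
  then show ?thesis using bN by blast
qed

end

section \<open>The back-and-forth system\<close>

lemma pair_model_fint:
  fixes L :: "('f fsym, 'r) lang"
  assumes "pair_model L M" "funs L f = Some (length as)" "f \<notin> dom (funs (L_rings :: ('f fsym, 'r) lang))"
    "set as \<subseteq> universe M"
  shows "if set as \<subseteq> universe (induced M) then fint M f as \<in> universe (induced M)
    else fint M f as = fint M RZero []"
  using assms unfolding pair_model_def by simp

lemma pair_model_rint:
  assumes "pair_model L M" "rels L r = Some (length as)" "set as \<subseteq> universe M" "rint M (Base r) as"
  shows "set as \<subseteq> universe (induced M)"
  using assms unfolding pair_model_def by simp

text \<open>Finitely generated over the predicate: exactly the sets over which transcendental
  elements are available.\<close>

definition small :: "('u, 'f fsym, 'r psym) struct \<Rightarrow> 'u set \<Rightarrow> bool" where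
  "small M A \<longleftrightarrow> (\<exists>l. set l \<subseteq> universe M \<and> A \<subseteq> generated M (universe (induced M) \<union> set l))"

definition pair_system ::
  "('u, 'f fsym, 'r psym) struct \<Rightarrow> ('v, 'f fsym, 'r psym) struct \<Rightarrow> ('u \<times> 'v) set \<Rightarrow> ('u \<times> 'v) set set" where
  "pair_system M N \<sigma> =
    {\<rho>. partial_iso (ring_of M) (ring_of N) \<rho> \<and> \<sigma> \<subseteq> \<rho> \<and> small M (Domain \<rho>) \<and> small N (Range \<rho>)}"

lemma pair_system_converse: "\<rho> \<in> pair_system M N \<sigma> \<Longrightarrow> \<rho>\<inverse> \<in> pair_system N M (\<sigma>\<inverse>)"
  unfolding pair_system_def by (auto intro: partial_iso_converse)

text \<open>Smallness of the range of \<rho> provides the transcendental element that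
  \<open>exists_extension\<close> may call for. Its bounds on the new relation then show that both
  sides stay small, with one more generator each.\<close>

lemma pair_system_forth:
  assumes M: "pair_model L M" and N: "pair_model L N" and L: "sublang L_rings L"
    and Tr: "\<And>l. set l \<subseteq> universe N \<Longrightarrow> \<exists>b\<in>universe N. transcendental_over N l b"
    and mem: "\<rho> \<in> pair_system M N \<sigma>" and a: "a \<in> universe M"
  shows "\<exists>b\<in>universe N. \<exists>\<rho>'\<in>pair_system M N \<sigma>. \<rho> \<subseteq> \<rho>' \<and> (a, b) \<in> \<rho>'"
proof -
  interpret R: algebraically_closed "ring_of M" using M unfolding pair_model_def by blast
  interpret S: algebraically_closed "ring_of N" using N unfolding pair_model_def by blast
  interpret partial_iso_extension "ring_of M" "ring_of N" \<rho> a
    by unfold_locales (use mem a in \<open>auto simp: pair_system_def ring_of_simps(1)\<close>)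
  obtain l l' where l: "set l \<subseteq> universe M" "Domain \<rho> \<subseteq> generated M (universe (induced M) \<union> set l)"
    and l': "set l' \<subseteq> universe N" "Range \<rho> \<subseteq> generated N (universe (induced N) \<union> set l')"
    using mem unfolding pair_system_def small_def by blast
  obtain t where t: "t \<in> universe N" "transcendental_over N l' t" using Tr[OF l'(1)] by blast
  have "\<exists>b\<in>carrier (ring_of N). \<forall>cs. set cs \<subseteq> Range \<rho> \<longrightarrow> S.eval cs b = \<zero>\<^bsub>ring_of N\<^esub> \<longrightarrow> set cs \<subseteq> {\<zero>\<^bsub>ring_of N\<^esub>}"
    using t l'(2) unfolding transcendental_over_def ring_of_simps by (meson subset_trans)
  from exists_extension[OF S.algebraically_closed_axioms this]
  obtain b \<rho>' where b: "b \<in> universe N" and \<rho>': "partial_iso (ring_of M) (ring_of N) \<rho>'" "\<rho> \<subseteq> \<rho>'" "(a, b) \<in> \<rho>'"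
    "\<And>H. subring H (ring_of M) \<Longrightarrow> Domain \<rho> \<subseteq> H \<Longrightarrow> a \<in> H \<Longrightarrow> Domain \<rho>' \<subseteq> H"
    "\<And>H. subring H (ring_of N) \<Longrightarrow> Range \<rho> \<subseteq> H \<Longrightarrow> b \<in> H \<Longrightarrow> Range \<rho>' \<subseteq> H"
    unfolding ring_of_simps(1) by blast
  have "Domain \<rho>' \<subseteq> generated M (universe (induced M) \<union> set (a # l))"
  proof (rule \<rho>'(4))
    show "subring (generated M (universe (induced M) \<union> set (a # l))) (ring_of M)"
      using M l(1) a by (intro subring_generated[OF _ _ _ sublang_L_rings_lang_P[OF L]])
        (auto simp: pair_model_def in_induced)
    show "Domain \<rho> \<subseteq> generated M (universe (induced M) \<union> set (a # l))"
      using l(2) generated_mono[of "universe (induced M) \<union> set l" "universe (induced M) \<union> set (a # l)" M] by auto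
  qed (auto intro: generated.base)
  moreover have "Range \<rho>' \<subseteq> generated N (universe (induced N) \<union> set (b # l'))"
  proof (rule \<rho>'(5))
    show "subring (generated N (universe (induced N) \<union> set (b # l'))) (ring_of N)"
      using N l'(1) b by (intro subring_generated[OF _ _ _ sublang_L_rings_lang_P[OF L]])
        (auto simp: pair_model_def in_induced)
    show "Range \<rho> \<subseteq> generated N (universe (induced N) \<union> set (b # l'))"
      using l'(2) generated_mono[of "universe (induced N) \<union> set l'" "universe (induced N) \<union> set (b # l')" N] by auto
  qed (auto intro: generated.base)
  ultimately have "small M (Domain \<rho>')" "small N (Range \<rho>')"
    unfolding small_def using a b l(1) l'(1) by (intro exI[of _ "a # l"] exI[of _ "b # l'"]; simp)+
  then have "\<rho>' \<in> pair_system M N \<sigma>" using mem \<rho>'(1,2) unfolding pair_system_def by blast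
  then show ?thesis using b \<rho>'(2,3) by blast
qed

text \<open>Two enumerations with the same atomic diagram are an isomorphism of the predicates given
  by common names; quantified formulas are handled by the system of extensions instead.\<close>

locale back_and_forth =
  fixes L :: "('f fsym, 'r) lang" and M :: "('u, 'f fsym, 'r psym) struct" and N :: "('v, 'f fsym, 'r psym) struct"
    and e :: "nat \<Rightarrow> 'u" and e' :: "nat \<Rightarrow> 'v"
  assumes M: "pair_model L M" and N: "pair_model L N" and L: "sublang L_rings L"
    and TrM: "\<And>l. set l \<subseteq> universe M \<Longrightarrow> \<exists>b\<in>universe M. transcendental_over M l b"
    and TrN: "\<And>l. set l \<subseteq> universe N \<Longrightarrow> \<exists>b\<in>universe N. transcendental_over N l b"
    and e: "range e = universe (induced M)" and e': "range e' = universe (induced N)"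
    and atomic: "\<And>\<theta>. wf_fm L \<theta> \<Longrightarrow> (\<exists>s t. \<theta> = Eq s t) \<or> (\<exists>r ts. \<theta> = Rel r ts) \<Longrightarrow>
      sat (induced M) e \<theta> \<longleftrightarrow> sat (induced N) e' \<theta>"
begin

definition graph :: "('u \<times> 'v) set" where "graph = range (\<lambda>x. (e x, e' x))"

lemma domains: "domain (ring_of M)" "domain (ring_of N)"
proof -
  have "field (ring_of M)" "field (ring_of N)" using M N unfolding pair_model_def field_struct_def by simp_all
  then show "domain (ring_of M)" "domain (ring_of N)" by (simp_all only: field.axioms(1))
qed

lemma fint_iff:
  assumes "funs L f = Some (length xs)"
  shows "fint M f (map e xs) = e y \<longleftrightarrow> fint N f (map e' xs) = e' y"
  using atomic[of "Eq (App f (map Var xs)) (Var y)"] assms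
  by (simp add: list_all_iff induced_def comp_def)

lemma rint_iff:
  assumes "rels L r = Some (length xs)"
  shows "rint M (Base r) (map e xs) \<longleftrightarrow> rint N (Base r) (map e' xs)"
  using atomic[of "Rel r (map Var xs)"] assms by (simp add: list_all_iff induced_def comp_def)

lemma graph_fint:
  assumes "funs L f = Some (length xs)" "fint M f (map e xs) \<in> universe (induced M)"
  shows "(fint M f (map e xs), fint N f (map e' xs)) \<in> graph"
proof -
  obtain y where "fint M f (map e xs) = e y" using assms(2) e by (metis rangeE)
  then show ?thesis using fint_iff[OF assms(1), of y] unfolding graph_def by auto
qed

lemma neg: "a \<in> universe M \<Longrightarrow> fint M RNeg [a] = \<ominus>\<^bsub>ring_of M\<^esub> a" "b \<in> universe N \<Longrightarrow> fint N RNeg [b] = \<ominus>\<^bsub>ring_of N\<^esub> b"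
  using M N unfolding pair_model_def field_struct_def by simp_all

lemma partial_iso_graph: "partial_iso (ring_of M) (ring_of N) graph"
proof -
  interpret R: domain "ring_of M" by (rule domains)
  interpret S: domain "ring_of N" by (rule domains)
  have KM: "subring (universe (induced M)) (ring_of M)" "subring (universe (induced N)) (ring_of N)"
    using M N unfolding pair_model_def by (simp_all add: subfieldE(1))
  note K = subringE[OF KM(1)] and K' = subringE[OF KM(2)]
  have ex: "e x \<in> universe (induced M)" "e' x \<in> universe (induced N)" for x using e e' by auto
  then have ex': "e x \<in> universe M" "e' x \<in> universe N" for x by (auto simp: in_induced)
  note f = funs_L_rings[OF L]
  show ?thesis
    unfolding partial_iso_def
  proof (intro conjI allI impI)
    show "graph \<subseteq> carrier (ring_of M) \<times> carrier (ring_of N)" using ex' by (auto simp: graph_def ring_of_simps)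
    show "(\<one>\<^bsub>ring_of M\<^esub>, \<one>\<^bsub>ring_of N\<^esub>) \<in> graph"
      using graph_fint[of ROne "[]"] f K(3) by (simp add: ring_of_simps)
  next
    fix a b assume "(a, b) \<in> graph"
    then obtain x where x: "a = e x" "b = e' x" unfolding graph_def by auto
    show "(\<ominus>\<^bsub>ring_of M\<^esub> a, \<ominus>\<^bsub>ring_of N\<^esub> b) \<in> graph"
      using graph_fint[of RNeg "[x]"] f K(5)[OF ex(1)[of x]] neg ex' by (simp add: x)
    show "a = \<zero>\<^bsub>ring_of M\<^esub> \<longleftrightarrow> b = \<zero>\<^bsub>ring_of N\<^esub>"
      using fint_iff[of RZero "[]" x] f by (auto simp: x ring_of_simps)
    fix c d assume "(c, d) \<in> graph"
    then obtain y where y: "c = e y" "d = e' y" unfolding graph_def by auto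
    show "(a \<oplus>\<^bsub>ring_of M\<^esub> c, b \<oplus>\<^bsub>ring_of N\<^esub> d) \<in> graph"
      using graph_fint[of RAdd "[x, y]"] f K(7)[OF ex(1)[of x] ex(1)[of y]] by (simp add: x y ring_of_simps)
    show "(a \<otimes>\<^bsub>ring_of M\<^esub> c, b \<otimes>\<^bsub>ring_of N\<^esub> d) \<in> graph"
      using graph_fint[of RMul "[x, y]"] f K(6)[OF ex(1)[of x] ex(1)[of y]] by (simp add: x y ring_of_simps)
  qed
qed

abbreviation "System \<equiv> pair_system M N graph"

lemma graph_in_System: "graph \<in> System"
proof -
  have "Domain graph \<subseteq> universe (induced M)" "Range graph \<subseteq> universe (induced N)"
    using e e' by (auto simp: graph_def)
  then have "small M (Domain graph)" "small N (Range graph)"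
    unfolding small_def by (intro exI[of _ "[]"], auto intro: generated.base)+
  then show ?thesis unfolding pair_system_def using partial_iso_graph by blast
qed

context
  fixes \<rho> assumes \<rho>: "\<rho> \<in> System"
begin

lemma iso: "partial_iso (ring_of M) (ring_of N) \<rho>" and graph_sub: "graph \<subseteq> \<rho>"
  using \<rho> unfolding pair_system_def by blast+

lemmas D = partial_isoD[OF iso]

text \<open>\<rho> extends the isomorphism of the predicates and is single-valued in both
  directions, so an element of a predicate has no partner other than its image.\<close>

lemma predicate_graph:
  assumes "(a, b) \<in> \<rho>" "a \<in> universe (induced M) \<or> b \<in> universe (induced N)"
  shows "\<exists>x. a = e x \<and> b = e' x"
proof -
  obtain x where "a = e x \<or> b = e' x" using assms(2) e e' by (metis rangeE)
  moreover have "(e x, e' x) \<in> \<rho>" using graph_sub unfolding graph_def by blast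
  ultimately show ?thesis using partial_iso_unique[OF domains iso assms(1)] by blast
qed

lemma predicate_iff: "(a, b) \<in> \<rho> \<Longrightarrow> a \<in> universe (induced M) \<longleftrightarrow> b \<in> universe (induced N)"
  using predicate_graph[of a b] e e' by blast

lemma predicate_list:
  assumes "list_all2 (\<lambda>a b. (a, b) \<in> \<rho>) as bs"
  shows "set as \<subseteq> universe (induced M) \<longleftrightarrow> set bs \<subseteq> universe (induced N)"
    and "set as \<subseteq> universe (induced M) \<Longrightarrow> \<exists>xs. as = map e xs \<and> bs = map e' xs"
  using assms
proof (induction rule: list_all2_induct)
  case (Cons a as b bs)
  { case 1 show ?case using Cons predicate_iff[of a b] by simp }
  { case 2
    then obtain xs where "as = map e xs" "bs = map e' xs" using Cons by auto
    moreover obtain x where "a = e x" "b = e' x" using predicate_graph[of a b] 2 Cons by auto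
    ultimately show ?case by (intro exI[of _ "x # xs"]) simp }
qed auto

lemma list_universe:
  assumes "list_all2 (\<lambda>a b. (a, b) \<in> \<rho>) as bs"
  shows "set as \<subseteq> universe M" "set bs \<subseteq> universe N"
  using assms by (induction rule: list_all2_induct) (use D(1,2) in \<open>auto simp: ring_of_simps(1)\<close>)

text \<open>Ring operations are preserved since \<rho> is a ring isomorphism. Any other function
  symbol follows the isomorphism on arguments in the predicate and is 0 on both sides otherwise, so
  no closure of \<rho> under it has to be arranged.\<close>

lemma term_preserved:
  assumes "\<And>x. (\<epsilon> x, \<epsilon>' x) \<in> \<rho>" "wf_tm L t"
  shows "(eval_tm M \<epsilon> t, eval_tm N \<epsilon>' t) \<in> \<rho>"
  using assms(2)
proof (induction t)
  case (Var x)
  then show ?case using assms(1) by simp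
next
  case (App f ts)
  let ?as = "map (eval_tm M \<epsilon>) ts" and ?bs = "map (eval_tm N \<epsilon>') ts"
  have f: "funs L f = Some (length ts)" using App.prems by simp
  have l2: "list_all2 (\<lambda>a b. (a, b) \<in> \<rho>) ?as ?bs"
    using App by (auto simp: list_all2_map1 list_all2_map2 list_all_iff list.rel_refl_strong intro!: list.rel_refl_strong)
  note u = list_universe[OF l2]
  have "(fint M f ?as, fint N f ?bs) \<in> \<rho>"
  proof (cases f)
    case RZero
    then have "ts = []" using f funs_L_rings[OF L] by simp
    then show ?thesis using partial_iso_zero[OF domains iso] RZero by (simp add: ring_of_simps)
  next
    case ROne
    then have "ts = []" using f funs_L_rings[OF L] by simp
    then show ?thesis using D(3) ROne by (simp add: ring_of_simps)
  next
    case RNeg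
    then have "length ts = Suc 0" using f funs_L_rings[OF L] by simp
    then obtain t where "ts = [t]" by (auto simp: length_Suc_conv)
    then show ?thesis using D(4)[of "eval_tm M \<epsilon> t"] l2 RNeg neg u by simp
  next
    case RAdd
    then have "length ts = Suc (Suc 0)" using f funs_L_rings[OF L] by simp
    then obtain s t where "ts = [s, t]" by (auto simp: length_Suc_conv)
    then show ?thesis using D(6) l2 RAdd by (simp add: ring_of_simps)
  next
    case RMul
    then have "length ts = Suc (Suc 0)" using f funs_L_rings[OF L] by simp
    then obtain s t where "ts = [s, t]" by (auto simp: length_Suc_conv)
    then show ?thesis using D(7) l2 RMul by (simp add: ring_of_simps)
  next
    case (Ext g)
    then have nr: "f \<notin> dom (funs (L_rings :: ('f fsym, 'r) lang))" by (auto simp: L_rings_def split: if_splits)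
    have fM: "if set ?as \<subseteq> universe (induced M) then fint M f ?as \<in> universe (induced M) else fint M f ?as = fint M RZero []"
      using pair_model_fint[OF M, of f ?as] f nr u(1) by simp
    have fN: "if set ?bs \<subseteq> universe (induced N) then fint N f ?bs \<in> universe (induced N) else fint N f ?bs = fint N RZero []"
      using pair_model_fint[OF N, of f ?bs] f nr u(2) by simp
    show ?thesis
    proof (cases "set ?as \<subseteq> universe (induced M)")
      case True
      then obtain xs where xs: "?as = map e xs" "?bs = map e' xs" using predicate_list(2)[OF l2] by blast
      have "length xs = length ts" using xs(1) by (metis length_map)
      then have "(fint M f (map e xs), fint N f (map e' xs)) \<in> graph"
        using graph_fint[of f xs] f fM True xs by simp
      then show ?thesis using graph_sub unfolding xs by blast
    next
      case False
      then have "fint M f ?as = fint M RZero []" "fint N f ?bs = fint N RZero []"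
        using fM fN predicate_list(1)[OF l2] by auto
      then show ?thesis using partial_iso_zero[OF domains iso] by (simp add: ring_of_simps)
    qed
  qed
  then show ?case by simp
qed

lemma terms_preserved:
  assumes "\<And>x. (\<epsilon> x, \<epsilon>' x) \<in> \<rho>" "list_all (wf_tm L) ts"
  shows "list_all2 (\<lambda>a b. (a, b) \<in> \<rho>) (map (eval_tm M \<epsilon>) ts) (map (eval_tm N \<epsilon>') ts)"
  using term_preserved[OF assms(1)] assms(2)
  by (auto simp: list_all2_map1 list_all2_map2 list_all_iff intro!: list.rel_refl_strong)

lemma rel_preserved:
  assumes \<epsilon>: "\<And>x. (\<epsilon> x, \<epsilon>' x) \<in> \<rho>" and wf: "wf_fm (lang_P L) (Rel r ts)"
  shows "sat M \<epsilon> (Rel r ts) \<longleftrightarrow> sat N \<epsilon>' (Rel r ts)"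
proof -
  let ?as = "map (eval_tm M \<epsilon>) ts" and ?bs = "map (eval_tm N \<epsilon>') ts"
  have "wf_tm L t \<longleftrightarrow> wf_tm (lang_P L) t" for t
    using wf_tm_transfer[of L t "lang_P L"] wf_tm_transfer[of "lang_P L" t L] by (auto simp: lang_P_def)
  then have "list_all (wf_tm L) ts" using wf by (simp add: list_all_iff)
  note l2 = terms_preserved[OF \<epsilon> this]
  note u = list_universe[OF l2]
  show ?thesis
  proof (cases r)
    case P
    then have "length ts = Suc 0" using wf by (simp add: lang_P_def)
    then obtain t where "ts = [t]" by (auto simp: length_Suc_conv)
    then have "(eval_tm M \<epsilon> t, eval_tm N \<epsilon>' t) \<in> \<rho>" using l2 by simp
    from predicate_iff[OF this] show ?thesis using \<open>ts = [t]\<close> P u by (simp add: in_induced)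
  next
    case (Base q)
    have q: "rels L q = Some (length ts)" using wf Base by (simp add: lang_P_def)
    have "rint M (Base q) ?as \<Longrightarrow> set ?as \<subseteq> universe (induced M)"
      using pair_model_rint[OF M, of q ?as] q u(1) by simp
    moreover have "rint N (Base q) ?bs \<Longrightarrow> set ?bs \<subseteq> universe (induced N)"
      using pair_model_rint[OF N, of q ?bs] q u(2) by simp
    moreover have "rint M (Base q) ?as \<longleftrightarrow> rint N (Base q) ?bs" if s: "set ?as \<subseteq> universe (induced M)"
    proof -
      obtain xs where xs: "?as = map e xs" "?bs = map e' xs" using predicate_list(2)[OF l2 s] by blast
      have "length xs = length ts" using xs(1) by (metis length_map)
      then show ?thesis unfolding xs using rint_iff[of q xs] q by simp
    qed
    ultimately show ?thesis using Base predicate_list(1)[OF l2] by auto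
  qed
qed

end

lemma sat_preserved:
  assumes "\<rho> \<in> System" "\<And>x. (\<epsilon> x, \<epsilon>' x) \<in> \<rho>" "wf_fm (lang_P L) \<phi>"
  shows "sat M \<epsilon> \<phi> \<longleftrightarrow> sat N \<epsilon>' \<phi>"
  using assms
proof (induction \<phi> arbitrary: \<rho> \<epsilon> \<epsilon>')
  case (Eq s t)
  have "wf_tm L t \<longleftrightarrow> wf_tm (lang_P L) t" for t
    using wf_tm_transfer[of L t "lang_P L"] wf_tm_transfer[of "lang_P L" t L] by (auto simp: lang_P_def)
  then have "wf_tm L s" "wf_tm L t" using Eq.prems by auto
  then show ?case
    using partial_iso_unique[OF domains iso[OF Eq.prems(1)] term_preserved[OF Eq.prems(1,2)] term_preserved[OF Eq.prems(1,2)]]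
    by simp
next
  case (Rel r ts)
  then show ?case using rel_preserved by blast
next
  case (Imp \<phi> \<psi>)
  then show ?case by (metis sat.simps(4) wf_fm.simps(4))
next
  case (Forall x \<phi>)
  have wf: "wf_fm (lang_P L) \<phi>" using Forall.prems by simp
  have step: "sat M (\<epsilon>(x := a)) \<phi> \<longleftrightarrow> sat N (\<epsilon>'(x := b)) \<phi>"
    if "\<rho>' \<in> System" "\<rho> \<subseteq> \<rho>'" "(a, b) \<in> \<rho>'" for a b \<rho>'
    by (rule Forall.IH[OF that(1) _ wf]) (use Forall.prems(2) that in auto)
  show ?case
  proof
    assume s: "sat M \<epsilon> (Forall x \<phi>)"
    show "sat N \<epsilon>' (Forall x \<phi>)" unfolding sat.simps
    proof
      fix b assume "b \<in> universe N"
      \<comment> \<open>The back direction is the forth direction for the converse relation, with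
        \<open>M\<close> and \<open>N\<close> exchanged.\<close>
      from pair_system_forth[OF N M L TrM pair_system_converse[OF Forall.prems(1)] this]
      obtain a \<rho>' where a: "a \<in> universe M" "\<rho>' \<in> pair_system N M (graph\<inverse>)" "\<rho>\<inverse> \<subseteq> \<rho>'" "(b, a) \<in> \<rho>'" by blast
      have "\<rho>'\<inverse> \<in> System" using pair_system_converse[OF a(2)] by simp
      moreover have "\<rho> \<subseteq> \<rho>'\<inverse>" "(a, b) \<in> \<rho>'\<inverse>" using a(3,4) by auto
      ultimately show "sat N (\<epsilon>'(x := b)) \<phi>" using step s a(1) by auto
    qed
  next
    assume s: "sat N \<epsilon>' (Forall x \<phi>)"
    show "sat M \<epsilon> (Forall x \<phi>)" unfolding sat.simps
    proof
      fix a assume "a \<in> universe M"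
      from pair_system_forth[OF M N L TrN Forall.prems(1) this]
      obtain b \<rho>' where b: "b \<in> universe N" "\<rho>' \<in> System" "\<rho> \<subseteq> \<rho>'" "(a, b) \<in> \<rho>'" by blast
      then show "sat M (\<epsilon>(x := a)) \<phi>" using step s by auto
    qed
  qed
qed simp

theorem elementarily_equivalent:
  assumes "\<phi> \<in> sentences (lang_P L)"
  shows "holds M \<phi> \<longleftrightarrow> holds N \<phi>"
proof -
  have "range e \<subseteq> universe M" "range e' \<subseteq> universe N" using e e' by (auto simp: in_induced)
  then have "holds M \<phi> \<longleftrightarrow> sat M e \<phi>" "holds N \<phi> \<longleftrightarrow> sat N e' \<phi>"
    using assms by (auto simp: sentences_def intro!: holds_iff_sat)
  moreover have "sat M e \<phi> \<longleftrightarrow> sat N e' \<phi>"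
    by (rule sat_preserved[OF graph_in_System]) (use assms in \<open>auto simp: graph_def sentences_def\<close>)
  ultimately show ?thesis by simp
qed

end

section \<open>Existence of models\<close>

lemma holds_field_axioms:
  assumes M: "field_struct M" and \<phi>: "\<phi> \<in> Defs.field_axioms"
  shows "holds M \<phi>"
proof -
  interpret field "ring_of M" using M unfolding field_struct_def by simp
  have neg: "fint M RNeg [a] = \<ominus>\<^bsub>ring_of M\<^esub> a" if "a \<in> carrier (ring_of M)" for a
    using M that unfolding field_struct_def by (simp add: ring_of_simps(1))
  have inv: "\<exists>b\<in>carrier (ring_of M). a \<otimes>\<^bsub>ring_of M\<^esub> b = \<one>\<^bsub>ring_of M\<^esub>"
    if "a \<in> carrier (ring_of M)" "a \<noteq> \<zero>\<^bsub>ring_of M\<^esub>" for a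
    using that field_Units Units_r_inv Units_inv_closed by blast
  show ?thesis
    using \<phi> unfolding Defs.field_axioms_def Let_def
    by (auto simp: holds_def Foralls_def ring_of_simps[symmetric] neg r_neg a_assoc m_assoc r_distr
        intro: a_comm m_comm inv)
qed

text \<open>The values at \<open>Ext\<close> symbols and at relations are dummies;
  \<open>expand\<close> overwrites them.\<close>

definition struct_of_ring :: "'a ring \<Rightarrow> ('a, 'f fsym, 'r) struct" where
  "struct_of_ring R = \<lparr>universe = carrier R,
     fint = (\<lambda>f as. case f of RZero \<Rightarrow> \<zero>\<^bsub>R\<^esub> | ROne \<Rightarrow> \<one>\<^bsub>R\<^esub> | RNeg \<Rightarrow> \<ominus>\<^bsub>R\<^esub> (as ! 0)
       | RAdd \<Rightarrow> as ! 0 \<oplus>\<^bsub>R\<^esub> as ! 1 | RMul \<Rightarrow> as ! 0 \<otimes>\<^bsub>R\<^esub> as ! 1 | Ext g \<Rightarrow> \<zero>\<^bsub>R\<^esub>),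
     rint = (\<lambda>_ _. False)\<rparr>"

lemma struct_of_ring_simps:
  "universe (struct_of_ring R) = carrier R" "fint (struct_of_ring R) RZero as = \<zero>\<^bsub>R\<^esub>"
  "fint (struct_of_ring R) ROne as = \<one>\<^bsub>R\<^esub>" "fint (struct_of_ring R) RNeg [a] = \<ominus>\<^bsub>R\<^esub> a"
  "fint (struct_of_ring R) RAdd [a, b] = a \<oplus>\<^bsub>R\<^esub> b" "fint (struct_of_ring R) RMul [a, b] = a \<otimes>\<^bsub>R\<^esub> b"
  by (simp_all add: struct_of_ring_def)

lemma ring_of_struct_of_ring: "ring_of (struct_of_ring R) = R"
  by (simp add: ring_of_def struct_of_ring_def)

lemma field_struct_struct_of_ring: "field R \<Longrightarrow> field_struct (struct_of_ring R)"
  unfolding field_struct_def ring_of_struct_of_ring by (simp add: struct_of_ring_def)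

lemma is_structure_struct_of_ring:
  assumes "field R"
  shows "is_structure L_rings (struct_of_ring R)"
proof -
  interpret field R by fact
  show ?thesis
    unfolding is_structure_def
  proof (intro conjI allI impI)
    show "universe (struct_of_ring R) \<noteq> {}" using zero_closed by (auto simp: struct_of_ring_def)
    fix f n and as :: "'a list"
    assume *: "funs L_rings f = Some n" "length as = n" "set as \<subseteq> universe (struct_of_ring R)"
    have nth: "as ! i \<in> carrier R" if "i < n" for i
      using * that nth_mem[of i as] by (auto simp: struct_of_ring_def)
    show "fint (struct_of_ring R) f as \<in> universe (struct_of_ring R)"
      using *(1) nth by (auto simp: struct_of_ring_def L_rings_def split: fsym.splits if_splits)
  qed
qed

text \<open>In a finite field with m units, x^(m+1) = x for all x, so X^(m+1) - X - 1 takes the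
  value -1 everywhere and has no root.\<close>

lemma (in algebraically_closed) infinite_carrier: "infinite (carrier L)"
proof
  assume fin: "finite (carrier L)"
  define m where "m = order (units_of L)"
  interpret G: group "units_of L" by (rule units_group)
  have "finite (carrier (units_of L))" using fin by (simp add: units_of_carrier field_Units)
  moreover have "\<one> \<in> carrier (units_of L)" by (simp add: units_of_carrier)
  ultimately have "0 < m" unfolding m_def order_def by (subst card_gt_0_iff) blast
  then have m: "1 \<le> m" by simp
  let ?p = "\<one> # replicate (m - 1) \<zero> @ [\<ominus> \<one>, \<ominus> \<one>]"
  have "?p \<in> carrier (poly_ring L)" by (auto simp: univ_poly_def polynomial_def)
  moreover have "1 \<le> degree ?p" by simp
  ultimately obtain x where x: "x \<in> carrier L" "eval ?p x = \<zero>" using exists_root by blast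
  have "eval (replicate (m - 1) \<zero> @ [\<ominus> \<one>, \<ominus> \<one>]) x = eval [\<ominus> \<one>, \<ominus> \<one>] x"
    by (rule eval_replicate) (use x in auto)
  also have "\<dots> = \<ominus> x \<oplus> \<ominus> \<one>" using x by (simp add: l_minus)
  finally have e: "x [^] Suc m \<oplus> (\<ominus> x \<oplus> \<ominus> \<one>) = \<zero>" using x m by simp
  show False
  proof (cases "x = \<zero>")
    case True
    then show False using e by simp
  next
    case False
    then have u: "x \<in> Units L" using x by (simp add: field_Units)
    then have "x [^]\<^bsub>units_of L\<^esub> m = \<one>\<^bsub>units_of L\<^esub>"
      unfolding m_def by (intro G.pow_order_eq_1) (simp add: units_of_carrier)
    then have "x [^] m = \<one>" using units_of_pow[OF u] by (simp add: units_of_one)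
    then have "x \<oplus> (\<ominus> x \<oplus> \<ominus> \<one>) = \<zero>" using e x by simp
    then show False using x by (simp add: r_neg2)
  qed
qed

text \<open>\<open>h\<close> embeds \<open>K\<close> into the field \<open>M\<close>; the image becomes the predicate and carries the structure
  of \<open>K\<close>.\<close>

definition expand ::
  "('k, 'f fsym, 'r) struct \<Rightarrow> ('k \<Rightarrow> 'u) \<Rightarrow> ('u, 'f fsym, 's) struct \<Rightarrow> ('u, 'f fsym, 'r psym) struct" where
  "expand K h M = (let A = h ` universe K; g = inv_into (universe K) h in
     \<lparr>universe = universe M,
      fint = (\<lambda>f as. case f of Ext _ \<Rightarrow> (if set as \<subseteq> A then h (fint K f (map g as)) else fint M RZero [])
        | _ \<Rightarrow> fint M f as),
      rint = (\<lambda>r as. set as \<subseteq> A \<and> (case r of P \<Rightarrow> True | Base q \<Rightarrow> rint K q (map g as)))\<rparr>)"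

locale expansion =
  fixes L :: "('f fsym, 'r) lang" and K :: "('k, 'f fsym, 'r) struct" and h :: "'k \<Rightarrow> 'u"
    and M :: "('u, 'f fsym, 's) struct"
  assumes L: "sublang L_rings L" and K: "is_structure L K" "field_struct K"
    and M: "is_structure L_rings M" "field_struct M" "algebraically_closed (ring_of M)"
    and hom: "h \<in> ring_hom (ring_of K) (ring_of M)"
begin

abbreviation "E \<equiv> expand K h M"

sublocale FK: field "ring_of K" using K(2) unfolding field_struct_def by simp
sublocale FM: algebraically_closed "ring_of M" by (rule M(3))
sublocale H: ring_hom_ring "ring_of K" "ring_of M" h
  by (rule ring_hom_ringI2) (unfold_locales, rule hom)

lemma inj: "inj_on h (universe K)"
  using non_trivial_field_hom_is_inj[OF hom FK.field_axioms FM.field_axioms] by (simp add: ring_of_simps)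

lemma h_in: "a \<in> universe K \<Longrightarrow> h a \<in> universe M"
  using H.hom_closed by (simp add: ring_of_simps(1))

lemma inv_h: "set as \<subseteq> universe K \<Longrightarrow> map (inv_into (universe K) h) (map h as) = as"
  using inj by (intro nth_equalityI) (auto simp: subset_iff)

lemma universe_expand: "universe E = universe M"
  by (simp add: expand_def Let_def)

lemma ring_of_expand: "ring_of E = ring_of M"
  by (simp add: ring_of_def expand_def Let_def)

lemma universe_induced: "universe (induced E) = h ` universe K"
  using h_in by (auto simp: induced_def expand_def Let_def)

lemma field_struct_expand: "field_struct E"
  using M(2) unfolding field_struct_def ring_of_expand universe_expand by (simp add: expand_def Let_def)

lemma is_structure_expand: "is_structure (lang_P L) E"
  unfolding is_structure_def
proof (intro conjI allI impI)
  show "universe E \<noteq> {}" using M(1) unfolding universe_expand is_structure_def by simp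
  fix f n as assume *: "funs (lang_P L) f = Some n" "length as = n" "set as \<subseteq> universe E"
  have f: "funs L f = Some (length as)" using * by (simp add: lang_P_def)
  have sub: "funs (L_rings :: ('f fsym, 's) lang) f = Some (length as)" if "\<And>g. f \<noteq> Ext g"
    using f that funs_L_rings[OF L] by (cases f) (auto simp: L_rings_def)
  show "fint E f as \<in> universe E"
  proof (cases "\<exists>g. f = Ext g")
    case True
    then obtain g where g: "f = Ext g" by blast
    have "fint M RZero [] \<in> universe M" using M(1) unfolding is_structure_def by (auto simp: L_rings_def)
    moreover have "h (fint K f (map (inv_into (universe K) h) as)) \<in> universe M" if "set as \<subseteq> h ` universe K"
    proof (rule h_in)
      have "set (map (inv_into (universe K) h) as) \<subseteq> universe K" using that by (auto intro: inv_into_into)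
      then show "fint K f (map (inv_into (universe K) h) as) \<in> universe K"
        using K(1) f unfolding is_structure_def by simp
    qed
    ultimately show ?thesis unfolding universe_expand using g by (simp add: expand_def Let_def)
  next
    case False
    then have "fint E f as = fint M f as" by (cases f) (auto simp: expand_def Let_def)
    moreover have "fint M f as \<in> universe M"
    proof -
      have "funs (L_rings :: ('f fsym, 's) lang) f = Some (length as)" using sub False by blast
      then show ?thesis using M(1) *(3) unfolding is_structure_def universe_expand by blast
    qed
    ultimately show ?thesis unfolding universe_expand by simp
  qed
qed

lemma fint_expand:
  assumes f: "funs L f = Some (length as)" and as: "set as \<subseteq> universe K"
  shows "fint E f (map h as) = h (fint K f as)" "fint K f as \<in> universe K"
proof -
  show c: "fint K f as \<in> universe K" using K(1) f as unfolding is_structure_def by simp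
  have as': "set as \<subseteq> carrier (ring_of K)" using as by (simp add: ring_of_simps)
  show "fint E f (map h as) = h (fint K f as)"
  proof (cases f)
    case RZero
    then have "as = []" using f funs_L_rings[OF L] by simp
    then show ?thesis using H.hom_zero RZero by (simp add: ring_of_simps expand_def Let_def)
  next
    case ROne
    then have "as = []" using f funs_L_rings[OF L] by simp
    then show ?thesis using H.hom_one ROne by (simp add: ring_of_simps expand_def Let_def)
  next
    case RNeg
    then have "length as = Suc 0" using f funs_L_rings[OF L] by simp
    then obtain a where a: "as = [a]" by (auto simp: length_Suc_conv)
    have "fint K RNeg [a] = \<ominus>\<^bsub>ring_of K\<^esub> a" "fint M RNeg [h a] = \<ominus>\<^bsub>ring_of M\<^esub> h a"
      using K(2) M(2) as h_in unfolding field_struct_def a by simp_all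
    then show ?thesis using H.hom_a_inv[of a] as' RNeg a by (simp add: expand_def Let_def)
  next
    case RAdd
    then have "length as = Suc (Suc 0)" using f funs_L_rings[OF L] by simp
    then obtain a b where "as = [a, b]" by (auto simp: length_Suc_conv)
    then show ?thesis using H.hom_add[of a b] as' RAdd by (simp add: ring_of_simps expand_def Let_def)
  next
    case RMul
    then have "length as = Suc (Suc 0)" using f funs_L_rings[OF L] by simp
    then obtain a b where "as = [a, b]" by (auto simp: length_Suc_conv)
    then show ?thesis using H.hom_mult[of a b] as' RMul by (simp add: ring_of_simps expand_def Let_def)
  next
    case (Ext g)
    have "set (map h as) \<subseteq> h ` universe K" using as by auto
    then show ?thesis using Ext inv_h[OF as] by (simp add: expand_def Let_def)
  qed
qed

lemma eval_tm_expand: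
  assumes e: "range e \<subseteq> universe K" and "wf_tm L t"
  shows "eval_tm E (h \<circ> e) t = h (eval_tm K e t) \<and> eval_tm K e t \<in> universe K"
  using assms(2)
proof (induction t)
  case (App f ts)
  have IH: "eval_tm E (h \<circ> e) t = h (eval_tm K e t)" "eval_tm K e t \<in> universe K" if "t \<in> set ts" for t
  proof -
    have "wf_tm L t" using App.prems that by (auto simp: list_all_iff)
    from App.IH[OF that this] show "eval_tm E (h \<circ> e) t = h (eval_tm K e t)" "eval_tm K e t \<in> universe K"
      by (rule conjunct1, rule conjunct2)
  qed
  have m: "map (eval_tm E (h \<circ> e)) ts = map h (map (eval_tm K e) ts)" using IH(1) by simp
  have "set (map (eval_tm K e) ts) \<subseteq> universe K" using IH(2) by auto
  then show ?case
    unfolding eval_tm.simps m using fint_expand[of f "map (eval_tm K e) ts"] App.prems by simp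
qed (use e in auto)

lemma sat_expand:
  assumes "range e \<subseteq> universe K" "wf_fm L \<theta>"
  shows "sat (induced E) (h \<circ> e) \<theta> \<longleftrightarrow> sat K e \<theta>"
  using assms
proof (induction \<theta> arbitrary: e)
  case (Eq s t)
  then have "eval_tm E (h \<circ> e) s = h (eval_tm K e s) \<and> eval_tm K e s \<in> universe K"
    "eval_tm E (h \<circ> e) t = h (eval_tm K e t) \<and> eval_tm K e t \<in> universe K"
    using eval_tm_expand[of e] by simp_all
  then show ?case by (simp only: sat.simps eval_tm_induced inj_on_eq_iff[OF inj])
next
  case (Rel r ts)
  have *: "eval_tm E (h \<circ> e) t = h (eval_tm K e t)" "eval_tm K e t \<in> universe K" if "t \<in> set ts" for t
  proof -
    have "wf_tm L t" using Rel.prems that by (auto simp: list_all_iff)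
    from eval_tm_expand[OF Rel.prems(1) this]
    show "eval_tm E (h \<circ> e) t = h (eval_tm K e t)" "eval_tm K e t \<in> universe K"
      by (rule conjunct1, rule conjunct2)
  qed
  let ?as = "map (eval_tm K e) ts"
  have m: "map (eval_tm E (h \<circ> e)) ts = map h ?as" using *(1) by simp
  have as: "set ?as \<subseteq> universe K" using *(2) by auto
  have "sat (induced E) (h \<circ> e) (Rel r ts) \<longleftrightarrow> rint E (Base r) (map (eval_tm E (h \<circ> e)) ts)"
    unfolding sat.simps by (simp only: eval_tm_induced cong: map_cong) (simp add: induced_def)
  also have "\<dots> \<longleftrightarrow> rint E (Base r) (map h ?as)" unfolding m by (rule refl)
  also have "\<dots> \<longleftrightarrow> rint K r (map (inv_into (universe K) h) (map h ?as))"
    using as by (auto simp: expand_def Let_def)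
  also have "\<dots> \<longleftrightarrow> sat K e (Rel r ts)" unfolding inv_h[OF as] by simp
  finally show ?case .
next
  case (Forall x \<theta>)
  have "sat (induced E) ((h \<circ> e)(x := h a)) \<theta> \<longleftrightarrow> sat K (e(x := a)) \<theta>" if "a \<in> universe K" for a
  proof -
    have "(h \<circ> e)(x := h a) = h \<circ> e(x := a)" by auto
    moreover have "sat (induced E) (h \<circ> e(x := a)) \<theta> \<longleftrightarrow> sat K (e(x := a)) \<theta>"
      by (rule Forall.IH) (use Forall.prems that in auto)
    ultimately show ?thesis by simp
  qed
  then have "(\<forall>b\<in>h ` universe K. sat (induced E) ((h \<circ> e)(x := b)) \<theta>) \<longleftrightarrow>
      (\<forall>a\<in>universe K. sat K (e(x := a)) \<theta>)" by (simp only: ball_simps cong: ball_cong)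
  then show ?case by (simp only: sat.simps universe_induced)
qed simp_all

lemma subfield_image: "subfield (h ` universe K) (ring_of M)"
  using H.img_is_subfield(2)[OF FK.carrier_is_subfield FM.one_not_zero] by (simp add: ring_of_simps(1))

lemma pair_model_expand: "pair_model L E"
  unfolding pair_model_def ring_of_expand universe_induced
proof (intro conjI allI impI)
  fix f n as
  assume *: "funs L f = Some n" "f \<notin> dom (funs (L_rings :: ('f fsym, 'r) lang))" "length as = n" "set as \<subseteq> universe E"
  have "\<exists>g. f = Ext g" using *(2) by (cases f) (auto simp: L_rings_def)
  then obtain g where g: "f = Ext g" by blast
  show "if set as \<subseteq> h ` universe K then fint E f as \<in> h ` universe K else fint E f as = fint E RZero []"
  proof (cases "set as \<subseteq> h ` universe K")
    case True
    have "set (map (inv_into (universe K) h) as) \<subseteq> universe K" using True by (auto intro: inv_into_into)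
    then have "fint K f (map (inv_into (universe K) h) as) \<in> universe K"
      using K(1) *(1,3) unfolding is_structure_def by simp
    then show ?thesis using True g by (simp add: expand_def Let_def)
  next
    case False
    then show ?thesis using g by (simp add: expand_def Let_def)
  qed
next
  fix r n as assume "rint E (Base r) as"
  then show "set as \<subseteq> h ` universe K" by (simp add: expand_def Let_def)
qed (simp_all only: is_structure_expand field_struct_expand M(3) subfield_image)

lemma holds_expand:
  assumes "\<theta> \<in> sentences L"
  shows "holds (induced E) \<theta> \<longleftrightarrow> holds K \<theta>"
proof -
  obtain d where d: "d \<in> universe K" using K(1) unfolding is_structure_def by blast
  have "holds (induced E) \<theta> \<longleftrightarrow> sat (induced E) (h \<circ> (\<lambda>_. d)) \<theta>"
    by (rule holds_iff_sat) (use assms d in \<open>auto simp: sentences_def universe_induced\<close>)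
  also have "\<dots> \<longleftrightarrow> sat K (\<lambda>_. d) \<theta>" by (rule sat_expand) (use assms d in \<open>auto simp: sentences_def\<close>)
  also have "\<dots> \<longleftrightarrow> holds K \<theta>"
    by (rule holds_iff_sat[symmetric]) (use assms d in \<open>auto simp: sentences_def\<close>)
  finally show ?thesis .
qed

end

section \<open>A pair of infinite degree\<close>

context ultrafilter
begin

lemma germ_fint: "fint (ultrapower M) f (map germ fs) = germ (\<lambda>i. fint M f (map (\<lambda>f. f i) fs))"
proof -
  have "eventually (\<lambda>i. map (\<lambda>f. germ f i) fs = map (\<lambda>f. f i) fs) U"
    by (rule eventually_map_eq) (rule germ)
  then have "eventually (\<lambda>i. fint M f (map (\<lambda>f. germ f i) fs) = fint M f (map (\<lambda>f. f i) fs)) U"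
    by eventually_elim (rule arg_cong)
  then show ?thesis by (simp add: ultrapower_def germ_eq_iff comp_def)
qed

theorem exists_pair_model:
  fixes L :: "('f fsym, 'r) lang" and K :: "('k, 'f fsym, 'r) struct" and A :: "'u ring"
  assumes L: "sublang L_rings L" and K: "is_structure L K" "field_struct K"
    and A: "algebraically_closed A" and c: "c \<in> ring_hom (ring_of K) A"
  shows "\<exists>E :: (nat \<Rightarrow> 'u, 'f fsym, 'r psym) struct. pair_model L E \<and>
    ring.infinite_dimension (ring_of E) (universe (induced E)) (universe E) \<and>
    (\<forall>\<theta>\<in>sentences L. holds (induced E) \<theta> \<longleftrightarrow> holds K \<theta>)"
proof -
  interpret A: algebraically_closed A by (rule A)
  let ?M = "struct_of_ring A :: ('u, 'f fsym, 'r) struct" and ?h = "\<lambda>a. germ (\<lambda>i::nat. c a)"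
  let ?N = "ultrapower ?M"
  have M: "is_structure L_rings ?M" "field_struct ?M"
    by (rule is_structure_struct_of_ring[OF A.field_axioms], rule field_struct_struct_of_ring[OF A.field_axioms])
  have LL: "sublang L_rings L_rings" by (simp add: sublang_def)
  have N: "is_structure L_rings ?N" by (rule is_structure_ultrapower[OF M(1)])
  have fv: "fv \<phi> = {}" if "\<phi> \<in> ACF" for \<phi> :: "('f fsym, 'r) fm"
    using ACF_sentences[OF LL] that by (auto simp: sentences_def)
  have hN: "holds ?N \<phi>" if "\<phi> \<in> ACF" for \<phi>
  proof -
    have "holds ?M \<phi>"
      using that holds_field_axioms[OF M(2)] algebraically_closed_iff[OF M(2)] A
      unfolding ACF_def ring_of_struct_of_ring by auto
    then show ?thesis using holds_ultrapower[OF M(1) fv[OF that]] by simp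
  qed
  have FN: "field_struct ?N"
    by (rule field_struct_if_field_axioms[OF N LL]) (use hN in \<open>simp add: ACF_def\<close>)
  have AN: "algebraically_closed (ring_of ?N)"
    unfolding algebraically_closed_iff[OF FN] using hN by (auto simp: ACF_def)
  have cA: "c a \<in> carrier A" if "a \<in> universe K" for a using ring_hom_closed[OF c] that by (simp add: ring_of_simps)
  have hom: "?h \<in> ring_hom (ring_of K) (ring_of ?N)"
  proof (rule ring_hom_memI)
    fix a assume a: "a \<in> carrier (ring_of K)"
    show "?h a \<in> carrier (ring_of ?N)" unfolding ring_of_simps(1)
      by (rule germ_in_ultrapower) (use a cA in \<open>simp add: ring_of_simps(1) struct_of_ring_simps\<close>)
    fix b assume b: "b \<in> carrier (ring_of K)"
    show "?h (a \<otimes>\<^bsub>ring_of K\<^esub> b) = ?h a \<otimes>\<^bsub>ring_of ?N\<^esub> ?h b"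
      using germ_fint[of ?M RMul "[\<lambda>i. c a, \<lambda>i. c b]"] ring_hom_mult[OF c a b]
      by (simp add: ring_of_simps(2)[where M = ?N] struct_of_ring_simps)
    show "?h (a \<oplus>\<^bsub>ring_of K\<^esub> b) = ?h a \<oplus>\<^bsub>ring_of ?N\<^esub> ?h b"
      using germ_fint[of ?M RAdd "[\<lambda>i. c a, \<lambda>i. c b]"] ring_hom_add[OF c a b]
      by (simp add: ring_of_simps(3)[where M = ?N] struct_of_ring_simps)
  next
    show "?h \<one>\<^bsub>ring_of K\<^esub> = \<one>\<^bsub>ring_of ?N\<^esub>"
      using germ_fint[of ?M ROne "[]"] ring_hom_one[OF c] by (simp add: ring_of_simps(4)[where M = ?N] struct_of_ring_simps)
  qed
  interpret expansion L K ?h ?N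
    by (rule expansion.intro[OF L K N FN AN hom])
  \<comment> \<open>The class of this sequence will be transcendental over the diagonal copy of
    \<open>K\<close>.\<close>
  obtain x :: "nat \<Rightarrow> 'u" where x: "inj x" "range x \<subseteq> carrier A"
    using A.infinite_carrier infinite_countable_subset by blast
  have xi: "x i \<in> carrier A" for i using x(2) by blast
  have xN: "germ x \<in> carrier (ring_of ?N)" unfolding ring_of_simps(1)
    by (rule germ_in_ultrapower) (simp add: struct_of_ring_simps xi)
  have ringM: "ring (ring_of ?M)" unfolding ring_of_struct_of_ring by (rule A.ring_axioms)
  let ?K = "?h ` universe K"
  have "FM.infinite_dimension ?K (carrier (ring_of ?N))"
  proof
    assume "FM.finite_dimension ?K (carrier (ring_of ?N))"
    then have "(FM.algebraic over ?K) (germ x)"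
      using FM.finite_dimension_imp_algebraic[OF subfield_image FM.carrier_is_subring] xN by blast
    then obtain p where p: "p \<in> carrier (?K [X]\<^bsub>ring_of ?N\<^esub>)" "p \<noteq> []" "FM.eval p (germ x) = \<zero>\<^bsub>ring_of ?N\<^esub>"
      using FM.algebraicE[OF subfieldE(1)[OF subfield_image] xN] by blast
    have "set p \<subseteq> ?K" "hd p \<noteq> \<zero>\<^bsub>ring_of ?N\<^esub>" using p(1,2) by (auto simp: univ_poly_def polynomial_def)
    \<comment> \<open>The coefficients are classes of constant sequences, so one polynomial over
      \<open>A\<close> represents the relation at almost all indices.\<close>
    moreover from this(1) obtain q where q: "p = map ?h q" "set q \<subseteq> universe K"
    proof -
      have "p \<in> lists ?K" using \<open>set p \<subseteq> ?K\<close> by auto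
      then show ?thesis using that unfolding lists_image by auto
    qed
    ultimately have hq: "c (hd q) \<noteq> \<zero>\<^bsub>A\<^esub>" and qn: "q \<noteq> []"
      using p(2) germ_fint[of ?M RZero "[]"] by (auto simp: hd_map ring_of_simps(5)[where M = ?N] struct_of_ring_simps)
    have cq: "map c q \<in> carrier (poly_ring A)"
      using q(2) cA hq qn by (auto simp: univ_poly_def polynomial_def hd_map)
    have ev: "eventually (\<lambda>i. map (\<lambda>a. germ (\<lambda>i::nat. c a) i) q = map c q) U"
      by (rule eventually_map_eq) (rule germ)
    have ev0: "eventually (\<lambda>i. A.eval (map c q) (x i) = \<zero>\<^bsub>A\<^esub>) U"
      using ev eventually_eval[OF ringM FM.ring_axioms, of p "germ x"] germ[of x] eventually_fint[of ?M RZero "[]"]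
    proof eventually_elim
      case (elim i)
      have "\<zero>\<^bsub>ring_of ?N\<^esub> i = \<zero>\<^bsub>A\<^esub>" using elim(4) by (simp add: ring_of_simps(5)[where M = ?N] struct_of_ring_simps)
      moreover have "map (\<lambda>c. c i) p = map c q" unfolding q(1) using elim(1) by (simp add: comp_def)
      ultimately show ?case using elim(2,3) p(3) by (simp add: ring_of_struct_of_ring)
    qed
    \<comment> \<open>A nonzero polynomial has finitely many roots and \<open>x\<close> is
      injective, so only finitely many indices can satisfy the relation; the filter contains no
      finite set.\<close>
    have "finite (x -` {y. A.is_root (map c q) y})"
      by (rule finite_vimageI[OF A.finite_number_of_roots[OF cq] x(1)])
    then obtain n where n: "\<And>i. A.is_root (map c q) (x i) \<Longrightarrow> i < n"
      unfolding finite_nat_set_iff_bounded by auto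
    from ev0 eventually_ge[of n] have "eventually (\<lambda>i. False) U"
    proof eventually_elim
      case (elim i)
      then have "A.is_root (map c q) (x i)" using xi qn unfolding A.is_root_def by simp
      from n[OF this] show ?case using elim by simp
    qed
    then show False using proper by (simp add: trivial_limit_def)
  qed
  then have "ring.infinite_dimension (ring_of E) (universe (induced E)) (universe E)"
    unfolding ring_of_expand universe_induced universe_expand by (simp add: ring_of_simps(1))
  then show ?thesis using pair_model_expand holds_expand by blast
qed

end

section \<open>Completeness\<close>

lemma fv_relativize: "fv (relativize \<phi>) \<subseteq> fv \<phi>"
  by (induction \<phi>) auto

lemma holds_relativize:
  assumes "fv \<theta> = {}" "d \<in> universe (induced M)"
  shows "holds M (relativize \<theta>) \<longleftrightarrow> holds (induced M) \<theta>"
proof -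
  have "fv (relativize \<theta>) = {}" using fv_relativize[of \<theta>] assms(1) by blast
  moreover have "range (\<lambda>_::nat. d) \<subseteq> universe M" using assms(2) by (auto simp: in_induced)
  ultimately have "holds M (relativize \<theta>) \<longleftrightarrow> sat M (\<lambda>_. d) (relativize \<theta>)" by (rule holds_iff_sat)
  also have "\<dots> \<longleftrightarrow> sat (induced M) (\<lambda>_. d) \<theta>" by (rule sat_relativize)
  also have "\<dots> \<longleftrightarrow> holds (induced M) \<theta>" using assms by (intro holds_iff_sat[symmetric]) auto
  finally show ?thesis .
qed

lemma pair_model_zero:
  assumes "pair_model L M"
  shows "fint M RZero [] \<in> universe (induced M)"
proof -
  have "subfield (universe (induced M)) (ring_of M)" using assms unfolding pair_model_def by simp
  from subringE(2)[OF subfieldE(1)[OF this]] show ?thesis by (simp add: ring_of_simps)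
qed

lemma is_structure_induced:
  fixes L :: "('f fsym, 'r) lang"
  assumes M: "pair_model L M" and L: "sublang L_rings L"
  shows "is_structure L (induced M)"
proof -
  have F: "field_struct M" and K: "subfield (universe (induced M)) (ring_of M)"
    using M unfolding pair_model_def by simp_all
  note Kr = subringE[OF subfieldE(1)[OF K]]
  have KM: "universe (induced M) \<subseteq> universe M" by (auto simp: in_induced)
  have neg: "fint M RNeg [a] = \<ominus>\<^bsub>ring_of M\<^esub> a" if "a \<in> universe M" for a
    using F that unfolding field_struct_def by simp
  have "fint M f as \<in> universe (induced M)"
    if f: "funs L f = Some (length as)" and as: "set as \<subseteq> universe (induced M)" for f as
  proof (cases f)
    case RZero
    then have "as = []" using f funs_L_rings[OF L] by simp
    then show ?thesis using Kr(2) RZero by (simp add: ring_of_simps)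
  next
    case ROne
    then have "as = []" using f funs_L_rings[OF L] by simp
    then show ?thesis using Kr(3) ROne by (simp add: ring_of_simps)
  next
    case RNeg
    then have "length as = Suc 0" using f funs_L_rings[OF L] by simp
    then obtain a where "as = [a]" by (auto simp: length_Suc_conv)
    then show ?thesis using Kr(5)[of a] neg[of a] as KM RNeg by auto
  next
    case RAdd
    then have "length as = Suc (Suc 0)" using f funs_L_rings[OF L] by simp
    then obtain a b where "as = [a, b]" by (auto simp: length_Suc_conv)
    then show ?thesis using Kr(7)[of a b] as RAdd by (simp add: ring_of_simps)
  next
    case RMul
    then have "length as = Suc (Suc 0)" using f funs_L_rings[OF L] by simp
    then obtain a b where "as = [a, b]" by (auto simp: length_Suc_conv)
    then show ?thesis using Kr(6)[of a b] as RMul by (simp add: ring_of_simps)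
  next
    case (Ext g)
    then have "f \<notin> dom (funs (L_rings :: ('f fsym, 'r) lang))" by (auto simp: L_rings_def split: if_splits)
    from pair_model_fint[OF M f this] show ?thesis using as KM by auto
  qed
  moreover have "universe (induced M) \<noteq> {}" using pair_model_zero[OF M] by blast
  ultimately show ?thesis unfolding is_structure_def by (simp add: induced_def)
qed

lemma ring_of_universe_update: "ring_of (M\<lparr>universe := A\<rparr>) = (ring_of M)\<lparr>carrier := A\<rparr>"
  by (simp add: ring_of_def)

lemma induced_universe_update: "universe (induced (M\<lparr>universe := A\<rparr>)) = A \<inter> {a. rint M P [a]}"
  by (auto simp: induced_def)

text \<open>Evaluation does not change in a subring, and the ring of coefficients can only shrink
  together with the predicate.\<close>

lemma transcendental_over_universe_update:
  assumes M: "pair_model L M" and MA: "pair_model L (M\<lparr>universe := A\<rparr>)" and A: "A \<subseteq> universe M"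
    and t: "transcendental_over M l b"
  shows "transcendental_over (M\<lparr>universe := A\<rparr>) l b"
proof -
  interpret R: algebraically_closed "ring_of M" using M unfolding pair_model_def by simp
  have "algebraically_closed (ring_of (M\<lparr>universe := A\<rparr>))" using MA unfolding pair_model_def by simp
  then interpret S: algebraically_closed "(ring_of M)\<lparr>carrier := A\<rparr>" unfolding ring_of_universe_update .
  have "subring A (ring_of M)"
    using A by (intro R.ring_incl_imp_subring S.ring_axioms) (simp add: ring_of_simps)
  then have ev: "ring.eval (ring_of (M\<lparr>universe := A\<rparr>)) = ring.eval (ring_of M)"
    unfolding ring_of_universe_update by (rule R.eval_consistent)
  have "universe (induced (M\<lparr>universe := A\<rparr>)) \<union> set l \<subseteq> universe (induced M) \<union> set l"
    using A by (auto simp: induced_universe_update in_induced)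
  from generated_mono[OF this, of M] show ?thesis
    using t unfolding transcendental_over_def ev generated_universe_update by fastforce
qed

text \<open>Atomic formulas do not look at the universe, and the locale
  \<open>back_and_forth\<close> asks for no others.\<close>

lemma sat_induced_atomic:
  assumes "(\<exists>s t. \<theta> = Eq s t) \<or> (\<exists>r ts. \<theta> = Rel r ts)"
  shows "sat (induced (M\<lparr>universe := A\<rparr>)) e \<theta> \<longleftrightarrow> sat (induced M) e \<theta>"
  using assms by (auto simp: eval_tm_induced eval_tm_universe_update cong: map_cong)
    (auto simp: induced_def)

lemma pair_axioms_sublang:
  assumes "sublang L L'"
  shows "pair_axioms L \<subseteq> pair_axioms L'"
proof -
  have "funs L' f = Some n" if "funs L f = Some n" for f n
    using assms that unfolding sublang_def map_le_def by (metis domI)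
  then have "function_axioms L \<subseteq> function_axioms L'" unfolding function_axioms_def by (intro UN_mono) auto
  moreover have "rels L' f = Some n" if "rels L f = Some n" for f n
    using assms that unfolding sublang_def map_le_def by (metis domI)
  then have "relation_axioms L \<subseteq> relation_axioms L'" unfolding relation_axioms_def by (intro Collect_mono) metis
  ultimately show ?thesis unfolding pair_axioms_def by blast
qed

lemma sublang_lang_P: "sublang L L' \<Longrightarrow> sublang (lang_P L) (lang_P L')"
  unfolding sublang_def lang_P_def map_le_def by (auto simp: dom_def split: psym.splits)

lemma pair_model_if_pair_axioms:
  assumes "is_structure (lang_P L) M" "sublang L_rings L" "\<And>\<phi>. \<phi> \<in> pair_axioms L \<Longrightarrow> holds M \<phi>"
  shows "pair_model L M"
  using pair_model_iff[OF assms(1,2)] assms(3) by simp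

text \<open>Finiteness of the language makes its formulas countable, as needed for saturation with
  countable types and for the countable closures. The predicates enter through equivalence alone, so
  no theory \<open>T\<close> appears.\<close>

theorem elementarily_equivalent_finite:
  fixes L :: "('f fsym, 'r) lang"
    and M :: "('u, 'f fsym, 'r psym) struct" and N :: "('v, 'f fsym, 'r psym) struct"
  assumes L: "sublang L_rings L" "finite (dom (funs L))" "finite (dom (rels L))"
    and M: "is_structure (lang_P L) M" "\<And>\<phi>. \<phi> \<in> pair_axioms L \<Longrightarrow> holds M \<phi>" "\<And>n. holds M (degree_ge n)"
    and N: "is_structure (lang_P L) N" "\<And>\<phi>. \<phi> \<in> pair_axioms L \<Longrightarrow> holds N \<phi>" "\<And>n. holds N (degree_ge n)"
    and eq: "\<And>\<theta>. \<theta> \<in> sentences L \<Longrightarrow> holds (induced M) \<theta> \<longleftrightarrow> holds (induced N) \<theta>"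
    and \<phi>: "\<phi> \<in> sentences (lang_P L)"
  shows "holds M \<phi> \<longleftrightarrow> holds N \<phi>"
proof -
  obtain U where "ultrafilter U" using exists_nonprincipal_ultrafilter unfolding ultrafilter_def by blast
  then interpret ultrafilter U .
  let ?M = "ultrapower M" and ?N = "ultrapower N"
  have PM: "pair_model L M" and PN: "pair_model L N"
    by (rule pair_model_if_pair_axioms[OF M(1) L(1) M(2)], assumption)
      (rule pair_model_if_pair_axioms[OF N(1) L(1) N(2)], assumption)
  have hM: "holds ?M \<psi> \<longleftrightarrow> holds M \<psi>" and hN: "holds ?N \<psi> \<longleftrightarrow> holds N \<psi>" if "fv \<psi> = {}" for \<psi>
    using holds_ultrapower[OF M(1) that] holds_ultrapower[OF N(1) that] .
  note ax = pair_axioms_sentences[OF L(1)]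
  have SM: "is_structure (lang_P L) ?M" and SN: "is_structure (lang_P L) ?N"
    using is_structure_ultrapower M(1) N(1) by blast+
  have axM: "holds ?M \<psi>" and axN: "holds ?N \<psi>" if "\<psi> \<in> pair_axioms L" for \<psi>
    using hM[of \<psi>] hN[of \<psi>] M(2) N(2) that ax by (auto simp: sentences_def)
  have PM': "pair_model L ?M" and PN': "pair_model L ?N"
    by (rule pair_model_if_pair_axioms[OF SM L(1) axM], assumption)
      (rule pair_model_if_pair_axioms[OF SN L(1) axN], assumption)
  \<comment> \<open>Infinite degree is used here, for \<open>M\<close> and \<open>N\<close>
    themselves. From the ultrapowers on it is replaced by the existence of transcendental
    elements.\<close>
  have infM: "ring.infinite_dimension (ring_of M) (universe (induced M)) (universe M)"
    using infinite_dimension_iff[of M] PM M(3) unfolding pair_model_def by simp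
  have infN: "ring.infinite_dimension (ring_of N) (universe (induced N)) (universe N)"
    using infinite_dimension_iff[of N] PN N(3) unfolding pair_model_def by simp
  have cP: "countable {\<psi>. wf_fm (lang_P L) \<psi>}" by (rule countable_wf_fm_lang_P[OF L(2,3)])
  have cL: "countable {\<psi>. wf_fm L \<psi>}" by (intro countable_wf_fm countable_finite L(2,3))
  \<comment> \<open>Relativized sentences carry the equivalence of the predicates through the
    ultrapowers.\<close>
  have eq': "holds (induced ?M) \<theta> \<longleftrightarrow> holds (induced ?N) \<theta>" if "\<theta> \<in> sentences L" for \<theta>
  proof -
    have fv: "fv \<theta> = {}" using that by (simp add: sentences_def)
    then have fv': "fv (relativize \<theta>) = {}" using fv_relativize[of \<theta>] by blast
    show ?thesis
      using holds_relativize[OF fv pair_model_zero[OF PM]] holds_relativize[OF fv pair_model_zero[OF PN]]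
        holds_relativize[OF fv pair_model_zero[OF PM']] holds_relativize[OF fv pair_model_zero[OF PN']]
        hM[OF fv'] hN[OF fv'] eq[OF that] by simp
  qed
  have "\<exists>A B e e'. elementary_subset (lang_P L) ?M A \<and> elementary_subset (lang_P L) ?N B \<and>
    range e = A \<inter> universe (induced ?M) \<and> range e' = B \<inter> universe (induced ?N) \<and>
    equivalent_on L (induced ?M) (induced ?N) UNIV e e' \<and>
    (\<forall>l. set l \<subseteq> A \<longrightarrow> (\<exists>b\<in>A. transcendental_over ?M l b)) \<and>
    (\<forall>l. set l \<subseteq> B \<longrightarrow> (\<exists>b\<in>B. transcendental_over ?N l b))"
  proof (rule exists_isomorphic_predicates)
    show "saturated ?M" "saturated ?N" by (rule saturated_ultrapower)+
    show "countable {\<theta>. wf_fm L \<theta>}" "countable {\<psi>. wf_fm (lang_P L) \<psi>}" by (fact cL cP)+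
    show "fint ?M RZero [] \<in> universe (induced ?M)" "fint ?N RZero [] \<in> universe (induced ?N)"
      by (rule pair_model_zero[OF PM'], rule pair_model_zero[OF PN'])
    show "holds (induced ?M) \<theta> \<longleftrightarrow> holds (induced ?N) \<theta>" if "\<theta> \<in> sentences L" for \<theta> using eq'[OF that] .
    show "\<exists>b\<in>universe ?M. transcendental_over ?M l b" if "set l \<subseteq> universe ?M" for l
      by (rule exists_transcendental_ultrapower[OF PM L(1) infM PM' that])
    show "\<exists>b\<in>universe ?N. transcendental_over ?N l b" if "set l \<subseteq> universe ?N" for l
      by (rule exists_transcendental_ultrapower[OF PN L(1) infN PN' that])
  qed
  then obtain A B e e' where A: "elementary_subset (lang_P L) ?M A" and B: "elementary_subset (lang_P L) ?N B"
    and e: "range e = A \<inter> universe (induced ?M)" and e': "range e' = B \<inter> universe (induced ?N)"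
    and ee': "equivalent_on L (induced ?M) (induced ?N) UNIV e e'"
    and trA: "\<forall>l. set l \<subseteq> A \<longrightarrow> (\<exists>b\<in>A. transcendental_over ?M l b)"
    and trB: "\<forall>l. set l \<subseteq> B \<longrightarrow> (\<exists>b\<in>B. transcendental_over ?N l b)"
    by (elim exE conjE)
  let ?A = "?M\<lparr>universe := A\<rparr>" and ?B = "?N\<lparr>universe := B\<rparr>"
  have AB: "A \<subseteq> universe ?M" "B \<subseteq> universe ?N" using A B unfolding elementary_subset_def by simp_all
  have hA: "holds ?A \<psi> \<longleftrightarrow> holds ?M \<psi>" and hB: "holds ?B \<psi> \<longleftrightarrow> holds ?N \<psi>" if "\<psi> \<in> sentences (lang_P L)" for \<psi>
    using holds_elementary_subset[OF A that] holds_elementary_subset[OF B that] .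
  have axA: "holds ?A \<psi>" and axB: "holds ?B \<psi>" if "\<psi> \<in> pair_axioms L" for \<psi>
    using hA[of \<psi>] hB[of \<psi>] axM axN that ax by auto
  have PA: "pair_model L ?A" and PB: "pair_model L ?B"
    by (rule pair_model_if_pair_axioms[OF is_structure_elementary_subset[OF SM A] L(1) axA], assumption)
      (rule pair_model_if_pair_axioms[OF is_structure_elementary_subset[OF SN B] L(1) axB], assumption)
  interpret back_and_forth L ?A ?B e e'
  proof
    show "pair_model L ?A" "pair_model L ?B" "sublang L_rings L" by (fact PA PB L(1))+
    show "\<exists>b\<in>universe ?A. transcendental_over ?A l b" if "set l \<subseteq> universe ?A" for l
      using trA[rule_format, of l] that transcendental_over_universe_update[OF PM' PA AB(1)] by auto
    show "\<exists>b\<in>universe ?B. transcendental_over ?B l b" if "set l \<subseteq> universe ?B" for l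
      using trB[rule_format, of l] that transcendental_over_universe_update[OF PN' PB AB(2)] by auto
    show "range e = universe (induced ?A)" "range e' = universe (induced ?B)"
      unfolding e e' induced_universe_update using AB by (auto simp: in_induced)
    show "sat (induced ?A) e \<theta> \<longleftrightarrow> sat (induced ?B) e' \<theta>"
      if "wf_fm L \<theta>" "(\<exists>s t. \<theta> = Eq s t) \<or> (\<exists>r ts. \<theta> = Rel r ts)" for \<theta>
      unfolding sat_induced_atomic[OF that(2)] using ee' that(1) unfolding equivalent_on_def by simp
  qed
  have "fv \<phi> = {}" using \<phi> by (simp add: sentences_def)
  then show ?thesis
    using elementarily_equivalent[OF \<phi>] hA[OF \<phi>] hB[OF \<phi>] hM hN by simp
qed

text \<open>Completeness of \<open>T\<close> is applied in the full language, and only the resulting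
  agreement on sentences of the finite language is passed on. This avoids having to restrict
  \<open>T\<close> itself.\<close>

theorem ACF_T_elementarily_equivalent:
  fixes L :: "('f fsym, 'r) lang"
    and M :: "('u, 'f fsym, 'r psym) struct" and N :: "('v, 'f fsym, 'r psym) struct"
  assumes L: "sublang L_rings L" and T: "complete_theory L T"
    and M: "is_model (lang_P L) M (ACF_T L T)" and N: "is_model (lang_P L) N (ACF_T L T)"
    and \<phi>: "\<phi> \<in> sentences (lang_P L)"
  shows "holds M \<phi> \<longleftrightarrow> holds N \<phi>"
proof -
  have sub: "pair_axioms L \<subseteq> ACF_T L T" unfolding pair_axioms_def ACF_T_def by blast
  have deg: "degree_ge n \<in> ACF_T L T" for n unfolding ACF_T_def by blast
  have TT: "\<theta> \<in> T \<Longrightarrow> relativize \<theta> \<in> ACF_T L T" for \<theta> unfolding ACF_T_def by blast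
  have ind: "is_model L (induced K) T" if K: "is_model (lang_P L) K (ACF_T L T)" for K :: "('w, 'f fsym, 'r psym) struct"
  proof -
    have P: "pair_model L K"
      by (rule pair_model_if_pair_axioms[OF _ L]) (use K sub in \<open>auto simp: is_model_def\<close>)
    have "holds (induced K) \<theta>" if "\<theta> \<in> T" for \<theta>
    proof -
      have "fv \<theta> = {}" using T that unfolding complete_theory_def is_theory_def sentences_def by blast
      from holds_relativize[OF this pair_model_zero[OF P]] show ?thesis
        using K TT[OF that] unfolding is_model_def by blast
    qed
    then show ?thesis unfolding is_model_def using is_structure_induced[OF P L] by blast
  qed
  obtain L0 where L0: "sublang L_rings L0" "sublang L0 L" "finite (dom (funs L0))" "finite (dom (rels L0))"
    "\<phi> \<in> sentences (lang_P L0)" by (rule finite_sublanguage[OF L \<phi>])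
  show ?thesis
  proof (rule elementarily_equivalent_finite[OF L0(1,3,4) _ _ _ _ _ _ _ L0(5)])
    show "is_structure (lang_P L0) M"
      using M unfolding is_model_def by (intro is_structure_sublang[OF sublang_lang_P[OF L0(2)]]) simp
    show "is_structure (lang_P L0) N"
      using N unfolding is_model_def by (intro is_structure_sublang[OF sublang_lang_P[OF L0(2)]]) simp
    show "holds M \<psi>" "holds N \<psi>" if "\<psi> \<in> pair_axioms L0" for \<psi>
      using that pair_axioms_sublang[OF L0(2)] sub M N unfolding is_model_def by auto
    show "holds M (degree_ge n)" "holds N (degree_ge n)" for n
      using deg M N unfolding is_model_def by auto
    show "holds (induced M) \<theta> \<longleftrightarrow> holds (induced N) \<theta>" if "\<theta> \<in> sentences L0" for \<theta>
      by (rule complete_elementarily_equivalent[OF T ind[OF M] ind[OF N]])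
        (use that sentences_sublang[OF L0(2)] in blast)
  qed
qed

section \<open>Satisfiability and conclusion\<close>

lemma wf_relativize: "wf_fm L \<phi> \<Longrightarrow> wf_fm (lang_P L) (relativize \<phi>)"
proof (induction \<phi>)
  case (Rel r ts)
  then show ?case by (auto simp: lang_P_def list_all_iff intro: wf_tm_transfer)
qed (auto simp: lang_P_def intro: wf_tm_transfer)

lemma degree_ge_sentence:
  assumes "sublang L_rings L"
  shows "degree_ge n \<in> sentences (lang_P L)"
proof -
  note fs = funs_L_rings[OF sublang_L_rings_lang_P[OF assms]]
  have "wf_tm (lang_P L) (tsum (map2 tmul (map Var [n..<2 * n]) (map Var [0..<n])))"
    by (rule wf_tsum[OF sublang_L_rings_lang_P[OF assms]]) (auto simp: fs in_set_zip)
  moreover have "rels (lang_P L) P = Some 1" by (simp add: lang_P_def)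
  ultimately have "wf_fm (lang_P L) (degree_ge n)"
    by (auto simp: degree_ge_def Let_def wf_Foralls fs intro!: wf_Existss wf_Conjs)
  then show ?thesis by (simp add: sentences_def fv_degree_ge)
qed

lemma ACF_T_sentences:
  assumes "sublang L_rings L" "is_theory L T"
  shows "is_theory (lang_P L) (ACF_T L T)"
proof -
  have "relativize \<theta> \<in> sentences (lang_P L)" if "\<theta> \<in> T" for \<theta>
    using assms(2) that wf_relativize[of L \<theta>] fv_relativize[of \<theta>] by (auto simp: is_theory_def sentences_def)
  then show ?thesis
    using pair_axioms_sentences[OF assms(1)] degree_ge_sentence[OF assms(1)]
    unfolding is_theory_def ACF_T_def pair_axioms_def by blast
qed

text \<open>The constructed model consists of sequences in the algebraic closure of a model of
  \<open>T\<close>. \<open>satisfiable_of_model\<close>, which rests on downward Loewenheim-Skolem,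
  moves it to the type of universe that \<open>satisfiable\<close> prescribes.\<close>

lemma ACF_T_satisfiable:
  fixes L :: "('f fsym, 'r) lang"
  assumes L: "sublang L_rings L" and T: "is_theory L T" "Defs.field_axioms \<subseteq> T" "satisfiable L T"
  shows "satisfiable (lang_P L) (ACF_T L T)"
proof -
  obtain K :: "('f fsym, 'r) fm_struct" where K: "is_structure L K" "\<And>\<theta>. \<theta> \<in> T \<Longrightarrow> holds K \<theta>"
    using T(3) unfolding satisfiable_def is_model_def by blast
  have FK: "field_struct K" by (rule field_struct_if_field_axioms[OF K(1) L]) (use K(2) T(2) in auto)
  then interpret FK: field "ring_of K" unfolding field_struct_def by simp
  interpret A: algebraic_closure FK.alg_closure "FK.indexed_const ` carrier (ring_of K)"
    by (rule FK.alg_closureE)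
  obtain U where "ultrafilter U" using exists_nonprincipal_ultrafilter unfolding ultrafilter_def by blast
  from ultrafilter.exists_pair_model[OF this L K(1) FK A.algebraically_closed_axioms FK.alg_closureE(2)]
  obtain E :: "(nat \<Rightarrow> ((('f fsym, 'r) fm list \<times> nat) multiset \<Rightarrow> ('f fsym, 'r) fm), 'f fsym, 'r psym) struct" where PE: "pair_model L E"
    and inf: "ring.infinite_dimension (ring_of E) (universe (induced E)) (universe E)"
    and eq: "\<And>\<theta>. \<theta> \<in> sentences L \<Longrightarrow> holds (induced E) \<theta> \<longleftrightarrow> holds K \<theta>" by blast
  have SE: "is_structure (lang_P L) E" and FE: "field_struct E"
    and sub: "subfield (universe (induced E)) (ring_of E)"
    using PE unfolding pair_model_def by simp_all
  have "holds E \<phi>" if "\<phi> \<in> pair_axioms L" for \<phi>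
    using pair_model_iff[OF SE L] PE holds_field_axioms[OF FE] that by blast
  moreover have "holds E (degree_ge n)" for n using infinite_dimension_iff[OF FE sub] inf by blast
  moreover have "holds E (relativize \<theta>)" if "\<theta> \<in> T" for \<theta>
  proof -
    have \<theta>: "\<theta> \<in> sentences L" using T(1) that unfolding is_theory_def by blast
    then have "fv \<theta> = {}" by (simp add: sentences_def)
    from holds_relativize[OF this pair_model_zero[OF PE]] show ?thesis using eq[OF \<theta>] K(2)[OF that] by simp
  qed
  ultimately have "is_model (lang_P L) E (ACF_T L T)"
    using SE unfolding is_model_def ACF_T_def pair_axioms_def by blast
  then show ?thesis by (rule satisfiable_of_model[OF ACF_T_sentences[OF L T(1)]])
qed

theorem proposition4p1:
  fixes L :: "('f fsym, 'r) lang" and T :: "('f fsym, 'r) fm set"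
  assumes "theory_of_fields L T"
    and "complete_theory L T"
  shows "complete_theory (lang_P L) (ACF_T L T)"
proof -
  have L: "sublang L_rings L" and T: "is_theory L T" "Defs.field_axioms \<subseteq> T" "satisfiable L T"
    using assms unfolding theory_of_fields_def complete_theory_def by simp_all
  \<comment> \<open>One model decides every sentence, as all other models are elementarily
    equivalent to it.\<close>
  obtain M :: "('f fsym, 'r psym) fm_struct" where M: "is_model (lang_P L) M (ACF_T L T)"
    using ACF_T_satisfiable[OF L T] unfolding satisfiable_def by blast
  have "entails (lang_P L) (ACF_T L T) \<phi> \<or> entails (lang_P L) (ACF_T L T) (Neg \<phi>)"
    if \<phi>: "\<phi> \<in> sentences (lang_P L)" for \<phi>
  proof -
    have eq: "holds N \<phi> \<longleftrightarrow> holds M \<phi>" if "is_model (lang_P L) N (ACF_T L T)" for N :: "('f fsym, 'r psym) fm_struct"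
      by (rule ACF_T_elementarily_equivalent[OF L assms(2) that M \<phi>])
    have "holds N (Neg \<phi>)" if N: "is_model (lang_P L) N (ACF_T L T)" and "\<not> holds M \<phi>" for N :: "('f fsym, 'r psym) fm_struct"
    proof -
      have "\<not> holds N \<phi>" using eq[OF N] that(2) by simp
      moreover have "fv \<phi> = {}" using \<phi> by (simp add: sentences_def)
      ultimately show ?thesis using holds_iff_sat[of \<phi> _ N] unfolding holds_def by auto
    qed
    then show ?thesis using eq unfolding entails_def by blast
  qed
  then show ?thesis
    using ACF_T_sentences[OF L T(1)] ACF_T_satisfiable[OF L T] unfolding complete_theory_def by blast
qed

end
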